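(* Let $(S,\Pi_S)$ be an embedded Poisson submanifold of a Poisson manifold $(M,\Pi)$ with normal bundle $E=T_SM/TS$, and $H\in C^\infty(M)$. Fix a transversal $\mathscr L\subset T_SM$ of $S$ and consider the element $h\oplus\eta^{\mathscr L}\in C^\infty(S)\oplus\Gamma E^*$ representing $\mathrm{var}_SX_H$. If a vector bundle morphism $\mu:T^*S\to E^*$ satisfies the equation $$\big(\mathbf i_{\mathrm dh}\circ\mathscr D^{\mathscr L}+\mathrm{ad}_{\eta^{\mathscr L}}+\mathscr D^{\mathscr L}\circ\mathbf i_{\mathrm dh}\big)(\mu)=\mathscr D^{\mathscr L}\eta^{\mathscr L}-\mathbf i_{\mathrm dh}\mathscr K^{\mathscr L},$$ then $\mathrm{var}_SX_H$ is a Hamiltonian derivation with respect to the Poisson bracket $\{,\}^{\widetilde{\mathscr L}}$ on $C^\infty_{\mathrm{aff}}(E)$ associated to the transversal $\widetilde{\mathscr L}=(\mathrm{id}+\delta)(\mathscr L)$, where the vector bundle morphism $\delta:\mathscr L\to TS$ is determined by $$\mu=-\big((\nu|_{\mathscr L})^*\big)^{-1}\circ\delta^*.$$ The corresponding Hamiltonian is $H^{\mathrm{aff}}_{\widetilde{\mathscr L}}=\pi^*h+\ell_{(\eta^{\mathscr L}-\mu(\mathrm dh))}$, i.e. $\mathrm L_{\mathrm{var}_SX_H}\phi=\{H^{\mathrm{aff}}_{\widetilde{\mathscr L}},\phi\}^{\widetilde{\mathscr L}}$ for all $\phi\in C^\infty_{\mathrm{aff}}(E)$.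
   Context: **Poisson submanifold.** $\{f,g\}_M=\Pi(\mathrm df,\mathrm dg)$; $\Pi^\natural(\alpha)=\mathbf i_\alpha\Pi$, so $\beta(\Pi^\natural\alpha)=\Pi(\alpha,\beta)$; $X_H=\Pi^\natural\mathrm dH$. A submanifold $S$ is Poisson if $\Pi_q\in\wedge^2T_qS$ for all $q\in S$; it then carries the restricted Poisson tensor $\Pi_S$ with bracket $\{,\}_S$, and every $X_H$ is tangent to $S$. $T_SM=TM|_S$, $T^*_SM=T^*M|_S$; $TS^\circ\subset T^*_SM$ is the annihilator of $TS$. $\pi:E\to S$ is the normal bundle, $\nu:T_SM\to E$ the quotient projection; $\nu^*:E^*\to T_S^*M$ is an isomorphism onto $TS^\circ$. **Infinitesimal data.** The bracket of 1-forms on $M$ is $[\alpha,\beta]_A=\mathbf i_{\Pi^\natural(\alpha)}\mathrm d\beta-\mathbf i_{\Pi^\natural(\beta)}\mathrm d\alpha-\mathrm d\langle\alpha,\Pi^\natural(\beta)\rangle$; $[,]_{T^*S}$ is the analogous bracket of 1-forms on $(S,\Pi_S)$. The restricted Lie algebroid $A_S=(T^*_SM,[,]_{A_S},\Pi^\natural|_S)$ has the unique bracket for which the restriction map $\Gamma T^*M\to\Gamma T^*_SM$ is a Lie algebra homomorphism; $TS^\circ$ is an ideal with zero anchor. The fiberwise Lie bracket on $E^*$ is defined by $\nu^*[\eta_1,\eta_2]_{E^*}=[\nu^*\eta_1,\nu^*\eta_2]_{A_S}$; $\mathrm{ad}_\eta=[\eta,\cdot]_{E^*}$. **Affine functions.**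 $C^\infty_{\mathrm{aff}}(E)=\pi^*C^\infty(S)\oplus C^\infty_{\mathrm{lin}}(E)\simeq C^\infty(S)\oplus\Gamma E^*$, where $f\oplus\eta$ corresponds to $\pi^*f+\ell_\eta$, $\ell_\eta(z)=\langle\eta_{\pi(z)},z\rangle$. **Algebra of a transversal.** A transversal of $S$ is a subbundle $\mathscr L\subset T_SM$ with $T_SM=TS\oplus\mathscr L$. Then $T^*_SM=\mathscr L^\circ\oplus TS^\circ$; let $\varrho_{\mathscr L}:T_S^*M\to TS^\circ$ be the projection along $\mathscr L^\circ$, and $\tau_{\mathscr L}:T^*S\to\mathscr L^\circ$ the isomorphism sending $\alpha$ to the element of $\mathscr L^\circ$ which restricts to $\alpha$ on $TS$. Define $\nu^*(\mathscr D^{\mathscr L}_\alpha\eta)=[\tau_{\mathscr L}(\alpha),\nu^*\eta]_{A_S}$ and $\nu^*(\mathscr K^{\mathscr L}(\alpha,\beta))=\varrho_{\mathscr L}([\tau_{\mathscr L}(\alpha),\tau_{\mathscr L}(\beta)]_{A_S})$ for $\alpha,\beta\in\Gamma T^*S$, $\eta\in\Gamma E^*$, and $$\{f_1\oplus\eta_1,f_2\oplus\eta_2\}^{\mathscr L}=\{f_1,f_2\}_S\oplus\big(\mathscr D^{\mathscr L}_{\mathrm df_1}\eta_2-\mathscr D^{\mathscr L}_{\mathrm df_2}\eta_1+[\eta_1,\eta_2]_{E^*}+\mathscr K^{\mathscr L}(\mathrm df_1,\mathrm df_2)\big).$$ **First variation system.** An exponential map is a diffeomorphism $\mathbf e$ from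 $E$ onto a neighborhood of $S$ in $M$ with $\mathbf e|_S=\mathrm{id}_S$ and such that $E_q\hookrightarrow T_qE\xrightarrow{\mathrm d_q\mathbf e}T_qM\xrightarrow{\nu_q}E_q$ is the identity for each $q\in S$; it is compatible with $\mathscr L$ if $\mathscr L_q=(\mathrm d_q\mathbf e)(E_q)$ for all $q\in S$. With $\rho_\varepsilon:E\to E$ fiberwise multiplication by $\varepsilon>0$ and $\mathbf e_\varepsilon=\mathbf e\circ\rho_\varepsilon$, one sets $\mathrm{var}_SX_H=\lim_{\varepsilon\to0}\mathbf e_\varepsilon^*X_H$, a linear vector field on $E$ independent of $\mathbf e$. The element $h\oplus\eta^{\mathscr L}$ is given by $h=H|_S$ and $\eta^{\mathscr L}_q=\mathrm d_q(H\circ\mathbf e)|_{E_q}$, for $\mathbf e$ compatible with $\mathscr L$ (using $T_SE=TS\oplus E$). **Operators in the equation.** $(\mathscr D^{\mathscr L}\mu)(\alpha_1,\alpha_2)=\mathscr D^{\mathscr L}_{\alpha_1}\mu(\alpha_2)-\mathscr D^{\mathscr L}_{\alpha_2}\mu(\alpha_1)-\mu([\alpha_1,\alpha_2]_{T^*S})$; $(\mathbf i_{\mathrm dh}\mathscr D^{\mathscr L}\mu)(\alpha)=(\mathscr D^{\mathscr L}\mu)(\mathrm dh,\alpha)$; $(\mathrm{ad}_{\eta}\mu)(\alpha)=[\eta,\mu(\alpha)]_{E^*}$; $\mathbf i_{\mathrm dh}\mu=\mu(\mathrm dh)\in\Gamma E^*$; for $\xi\in\Gamma E^*$, $(\mathscr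 D^{\mathscr L}\xi)(\alpha)=\mathscr D^{\mathscr L}_\alpha\xi$; $(\mathbf i_{\mathrm dh}\mathscr K^{\mathscr L})(\alpha)=\mathscr K^{\mathscr L}(\mathrm dh,\alpha)$. Equivalently, the equation says $\mathscr D^{\mathscr L}_{\mathrm dh}\mu(\alpha)-\mu([\mathrm dh,\alpha]_{T^*S})+[\eta^{\mathscr L},\mu(\alpha)]_{E^*}=\mathscr D^{\mathscr L}_\alpha\eta^{\mathscr L}-\mathscr K^{\mathscr L}(\mathrm dh,\alpha)$ for all $\alpha\in\Gamma T^*S$. Here $(\nu|_{\mathscr L})^*:E^*\to\mathscr L^*$ and $\delta^*:T^*S\to\mathscr L^*$ are the adjoints. *)

theory Defs
  imports "HOL-Analysis.Analysis" "HOL-Library.Function_Algebras"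
begin

text \<open>Tangent vectors are derivations, hence functions with values in the reals; the pointwise
  vector space structure makes \<^const>\<open>subspace\<close>, \<^const>\<open>span\<close> etc. available for them.\<close>

instantiation "fun" :: (type, real_vector) real_vector
begin

definition scaleR_fun :: "real \<Rightarrow> ('a \<Rightarrow> 'b) \<Rightarrow> 'a \<Rightarrow> 'b"
  where "scaleR_fun r f = (\<lambda>x. r *\<^sub>R f x)"

instance
  by standard
    (simp_all add: scaleR_fun_def plus_fun_def fun_eq_iff scaleR_add_right scaleR_add_left)

end

definition zero_ext :: "'a set \<Rightarrow> ('a \<Rightarrow> 'b::zero) \<Rightarrow> 'a \<Rightarrow> 'b"
  where "zero_ext A f = (\<lambda>x. if x \<in> A then f x else 0)"

definition linear_over :: "'a::real_vector set \<Rightarrow> ('a \<Rightarrow> 'b::real_vector) \<Rightarrow> bool"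
  where "linear_over A f \<longleftrightarrow>
    (\<forall>x\<in>A. \<forall>y\<in>A. f (x + y) = f x + f y) \<and> (\<forall>c. \<forall>x\<in>A. f (c *\<^sub>R x) = c *\<^sub>R f x)"

text \<open>The dual of a linear subspace.  Functionals are normalised to vanish off the subspace, so
  that equality of functionals is equality in HOL.\<close>

definition dual_space :: "'a::real_vector set \<Rightarrow> ('a \<Rightarrow> real) set"
  where "dual_space A = {\<alpha>. linear_over A \<alpha> \<and> (\<forall>v. v \<notin> A \<longrightarrow> \<alpha> v = 0)}"


section \<open>Smooth manifolds\<close>

text \<open>Manifolds are modelled on a linear subspace \<open>V\<close> of a Euclidean space rather than on
  the whole space, so that all dimensions (including 0) occur and a submanifold may be modelled on a
  subspace of \<open>V\<close>.  Differentiability classes below are for functions on relatively open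
  subsets \<open>A\<close> of \<open>V\<close>; on such a set the values of a derivative on \<open>V\<close> are unique.\<close>

primrec Ck_on :: "nat \<Rightarrow> 'v::real_normed_vector set \<Rightarrow> 'v set \<Rightarrow> ('v \<Rightarrow> 'b::real_normed_vector) \<Rightarrow> bool"
  where
    "Ck_on 0 V A f \<longleftrightarrow> continuous_on A f"
  | "Ck_on (Suc k) V A f \<longleftrightarrow>
      (\<exists>D. (\<forall>x\<in>A. (f has_derivative D x) (at x within A)) \<and> (\<forall>v\<in>V. Ck_on k V A (\<lambda>x. D x v)))"

definition smooth_on :: "'v::real_normed_vector set \<Rightarrow> 'v set \<Rightarrow> ('v \<Rightarrow> 'b::real_normed_vector) \<Rightarrow> bool"
  where "smooth_on V A f \<longleftrightarrow> openin (top_of_set V) A \<and> (\<forall>k. Ck_on k V A f)"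

type_synonym ('a, 'v) chart = "'a set \<times> ('a \<Rightarrow> 'v)"

record ('a, 'v) mfd =
  points :: "'a set"
  model :: "'v set"
  atlas :: "('a, 'v) chart set"

definition chart_on :: "'a set \<Rightarrow> 'v::euclidean_space set \<Rightarrow> ('a, 'v) chart \<Rightarrow> bool"
  where "chart_on X V = (\<lambda>(U, \<phi>). U \<subseteq> X \<and> inj_on \<phi> U \<and> openin (top_of_set V) (\<phi> ` U))"

definition smooth_transition :: "'v::euclidean_space set \<Rightarrow> ('a, 'v) chart \<Rightarrow> ('a, 'v) chart \<Rightarrow> bool"
  where "smooth_transition V = (\<lambda>(U, \<phi>) (U', \<psi>). smooth_on V (\<phi> ` (U \<inter> U')) (\<psi> \<circ> inv_into U \<phi>))"

definition charts :: "('a, 'v::euclidean_space) mfd \<Rightarrow> ('a, 'v) chart set"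
  \<comment> \<open>the maximal atlas\<close>
  where "charts M = {c. chart_on (points M) (model M) c \<and>
    (\<forall>d\<in>atlas M. smooth_transition (model M) c d \<and> smooth_transition (model M) d c)}"

definition mfd_topology :: "('a, 'v::euclidean_space) mfd \<Rightarrow> 'a topology"
  where "mfd_topology M = topology (\<lambda>G. G \<subseteq> points M \<and>
    (\<forall>(U, \<phi>)\<in>atlas M. openin (top_of_set (model M)) (\<phi> ` (G \<inter> U))))"

definition smooth_manifold :: "('a, 'v::euclidean_space) mfd \<Rightarrow> bool"
  where "smooth_manifold M \<longleftrightarrow>
    subspace (model M) \<and> atlas M \<subseteq> charts M \<and> (\<Union>(U, \<phi>)\<in>atlas M. U) = points M \<and>
    Hausdorff_space (mfd_topology M) \<and> second_countable (mfd_topology M)"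

definition smooth_fun_at :: "('a, 'v::euclidean_space) mfd \<Rightarrow> 'a \<Rightarrow> ('a \<Rightarrow> real) \<Rightarrow> bool"
  \<comment> \<open>smoothness in a neighbourhood of \<open>p\<close>; values off \<open>points M\<close> are irrelevant\<close>
  where "smooth_fun_at M p f \<longleftrightarrow>
    (\<exists>(U, \<phi>)\<in>charts M. p \<in> U \<and> smooth_on (model M) (\<phi> ` U) (f \<circ> inv_into U \<phi>))"

definition smooth_funs :: "('a, 'v::euclidean_space) mfd \<Rightarrow> ('a \<Rightarrow> real) set"
  where "smooth_funs M = {f. \<forall>p\<in>points M. smooth_fun_at M p f}"

definition smooth_map_at ::
    "('a, 'v::euclidean_space) mfd \<Rightarrow> ('b, 'w::euclidean_space) mfd \<Rightarrow> 'a \<Rightarrow> ('a \<Rightarrow> 'b) \<Rightarrow> bool"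
  where "smooth_map_at M N p F \<longleftrightarrow>
    (\<exists>(U, \<phi>)\<in>charts M. \<exists>(U', \<psi>)\<in>charts N. p \<in> U \<and> F ` U \<subseteq> U' \<and>
       smooth_on (model M) (\<phi> ` U) (\<psi> \<circ> F \<circ> inv_into U \<phi>))"


section \<open>Tangent and cotangent vectors\<close>

type_synonym 'a tvec = "('a \<Rightarrow> real) \<Rightarrow> real"
type_synonym 'a covec = "'a tvec \<Rightarrow> real"

text \<open>Tangent vectors at \<open>p\<close> are the derivations of the algebra of functions that are smooth
  near \<open>p\<close>.  The product rule, applied to indicator functions of neighbourhoods, forces
  them to depend on germs only, and in particular not on values off the manifold.\<close>

definition tangent_space :: "('a, 'v::euclidean_space) mfd \<Rightarrow> 'a \<Rightarrow> 'a tvec set"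
  where "tangent_space M p = {v.
    (\<forall>f. \<not> smooth_fun_at M p f \<longrightarrow> v f = 0) \<and>
    (\<forall>f g. smooth_fun_at M p f \<longrightarrow> smooth_fun_at M p g \<longrightarrow>
       v (f + g) = v f + v g \<and> v (f * g) = v f * g p + f p * v g) \<and>
    (\<forall>c f. smooth_fun_at M p f \<longrightarrow> v (c *\<^sub>R f) = c * v f)}"

definition cotangent_space :: "('a, 'v::euclidean_space) mfd \<Rightarrow> 'a \<Rightarrow> 'a covec set"
  where "cotangent_space M p = dual_space (tangent_space M p)"

definition differential ::
    "('b, 'w::euclidean_space) mfd \<Rightarrow> ('a \<Rightarrow> 'b) \<Rightarrow> 'a \<Rightarrow> 'a tvec \<Rightarrow> 'b tvec"
  \<comment> \<open>\<open>N\<close> is the target manifold\<close>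
  where "differential N F p v = (\<lambda>g. if smooth_fun_at N (F p) g then v (g \<circ> F) else 0)"

definition dfun :: "('a, 'v::euclidean_space) mfd \<Rightarrow> ('a \<Rightarrow> real) \<Rightarrow> 'a \<Rightarrow> 'a covec"
  where "dfun M f p = zero_ext (tangent_space M p) (\<lambda>v. v f)"

definition coord_vec :: "('a, 'v::euclidean_space) mfd \<Rightarrow> ('a, 'v) chart \<Rightarrow> 'a \<Rightarrow> 'v \<Rightarrow> 'a tvec"
  \<comment> \<open>the coordinate vector at \<open>p\<close> in the direction \<open>u\<close> of the model space\<close>
  where "coord_vec M = (\<lambda>(U, \<phi>) p u f.
    if smooth_fun_at M p f then deriv (\<lambda>t. f (inv_into U \<phi> (\<phi> p + t *\<^sub>R u))) 0 else 0)"

definition vec_coords :: "('a, 'v::euclidean_space) chart \<Rightarrow> 'a tvec \<Rightarrow> 'v"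
  where "vec_coords c v = (\<Sum>b\<in>Basis. v (\<lambda>x. snd c x \<bullet> b) *\<^sub>R b)"


section \<open>Sections along a submanifold\<close>

text \<open>In \<open>smooth_vec_at M S q X\<close> and \<open>smooth_covec_at M S q a\<close> the fields are
  sections of the restrictions of \<open>TM\<close> and \<open>T*M\<close> to \<open>S\<close>, defined
  and smooth near \<open>q\<close> in \<open>S\<close>.  For \<open>S = M\<close> these are vector fields and 1-forms.\<close>

definition smooth_vec_at ::
    "('a, 'v::euclidean_space) mfd \<Rightarrow> ('a, 'v) mfd \<Rightarrow> 'a \<Rightarrow> ('a \<Rightarrow> 'a tvec) \<Rightarrow> bool"
  where "smooth_vec_at M S q X \<longleftrightarrow>
    (\<exists>G. openin (mfd_topology S) G \<and> q \<in> G \<and> (\<forall>x\<in>G. X x \<in> tangent_space M x)) \<and>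
    (\<forall>f. smooth_fun_at M q f \<longrightarrow> smooth_fun_at S q (\<lambda>x. X x f))"

definition smooth_covec_at ::
    "('a, 'v::euclidean_space) mfd \<Rightarrow> ('a, 'v) mfd \<Rightarrow> 'a \<Rightarrow> ('a \<Rightarrow> 'a covec) \<Rightarrow> bool"
  where "smooth_covec_at M S q a \<longleftrightarrow>
    (\<exists>G. openin (mfd_topology S) G \<and> q \<in> G \<and> (\<forall>x\<in>G. a x \<in> cotangent_space M x)) \<and>
    (\<forall>X. smooth_vec_at M S q X \<longrightarrow> smooth_fun_at S q (\<lambda>x. a x (X x)))"

definition one_forms :: "('a, 'v::euclidean_space) mfd \<Rightarrow> ('a \<Rightarrow> 'a covec) set"
  where "one_forms M = {\<alpha>. \<forall>p\<in>points M. smooth_covec_at M M p \<alpha>}"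


section \<open>Poisson manifolds and the bracket of 1-forms\<close>

type_synonym 'a bivec = "'a covec \<Rightarrow> 'a covec \<Rightarrow> real"

definition bivector_at :: "('a, 'v::euclidean_space) mfd \<Rightarrow> 'a \<Rightarrow> 'a bivec \<Rightarrow> bool"
  where "bivector_at M p B \<longleftrightarrow>
    (\<forall>\<alpha>\<in>cotangent_space M p. linear_over (cotangent_space M p) (B \<alpha>)) \<and>
    (\<forall>\<alpha>\<in>cotangent_space M p. \<forall>\<beta>\<in>cotangent_space M p. B \<alpha> \<beta> = - B \<beta> \<alpha>)"

definition poisson_bracket ::
    "('a, 'v::euclidean_space) mfd \<Rightarrow> ('a \<Rightarrow> 'a bivec) \<Rightarrow> ('a \<Rightarrow> real) \<Rightarrow> ('a \<Rightarrow> real) \<Rightarrow> 'a \<Rightarrow> real"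
  where "poisson_bracket M P f g = (\<lambda>p. P p (dfun M f p) (dfun M g p))"

definition poisson_manifold :: "('a, 'v::euclidean_space) mfd \<Rightarrow> ('a \<Rightarrow> 'a bivec) \<Rightarrow> bool"
  where "poisson_manifold M P \<longleftrightarrow>
    smooth_manifold M \<and>
    (\<forall>p\<in>points M. bivector_at M p (P p)) \<and>
    (\<forall>p\<in>points M. \<forall>f g. smooth_fun_at M p f \<longrightarrow> smooth_fun_at M p g \<longrightarrow>
       smooth_fun_at M p (poisson_bracket M P f g)) \<and>
    (\<forall>f\<in>smooth_funs M. \<forall>g\<in>smooth_funs M. \<forall>h\<in>smooth_funs M. \<forall>p\<in>points M.
       poisson_bracket M P f (poisson_bracket M P g h) p
       + poisson_bracket M P g (poisson_bracket M P h f) p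
       + poisson_bracket M P h (poisson_bracket M P f g) p = 0)"

definition sharp :: "('a, 'v::euclidean_space) mfd \<Rightarrow> ('a \<Rightarrow> 'a bivec) \<Rightarrow> 'a \<Rightarrow> 'a covec \<Rightarrow> 'a tvec"
  where "sharp M P p \<alpha> = (\<lambda>f. if smooth_fun_at M p f then P p \<alpha> (dfun M f p) else 0)"

definition hamiltonian_vf ::
    "('a, 'v::euclidean_space) mfd \<Rightarrow> ('a \<Rightarrow> 'a bivec) \<Rightarrow> ('a \<Rightarrow> real) \<Rightarrow> 'a \<Rightarrow> 'a tvec"
  where "hamiltonian_vf M P H p = sharp M P p (dfun M H p)"

text \<open>The exterior derivative of a 1-form at \<open>p\<close>, computed by extending the two arguments to
  fields with constant coefficients, hence commuting, in some chart around \<open>p\<close>.\<close>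

definition ext_deriv ::
    "('a, 'v::euclidean_space) mfd \<Rightarrow> ('a \<Rightarrow> 'a covec) \<Rightarrow> 'a \<Rightarrow> 'a tvec \<Rightarrow> 'a tvec \<Rightarrow> real"
  where "ext_deriv M \<beta> p v w =
    (let c = (SOME c. c \<in> charts M \<and> p \<in> fst c)
     in v (\<lambda>x. \<beta> x (coord_vec M c x (vec_coords c w)))
        - w (\<lambda>x. \<beta> x (coord_vec M c x (vec_coords c v))))"

definition oneform_bracket ::
    "('a, 'v::euclidean_space) mfd \<Rightarrow> ('a \<Rightarrow> 'a bivec) \<Rightarrow> ('a \<Rightarrow> 'a covec) \<Rightarrow> ('a \<Rightarrow> 'a covec)
      \<Rightarrow> 'a \<Rightarrow> 'a covec"
  where "oneform_bracket M P \<alpha> \<beta> p = zero_ext (tangent_space M p) (\<lambda>v.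
     ext_deriv M \<beta> p (sharp M P p (\<alpha> p)) v
     - ext_deriv M \<alpha> p (sharp M P p (\<beta> p)) v
     - dfun M (\<lambda>x. \<alpha> x (sharp M P x (\<beta> x))) p v)"


section \<open>Embedded Poisson submanifolds\<close>

definition adapted_charts :: "('a, 'v::euclidean_space) mfd \<Rightarrow> ('a, 'v) mfd \<Rightarrow> ('a, 'v) chart set"
  where "adapted_charts M S = {(U, \<phi>). (U, \<phi>) \<in> charts M \<and>
    \<phi> ` (U \<inter> points S) = \<phi> ` U \<inter> model S \<and> (U \<inter> points S, \<phi>) \<in> charts S}"

definition embedded_submanifold :: "('a, 'v::euclidean_space) mfd \<Rightarrow> ('a, 'v) mfd \<Rightarrow> bool"
  where "embedded_submanifold M S \<longleftrightarrow>
    smooth_manifold M \<and> smooth_manifold S \<and> points S \<subseteq> points M \<and> model S \<subseteq> model M \<and>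
    (\<forall>q\<in>points S. \<exists>(U, \<phi>)\<in>adapted_charts M S. q \<in> U)"

definition incl :: "('a, 'v::euclidean_space) mfd \<Rightarrow> 'a \<Rightarrow> 'a tvec \<Rightarrow> 'a tvec"
  \<comment> \<open>the differential at \<open>q\<close> of the inclusion of a submanifold into \<open>M\<close>\<close>
  where "incl M q = differential M id q"

definition tan_sub :: "('a, 'v::euclidean_space) mfd \<Rightarrow> ('a, 'v) mfd \<Rightarrow> 'a \<Rightarrow> 'a tvec set"
  \<comment> \<open>the tangent space of \<open>S\<close> as a subspace of that of \<open>M\<close>\<close>
  where "tan_sub M S q = incl M q ` tangent_space S q"

definition restrict_covec ::
    "('a, 'v::euclidean_space) mfd \<Rightarrow> ('a, 'v) mfd \<Rightarrow> 'a \<Rightarrow> 'a covec \<Rightarrow> 'a covec"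
  where "restrict_covec M S q a = zero_ext (tangent_space S q) (\<lambda>w. a (incl M q w))"

text \<open>The last clause says that \<open>P q\<close> is the image of the bivector \<open>PS q\<close> of \<open>S\<close>,
  i.e. it lies in the second exterior power of the tangent space of \<open>S\<close>, and that
  \<open>PS\<close> is the restricted tensor.\<close>

definition poisson_submanifold ::
    "('a, 'v::euclidean_space) mfd \<Rightarrow> ('a \<Rightarrow> 'a bivec) \<Rightarrow> ('a, 'v) mfd \<Rightarrow> ('a \<Rightarrow> 'a bivec) \<Rightarrow> bool"
  where "poisson_submanifold M P S PS \<longleftrightarrow>
    embedded_submanifold M S \<and>
    (\<forall>q\<in>points S. bivector_at S q (PS q) \<and>
      (\<forall>\<alpha>\<in>cotangent_space M q. \<forall>\<beta>\<in>cotangent_space M q.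
         P q \<alpha> \<beta> = PS q (restrict_covec M S q \<alpha>) (restrict_covec M S q \<beta>)))"

text \<open>The bracket on sections of the restricted cotangent bundle for which restriction of 1-forms
  is a homomorphism.  A section over a submanifold that is not closed need not extend to all of
  \<open>M\<close>, but Lie algebroid brackets are local, so local extensions determine the bracket.\<close>

definition restricted_bracket ::
    "('a, 'v::euclidean_space) mfd \<Rightarrow> ('a \<Rightarrow> 'a bivec) \<Rightarrow> ('a, 'v) mfd \<Rightarrow> ('a \<Rightarrow> 'a covec)
      \<Rightarrow> ('a \<Rightarrow> 'a covec) \<Rightarrow> 'a \<Rightarrow> 'a covec"
  where "restricted_bracket M P S a b q =
    (SOME c. \<exists>\<alpha> \<beta>. smooth_covec_at M M q \<alpha> \<and> smooth_covec_at M M q \<beta> \<and>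
       (\<exists>G. openin (mfd_topology S) G \<and> q \<in> G \<and> (\<forall>x\<in>G. \<alpha> x = a x \<and> \<beta> x = b x)) \<and>
       c = oneform_bracket M P \<alpha> \<beta> q)"


section \<open>The normal bundle\<close>

text \<open>A point of the normal bundle is a pair \<open>(q, c)\<close> with \<open>c\<close> a coset of
  \<open>tan_sub M S q\<close> in the tangent space of \<open>M\<close>.\<close>

definition nu :: "('a, 'v::euclidean_space) mfd \<Rightarrow> ('a, 'v) mfd \<Rightarrow> 'a \<Rightarrow> 'a tvec \<Rightarrow> 'a tvec set"
  where "nu M S q v = (\<lambda>s. v + s) ` tan_sub M S q"

definition normal_fibre :: "('a, 'v::euclidean_space) mfd \<Rightarrow> ('a, 'v) mfd \<Rightarrow> 'a \<Rightarrow> 'a tvec set set"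
  where "normal_fibre M S q = nu M S q ` tangent_space M q"

text \<open>An adapted chart \<open>(U, \<phi>)\<close> trivialises the bundle over the part of \<open>S\<close> in \<open>U\<close>:
  each coset has a unique representative whose coordinates are orthogonal to the
  model space of \<open>S\<close>.\<close>

definition normal_chart ::
    "('a, 'v::euclidean_space) mfd \<Rightarrow> ('a, 'v) mfd \<Rightarrow> ('a, 'v) chart \<Rightarrow> ('a \<times> 'a tvec set, 'v) chart"
  where "normal_chart M S = (\<lambda>(U, \<phi>).
    ({(q, c). q \<in> U \<inter> points S \<and> c \<in> normal_fibre M S q},
     \<lambda>(q, c). \<phi> q + (THE y. y \<in> model M \<and> (\<forall>w\<in>model S. orthogonal y w) \<and>
                            coord_vec M (U, \<phi>) q y \<in> c)))"

definition normal_bundle ::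
    "('a, 'v::euclidean_space) mfd \<Rightarrow> ('a, 'v) mfd \<Rightarrow> ('a \<times> 'a tvec set, 'v) mfd"
  where "normal_bundle M S =
    \<lparr>points = {(q, c). q \<in> points S \<and> c \<in> normal_fibre M S q},
     model = model M,
     atlas = normal_chart M S ` adapted_charts M S\<rparr>"

definition zero_normal :: "('a, 'v::euclidean_space) mfd \<Rightarrow> ('a, 'v) mfd \<Rightarrow> 'a \<Rightarrow> 'a \<times> 'a tvec set"
  where "zero_normal M S q = (q, tan_sub M S q)"

definition scale_normal ::
    "('a, 'v::euclidean_space) mfd \<Rightarrow> ('a, 'v) mfd \<Rightarrow> real \<Rightarrow> 'a \<times> 'a tvec set \<Rightarrow> 'a \<times> 'a tvec set"
  where "scale_normal M S t = (\<lambda>(q, c). (q, {t *\<^sub>R v + s |v s. v \<in> c \<and> s \<in> tan_sub M S q}))"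

definition vert ::
    "('a, 'v::euclidean_space) mfd \<Rightarrow> ('a, 'v) mfd \<Rightarrow> 'a \<times> 'a tvec set \<Rightarrow> ('a \<times> 'a tvec set) tvec"
  \<comment> \<open>the embedding of the fibre through \<open>z\<close> into the tangent space of \<open>E\<close> at the zero section\<close>
  where "vert M S z = (\<lambda>g. if smooth_fun_at (normal_bundle M S) (zero_normal M S (fst z)) g
                           then deriv (\<lambda>t. g (scale_normal M S t z)) 0 else 0)"

text \<open>The dual fibre; the vector space structure of the quotient is the one making
  \<open>nu\<close> linear.\<close>

definition conormal_fibre ::
    "('a, 'v::euclidean_space) mfd \<Rightarrow> ('a, 'v) mfd \<Rightarrow> 'a \<Rightarrow> ('a tvec set \<Rightarrow> real) set"
  where "conormal_fibre M S q = {\<xi>. linear_over (tangent_space M q) (\<lambda>v. \<xi> (nu M S q v)) \<and>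
    (\<forall>c. c \<notin> normal_fibre M S q \<longrightarrow> \<xi> c = 0)}"

definition nu_star ::
    "('a, 'v::euclidean_space) mfd \<Rightarrow> ('a, 'v) mfd \<Rightarrow> 'a \<Rightarrow> ('a tvec set \<Rightarrow> real) \<Rightarrow> 'a covec"
  where "nu_star M S q \<xi> = zero_ext (tangent_space M q) (\<lambda>v. \<xi> (nu M S q v))"

definition nu_star_inv ::
    "('a, 'v::euclidean_space) mfd \<Rightarrow> ('a, 'v) mfd \<Rightarrow> 'a \<Rightarrow> 'a covec \<Rightarrow> 'a tvec set \<Rightarrow> real"
  where "nu_star_inv M S q = inv_into (conormal_fibre M S q) (nu_star M S q)"

type_synonym 'a conormal = "'a \<Rightarrow> 'a tvec set \<Rightarrow> real"

abbreviation nu_star_sec ::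
    "('a, 'v::euclidean_space) mfd \<Rightarrow> ('a, 'v) mfd \<Rightarrow> 'a conormal \<Rightarrow> 'a \<Rightarrow> 'a covec"
  where "nu_star_sec M S \<eta> \<equiv> (\<lambda>q. nu_star M S q (\<eta> q))"

definition conormal_sections ::
    "('a, 'v::euclidean_space) mfd \<Rightarrow> ('a, 'v) mfd \<Rightarrow> 'a conormal set"
  where "conormal_sections M S = {\<eta>. \<forall>q\<in>points S.
    \<eta> q \<in> conormal_fibre M S q \<and> smooth_covec_at M S q (nu_star_sec M S \<eta>)}"

definition conormal_bracket ::
    "('a, 'v::euclidean_space) mfd \<Rightarrow> ('a \<Rightarrow> 'a bivec) \<Rightarrow> ('a, 'v) mfd \<Rightarrow> 'a conormal \<Rightarrow> 'a conormal
      \<Rightarrow> 'a conormal"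
  where "conormal_bracket M P S \<eta>1 \<eta>2 q =
    nu_star_inv M S q (restricted_bracket M P S (nu_star_sec M S \<eta>1) (nu_star_sec M S \<eta>2) q)"


section \<open>Transversals and the bracket on affine functions\<close>

definition transversal ::
    "('a, 'v::euclidean_space) mfd \<Rightarrow> ('a, 'v) mfd \<Rightarrow> ('a \<Rightarrow> 'a tvec set) \<Rightarrow> bool"
  where "transversal M S L \<longleftrightarrow>
    (\<forall>q\<in>points S. subspace (L q) \<and> L q \<subseteq> tangent_space M q \<and> tan_sub M S q \<inter> L q = {0} \<and>
       tangent_space M q = {s + l |s l. s \<in> tan_sub M S q \<and> l \<in> L q}) \<and>
    (\<forall>q\<in>points S. \<exists>m (X :: nat \<Rightarrow> 'a \<Rightarrow> 'a tvec) G.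
       openin (mfd_topology S) G \<and> q \<in> G \<and> (\<forall>i<m. smooth_vec_at M S q (X i)) \<and>
       (\<forall>x\<in>G. inj_on (\<lambda>i. X i x) {..<m} \<and> independent ((\<lambda>i. X i x) ` {..<m}) \<and>
              L x = span ((\<lambda>i. X i x) ` {..<m})))"

definition annihilator ::
    "('a, 'v::euclidean_space) mfd \<Rightarrow> 'a \<Rightarrow> 'a tvec set \<Rightarrow> 'a covec set"
  where "annihilator M q A = {a \<in> cotangent_space M q. \<forall>v\<in>A. a v = 0}"

definition transv_proj ::
    "('a, 'v::euclidean_space) mfd \<Rightarrow> ('a, 'v) mfd \<Rightarrow> ('a \<Rightarrow> 'a tvec set) \<Rightarrow> 'a \<Rightarrow> 'a covec \<Rightarrow> 'a covec"
  \<comment> \<open>the projection onto the annihilator of \<open>TS\<close> along that of \<open>L\<close>\<close>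
  where "transv_proj M S L q a =
    (THE b. b \<in> annihilator M q (tan_sub M S q) \<and> a - b \<in> annihilator M q (L q))"

definition transv_lift ::
    "('a, 'v::euclidean_space) mfd \<Rightarrow> ('a, 'v) mfd \<Rightarrow> ('a \<Rightarrow> 'a tvec set) \<Rightarrow> ('a \<Rightarrow> 'a covec)
      \<Rightarrow> 'a \<Rightarrow> 'a covec"
  where "transv_lift M S L \<alpha> q =
    (THE a. a \<in> annihilator M q (L q) \<and> restrict_covec M S q a = \<alpha> q)"

definition transv_deriv ::
    "('a, 'v::euclidean_space) mfd \<Rightarrow> ('a \<Rightarrow> 'a bivec) \<Rightarrow> ('a, 'v) mfd \<Rightarrow> ('a \<Rightarrow> 'a tvec set)
      \<Rightarrow> ('a \<Rightarrow> 'a covec) \<Rightarrow> 'a conormal \<Rightarrow> 'a conormal"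
  where "transv_deriv M P S L \<alpha> \<eta> q =
    nu_star_inv M S q (restricted_bracket M P S (transv_lift M S L \<alpha>) (nu_star_sec M S \<eta>) q)"

definition transv_curv ::
    "('a, 'v::euclidean_space) mfd \<Rightarrow> ('a \<Rightarrow> 'a bivec) \<Rightarrow> ('a, 'v) mfd \<Rightarrow> ('a \<Rightarrow> 'a tvec set)
      \<Rightarrow> ('a \<Rightarrow> 'a covec) \<Rightarrow> ('a \<Rightarrow> 'a covec) \<Rightarrow> 'a conormal"
  where "transv_curv M P S L \<alpha> \<beta> q =
    nu_star_inv M S q (transv_proj M S L q
      (restricted_bracket M P S (transv_lift M S L \<alpha>) (transv_lift M S L \<beta>) q))"

text \<open>A pair \<open>(f, \<eta>)\<close> stands for the fibrewise affine function \<open>aff_fun (f, \<eta>)\<close> on the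
  normal bundle.\<close>

definition aff_pairs ::
    "('a, 'v::euclidean_space) mfd \<Rightarrow> ('a, 'v) mfd \<Rightarrow> (('a \<Rightarrow> real) \<times> 'a conormal) set"
  where "aff_pairs M S = smooth_funs S \<times> conormal_sections M S"

definition aff_fun :: "('a \<Rightarrow> real) \<times> 'a conormal \<Rightarrow> 'a \<times> 'a tvec set \<Rightarrow> real"
  where "aff_fun = (\<lambda>(f, \<eta>) (q, c). f q + \<eta> q c)"

definition aff_bracket ::
    "('a, 'v::euclidean_space) mfd \<Rightarrow> ('a \<Rightarrow> 'a bivec) \<Rightarrow> ('a, 'v) mfd \<Rightarrow> ('a \<Rightarrow> 'a bivec)
      \<Rightarrow> ('a \<Rightarrow> 'a tvec set) \<Rightarrow> ('a \<Rightarrow> real) \<times> 'a conormal \<Rightarrow> ('a \<Rightarrow> real) \<times> 'a conormal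
      \<Rightarrow> ('a \<Rightarrow> real) \<times> 'a conormal"
  where "aff_bracket M P S PS L = (\<lambda>(f1, \<eta>1) (f2, \<eta>2).
    (poisson_bracket S PS f1 f2,
     transv_deriv M P S L (dfun S f1) \<eta>2 - transv_deriv M P S L (dfun S f2) \<eta>1
       + conormal_bracket M P S \<eta>1 \<eta>2 + transv_curv M P S L (dfun S f1) (dfun S f2)))"

definition hamiltonian_derivation ::
    "('a, 'v::euclidean_space) mfd \<Rightarrow> ('a \<Rightarrow> 'a bivec) \<Rightarrow> ('a, 'v) mfd \<Rightarrow> ('a \<Rightarrow> 'a bivec)
      \<Rightarrow> ('a \<Rightarrow> 'a tvec set) \<Rightarrow> ('a \<times> 'a tvec set \<Rightarrow> ('a \<times> 'a tvec set) tvec)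
      \<Rightarrow> ('a \<Rightarrow> real) \<times> 'a conormal \<Rightarrow> bool"
  \<comment> \<open>the vector field \<open>V\<close> on the normal bundle acts on affine functions as the Hamiltonian
     derivation with Hamiltonian \<open>k\<close>\<close>
  where "hamiltonian_derivation M P S PS L V k \<longleftrightarrow>
    k \<in> aff_pairs M S \<and>
    (\<forall>x\<in>aff_pairs M S. \<forall>z\<in>points (normal_bundle M S).
       V z (aff_fun x) = aff_fun (aff_bracket M P S PS L k x) z)"


section \<open>Exponential maps and the first variation system\<close>

definition exponential_map ::
    "('a, 'v::euclidean_space) mfd \<Rightarrow> ('a, 'v) mfd \<Rightarrow> ('a \<times> 'a tvec set \<Rightarrow> 'a) \<Rightarrow> bool"
  where "exponential_map M S e \<longleftrightarrow>
    (let E = normal_bundle M S in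
      (\<forall>z\<in>points E. smooth_map_at E M z e) \<and> inj_on e (points E) \<and>
      openin (mfd_topology M) (e ` points E) \<and>
      (\<forall>x\<in>e ` points E. smooth_map_at M E x (inv_into (points E) e)) \<and>
      (\<forall>q\<in>points S. e (zero_normal M S q) = q) \<and>
      (\<forall>(q, c)\<in>points E. nu M S q (differential M e (zero_normal M S q) (vert M S (q, c))) = c))"

definition compatible ::
    "('a, 'v::euclidean_space) mfd \<Rightarrow> ('a, 'v) mfd \<Rightarrow> ('a \<times> 'a tvec set \<Rightarrow> 'a)
      \<Rightarrow> ('a \<Rightarrow> 'a tvec set) \<Rightarrow> bool"
  where "compatible M S e L \<longleftrightarrow> (\<forall>q\<in>points S.
    L q = (\<lambda>c. differential M e (zero_normal M S q) (vert M S (q, c))) ` normal_fibre M S q)"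

definition pullback_vf ::
    "('b, 'w::euclidean_space) mfd \<Rightarrow> ('b \<Rightarrow> 'a) \<Rightarrow> ('a \<Rightarrow> 'a tvec) \<Rightarrow> 'b \<Rightarrow> 'b tvec"
  \<comment> \<open>pullback of a vector field under a diffeomorphism \<open>F\<close> from \<open>N\<close> onto an open set\<close>
  where "pullback_vf N F X z = differential N (inv_into (points N) F) (F z) (X (F z))"

text \<open>Convergence in the finite-dimensional tangent spaces of the normal bundle is convergence on
  every function.\<close>

definition first_variation ::
    "('a, 'v::euclidean_space) mfd \<Rightarrow> ('a, 'v) mfd \<Rightarrow> ('a \<times> 'a tvec set \<Rightarrow> 'a) \<Rightarrow> ('a \<Rightarrow> 'a tvec)
      \<Rightarrow> 'a \<times> 'a tvec set \<Rightarrow> ('a \<times> 'a tvec set) tvec"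
  where "first_variation M S e X z = (\<lambda>g.
    Lim (at_right 0) (\<lambda>\<epsilon>. pullback_vf (normal_bundle M S) (e \<circ> scale_normal M S \<epsilon>) X z g))"

definition normal_deriv ::
    "('a, 'v::euclidean_space) mfd \<Rightarrow> ('a, 'v) mfd \<Rightarrow> ('a \<Rightarrow> real) \<Rightarrow> ('a \<times> 'a tvec set \<Rightarrow> 'a)
      \<Rightarrow> 'a conormal"
  where "normal_deriv M S H e q = zero_ext (normal_fibre M S q) (\<lambda>c.
    dfun (normal_bundle M S) (H \<circ> e) (zero_normal M S q) (vert M S (q, c)))"


section \<open>Bundle morphisms and conormal-valued forms\<close>

type_synonym 'a conormal_form = "'a \<Rightarrow> 'a covec \<Rightarrow> 'a tvec set \<Rightarrow> real"

definition conormal_form ::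
    "('a, 'v::euclidean_space) mfd \<Rightarrow> ('a, 'v) mfd \<Rightarrow> 'a conormal_form \<Rightarrow> bool"
  \<comment> \<open>vector bundle morphisms from the cotangent bundle of \<open>S\<close> to the dual normal bundle\<close>
  where "conormal_form M S \<mu> \<longleftrightarrow> (\<forall>q\<in>points S.
    (\<forall>\<alpha>\<in>cotangent_space S q. \<mu> q \<alpha> \<in> conormal_fibre M S q) \<and>
    linear_over (cotangent_space S q) (\<mu> q) \<and>
    (\<forall>\<alpha>. smooth_covec_at S S q \<alpha> \<longrightarrow> smooth_covec_at M S q (\<lambda>x. nu_star M S x (\<mu> x (\<alpha> x)))))"

definition transv_morphism ::
    "('a, 'v::euclidean_space) mfd \<Rightarrow> ('a, 'v) mfd \<Rightarrow> ('a \<Rightarrow> 'a tvec set) \<Rightarrow> ('a \<Rightarrow> 'a tvec \<Rightarrow> 'a tvec)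
      \<Rightarrow> bool"
  \<comment> \<open>vector bundle morphisms from \<open>L\<close> to \<open>TS\<close>, normalised to vanish off \<open>L\<close>\<close>
  where "transv_morphism M S L \<delta> \<longleftrightarrow>
    (\<forall>q\<in>points S. (\<forall>l\<in>L q. \<delta> q l \<in> tangent_space S q) \<and> linear_over (L q) (\<delta> q) \<and>
      (\<forall>X. smooth_vec_at M S q X \<longrightarrow> (\<forall>x\<in>points S. X x \<in> L x) \<longrightarrow>
           smooth_vec_at S S q (\<lambda>x. \<delta> x (X x)))) \<and>
    (\<forall>q l. \<not> (q \<in> points S \<and> l \<in> L q) \<longrightarrow> \<delta> q l = 0)"

definition transv_nu_star ::
    "('a, 'v::euclidean_space) mfd \<Rightarrow> ('a, 'v) mfd \<Rightarrow> ('a \<Rightarrow> 'a tvec set) \<Rightarrow> 'a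
      \<Rightarrow> ('a tvec set \<Rightarrow> real) \<Rightarrow> 'a covec"
  \<comment> \<open>the adjoint of the restriction of \<open>nu\<close> to \<open>L\<close>, with values in \<open>dual_space (L q)\<close>\<close>
  where "transv_nu_star M S L q \<xi> = zero_ext (L q) (\<lambda>l. \<xi> (nu M S q l))"

definition transv_adjoint ::
    "('a \<Rightarrow> 'a tvec set) \<Rightarrow> ('a \<Rightarrow> 'a tvec \<Rightarrow> 'a tvec) \<Rightarrow> 'a \<Rightarrow> 'a covec \<Rightarrow> 'a covec"
  where "transv_adjoint L \<delta> q \<alpha> = zero_ext (L q) (\<lambda>l. \<alpha> (\<delta> q l))"

definition determined_by ::
    "('a, 'v::euclidean_space) mfd \<Rightarrow> ('a, 'v) mfd \<Rightarrow> ('a \<Rightarrow> 'a tvec set) \<Rightarrow> 'a conormal_form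
      \<Rightarrow> ('a \<Rightarrow> 'a tvec \<Rightarrow> 'a tvec) \<Rightarrow> bool"
  where "determined_by M S L \<mu> \<delta> \<longleftrightarrow> (\<forall>q\<in>points S. \<forall>\<alpha>\<in>cotangent_space S q.
    \<mu> q \<alpha> = - inv_into (conormal_fibre M S q) (transv_nu_star M S L q) (transv_adjoint L \<delta> q \<alpha>))"

definition shift_transversal ::
    "('a, 'v::euclidean_space) mfd \<Rightarrow> ('a \<Rightarrow> 'a tvec \<Rightarrow> 'a tvec) \<Rightarrow> ('a \<Rightarrow> 'a tvec set)
      \<Rightarrow> 'a \<Rightarrow> 'a tvec set"
  where "shift_transversal M \<delta> L q = (\<lambda>l. l + incl M q (\<delta> q l)) ` L q"

definition apply_form :: "'a conormal_form \<Rightarrow> ('a \<Rightarrow> 'a covec) \<Rightarrow> 'a conormal"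
  where "apply_form \<mu> \<alpha> = (\<lambda>q. \<mu> q (\<alpha> q))"

definition transv_ext_deriv ::
    "('a, 'v::euclidean_space) mfd \<Rightarrow> ('a \<Rightarrow> 'a bivec) \<Rightarrow> ('a, 'v) mfd \<Rightarrow> ('a \<Rightarrow> 'a bivec)
      \<Rightarrow> ('a \<Rightarrow> 'a tvec set) \<Rightarrow> 'a conormal_form \<Rightarrow> ('a \<Rightarrow> 'a covec) \<Rightarrow> ('a \<Rightarrow> 'a covec) \<Rightarrow> 'a conormal"
  where "transv_ext_deriv M P S PS L \<mu> \<alpha>1 \<alpha>2 =
    transv_deriv M P S L \<alpha>1 (apply_form \<mu> \<alpha>2) - transv_deriv M P S L \<alpha>2 (apply_form \<mu> \<alpha>1)
    - apply_form \<mu> (oneform_bracket S PS \<alpha>1 \<alpha>2)"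

end

theory Submission
  imports Defs
begin

text \<open>Every section of the restricted cotangent bundle that occurs in the statement is the restriction
  to \<open>S\<close> of an exact form.  Indeed, an exponential map \<open>e\<close> compatible with \<open>L\<close> turns the affine
  function \<open>f \<oplus> \<xi>\<close> on the normal bundle into a function \<open>F\<close> near \<open>S\<close> whose differential along
  \<open>S\<close> is \<open>\<tau> df + \<nu>\<^sup>* \<xi>\<close>, where \<open>\<tau>\<close> lifts along \<open>L\<close>; likewise \<open>dH\<close> is \<open>\<tau> dh + \<nu>\<^sup>* \<eta>\<close> along \<open>S\<close>.
  Since \<open>[dF, dG] = d{F, G}\<close>, and since the bracket at points of \<open>S\<close> only depends on the restrictions
  to \<open>S\<close> (Hamiltonian vector fields are tangent to \<open>S\<close>), the covariant derivative, the curvature and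
  the fibrewise bracket are all values of the derivative of \<open>{F, G}\<close> on vectors in \<open>L\<close>, hence of one
  antisymmetric bilinear expression \<open>B\<close> in pairs \<open>f \<oplus> \<xi>\<close>.

  The lift along the shifted transversal is \<open>\<tau> + \<nu>\<^sup>* \<mu>\<close>, so its operators arise from \<open>B\<close> by replacing
  \<open>f \<oplus> 0\<close> by \<open>f \<oplus> \<mu> df\<close>.  The first variation of \<open>X\<^sub>H\<close> acts on \<open>f \<oplus> \<xi>\<close> as
  \<open>{h, f} \<oplus> B (h \<oplus> \<eta>, 0 \<oplus> \<xi>)\<close>, and its equality with the shifted bracket is, by bilinearity, the
  equation assumed for \<open>\<mu>\<close>.\<close>

section \<open>Differential calculus on relatively open subsets of a subspace\<close>

text \<open>Two choices hidden in the definitions shape the argument: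
  \<open>restricted_bracket\<close> selects arbitrary local extensions, and the first variation is
  taken with an exponential map \<open>e\<close> unrelated to the map \<open>e\<^sub>L\<close> that
  represents H and the brackets. Both are absorbed by one principle: a vector tangent to S cannot
  distinguish smooth functions that agree on S, and every Hamiltonian vector at a point of S is
  tangent to S. Since tangent vectors are abstract derivations, Hadamard's lemma is what shows that
  coordinate vectors span them and that mixed derivatives commute.

  The equation for \<mu> has a direct meaning. With B as above it reads B (h \<oplus> \<eta>, f
  \<oplus> \<mu> df) = \<mu> d{h, f}. The functions f \<oplus> \<mu> df are those whose
  differentials along S annihilate the shifted transversal, so the equation says that bracketing
  with H preserves this class to first order along S.\<close>

definition onb :: "'v::euclidean_space set \<Rightarrow> 'v set"
  where "onb W = (SOME B. finite B \<and> B \<subseteq> W \<and> pairwise orthogonal B \<and> (\<forall>x\<in>B. norm x = 1) \<and> span B = W)"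

text \<open>It serves twice. Precomposition with it fixes a derivative in the directions off
  \<open>W\<close>, where differentiability within a subset of \<open>W\<close> leaves it arbitrary;
  and in a trivialisation of the normal bundle it reads off the base point.\<close>

definition oproj :: "'v::euclidean_space set \<Rightarrow> 'v \<Rightarrow> 'v"
  where "oproj W x = (\<Sum>b\<in>onb W. (x \<bullet> b) *\<^sub>R b)"

lemma onb:
  fixes W :: "'v::euclidean_space set"
  assumes "subspace W"
  shows finite_onb: "finite (onb W)" and onb_subset: "onb W \<subseteq> W"
    and onb_orthogonal: "pairwise orthogonal (onb W)" and onb_norm: "b \<in> onb W \<Longrightarrow> norm b = 1"
    and span_onb: "span (onb W) = W"
proof -
  obtain B where "B \<subseteq> W" "pairwise orthogonal B" "\<And>x. x \<in> B \<Longrightarrow> norm x = 1"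
    "independent B" "card B = dim W" "span B = W"
    using orthonormal_basis_subspace[OF assms] by blast
  then have "\<exists>B. finite B \<and> B \<subseteq> W \<and> pairwise orthogonal B \<and> (\<forall>x\<in>B. norm x = 1) \<and> span B = W"
    using finiteI_independent by blast
  from someI_ex[OF this]
  show "finite (onb W)" "onb W \<subseteq> W" "pairwise orthogonal (onb W)" "b \<in> onb W \<Longrightarrow> norm b = 1"
    "span (onb W) = W"
    unfolding onb_def[symmetric] by blast+
qed

lemma bounded_linear_oproj: "bounded_linear (oproj W)"
  unfolding oproj_def
  by (intro bounded_linear_sum bounded_linear_scaleR_const bounded_linear_inner_left)

lemma linear_oproj: "linear (oproj W)"
  using bounded_linear_oproj bounded_linear.linear by blast

lemma oproj_in: "subspace W \<Longrightarrow> oproj W x \<in> W"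
  unfolding oproj_def
  by (intro subspace_sum subspace_scale) (use onb_subset in auto)

lemma onb_inner:
  assumes "subspace W" "b \<in> onb W" "b' \<in> onb W"
  shows "b \<bullet> b' = (if b = b' then 1 else 0)"
  using assms onb_orthogonal[OF assms(1)] onb_norm[OF assms(1), of b]
  by (auto simp: pairwise_def orthogonal_def norm_eq_1)

lemma oproj_id:
  assumes W: "subspace W" and "x \<in> W"
  shows "oproj W x = x"
proof -
  have "oproj W x = id x"
  proof (rule linear_eq_on[OF linear_oproj linear_id])
    show "x \<in> span (onb W)" using assms span_onb by blast
    fix b assume b: "b \<in> onb W"
    have "oproj W b = (\<Sum>b'\<in>onb W. if b = b' then b' else 0)"
      unfolding oproj_def by (intro sum.cong refl) (simp add: onb_inner[OF W b])
    also have "\<dots> = b" using b finite_onb[OF W] by simp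
    finally show "oproj W b = id b" by simp
  qed
  then show ?thesis by simp
qed

lemma oproj_orthogonal:
  assumes W: "subspace W" and w: "w \<in> W"
  shows "orthogonal (x - oproj W x) w"
proof -
  have "orthogonal (x - oproj W x) b" if b: "b \<in> onb W" for b
  proof -
    have "oproj W x \<bullet> b = (\<Sum>b'\<in>onb W. if b' = b then x \<bullet> b else 0)"
      unfolding oproj_def inner_sum_left by (intro sum.cong refl) (auto simp: onb_inner[OF W _ b])
    also have "\<dots> = x \<bullet> b" using b finite_onb[OF W] by simp
    finally show ?thesis by (simp add: orthogonal_def inner_diff_left)
  qed
  then show ?thesis
    using orthogonal_to_span[of w "onb W" "x - oproj W x"] w span_onb[OF W] by blast
qed

text \<open>The remainder \<open>x - oproj W x\<close> is an admissible \<open>n\<close>; being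
  orthogonal to \<open>x\<close> and to the projection, it is zero. In this form, membership of a
  derivative in a model space is tested on functionals that vanish identically on that
  space.\<close>

lemma in_subspace_if_orthogonal:
  fixes W :: "'v::euclidean_space set"
  assumes W: "subspace W" and "\<And>n. (\<And>w. w \<in> W \<Longrightarrow> orthogonal n w) \<Longrightarrow> x \<bullet> n = 0"
  shows "x \<in> W"
proof -
  let ?r = "x - oproj W x"
  have "x \<bullet> ?r = 0"
    using oproj_orthogonal[OF W] by (intro assms(2)) auto
  moreover have "?r \<bullet> oproj W x = 0"
    using oproj_orthogonal[OF W oproj_in[OF W, of x], of x] by (simp add: orthogonal_def)
  ultimately have "?r \<bullet> ?r = 0" by (simp add: inner_diff_left inner_commute)
  then show ?thesis using oproj_in[OF W, of x] by simp
qed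

lemma oproj_add_orthogonal:
  assumes W: "subspace W" and x: "x \<in> W" and y: "\<And>w. w \<in> W \<Longrightarrow> orthogonal y w"
  shows "oproj W (x + y) = x"
proof -
  have "oproj W y = 0"
    unfolding oproj_def using y onb_subset[OF W] by (intro sum.neutral) (auto simp: orthogonal_def)
  then show ?thesis using oproj_id[OF W x] linear_add[OF linear_oproj, of W x y] by simp
qed

lemma at_within_openin:
  assumes "openin (top_of_set V) B" "B \<subseteq> A" "A \<subseteq> V" "x \<in> B"
  shows "at x within B = at x within A"
proof -
  obtain T where T: "open T" "B = V \<inter> T" using assms(1) unfolding openin_open by blast
  show ?thesis
    by (rule at_within_nhd[of x T]) (use T assms in auto)
qed

text \<open>A directional derivative that does not mention the linear map \<open>D\<close> of
  \<open>Ck_on\<close>, which is determined only on \<open>V\<close>. For \<open>x\<close> and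
  \<open>v\<close> in \<open>V\<close> the ray stays in \<open>V\<close>, so only values of
  \<open>f\<close> there are seen.\<close>

definition ddir :: "('v::real_normed_vector \<Rightarrow> 'b::real_normed_vector) \<Rightarrow> 'v \<Rightarrow> 'v \<Rightarrow> 'b"
  where "ddir f x v = vector_derivative (\<lambda>t. f (x + t *\<^sub>R v)) (at 0)"

section \<open>Closure properties and locality of the classes \<open>Ck_on\<close>\<close>

lemma Ck_on_cong:
  assumes "\<And>x. x \<in> A \<Longrightarrow> f x = g x"
  shows "Ck_on k V A f \<longleftrightarrow> Ck_on k V A g"
proof -
  have *: "Ck_on k V A g" if eq: "\<And>x. x \<in> A \<Longrightarrow> f x = g x" and f: "Ck_on k V A f" for f g :: "'a \<Rightarrow> 'b"
  proof (cases k)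
    case 0
    then show ?thesis using that continuous_on_cong[OF refl eq] by simp
  next
    case (Suc j)
    then obtain D where D: "\<forall>x\<in>A. (f has_derivative D x) (at x within A)"
      "\<forall>v\<in>V. Ck_on j V A (\<lambda>x. D x v)"
      using f by auto
    have "(g has_derivative D x) (at x within A)" if "x \<in> A" for x
      using has_derivative_transform[OF that _ D(1)[rule_format, OF that]] eq by metis
    then show ?thesis using D(2) Suc by auto
  qed
  show ?thesis using *[of f g] *[of g f] assms by auto
qed

lemma Ck_on_subset: "Ck_on k V A f \<Longrightarrow> B \<subseteq> A \<Longrightarrow> Ck_on k V B f"
proof (induction k arbitrary: f)
  case 0
  then show ?case using continuous_on_subset by auto
next
  case (Suc k)
  then obtain D where D: "\<forall>x\<in>A. (f has_derivative D x) (at x within A)"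
      "\<forall>v\<in>V. Ck_on k V A (\<lambda>x. D x v)" by auto
  have "\<forall>x\<in>B. (f has_derivative D x) (at x within B)"
    using D(1) Suc.prems(2) has_derivative_subset by blast
  then show ?case using D(2) Suc by auto
qed

lemma Ck_on_subspace: "Ck_on k V A f \<Longrightarrow> W \<subseteq> V \<Longrightarrow> Ck_on k W A f"
proof (induction k arbitrary: f)
  case (Suc k)
  then show ?case by (auto simp: subset_iff)
qed simp

lemma Ck_on_mono_Suc: "Ck_on (Suc k) V A f \<Longrightarrow> Ck_on k V A f"
proof (induction k arbitrary: f)
  case 0
  then show ?case using has_derivative_continuous_on by fastforce
next
  case (Suc k)
  then show ?case by (metis Ck_on.simps(2))
qed

lemma Ck_on_const: "Ck_on k V A (\<lambda>x. c)"
proof (induction k arbitrary: c)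
  case (Suc k)
  have "\<forall>x\<in>A. ((\<lambda>x. c) has_derivative (\<lambda>_. 0)) (at x within A)" by simp
  then show ?case using Suc[of 0] by (auto intro!: exI[of _ "\<lambda>_ _. 0"])
qed simp

lemma Ck_on_bounded_linear:
  assumes "bounded_linear L"
  shows "Ck_on k V A L"
proof (cases k)
  case 0
  then show ?thesis using linear_continuous_on[OF assms] by simp
next
  case (Suc j)
  have "\<forall>x\<in>A. (L has_derivative L) (at x within A)"
    using bounded_linear_imp_has_derivative[OF assms] by blast
  then show ?thesis using Suc Ck_on_const by (auto intro!: exI[of _ "\<lambda>_. L"])
qed

lemma Ck_on_add: "Ck_on k V A f \<Longrightarrow> Ck_on k V A g \<Longrightarrow> Ck_on k V A (\<lambda>x. f x + g x)"
proof (induction k arbitrary: f g)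
  case 0
  then show ?case by (auto intro: continuous_on_add)
next
  case (Suc k)
  then obtain D D' where "\<forall>x\<in>A. (f has_derivative D x) (at x within A)"
      "\<forall>v\<in>V. Ck_on k V A (\<lambda>x. D x v)" "\<forall>x\<in>A. (g has_derivative D' x) (at x within A)"
      "\<forall>v\<in>V. Ck_on k V A (\<lambda>x. D' x v)" by auto
  then show ?case using Suc.IH
    by (auto intro!: exI[of _ "\<lambda>x v. D x v + D' x v"] has_derivative_add)
qed

lemma Ck_on_sum:
  assumes "\<And>i. i \<in> I \<Longrightarrow> Ck_on k V A (f i)"
  shows "Ck_on k V A (\<lambda>x. \<Sum>i\<in>I. f i x)"
  using assms
proof (induction I rule: infinite_finite_induct)
  case (insert i I)
  then show ?case by (simp add: Ck_on_add)
qed (simp_all add: Ck_on_const)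

lemma Ck_on_bounded_bilinear:
  assumes P: "bounded_bilinear P"
  shows "Ck_on k V A f \<Longrightarrow> Ck_on k V A g \<Longrightarrow> Ck_on k V A (\<lambda>x. P (f x) (g x))"
proof (induction k arbitrary: f g)
  case 0
  then show ?case by (auto intro: bounded_bilinear.continuous_on[OF P])
next
  case (Suc k)
  then obtain D D' where D: "\<forall>x\<in>A. (f has_derivative D x) (at x within A)"
      "\<forall>v\<in>V. Ck_on k V A (\<lambda>x. D x v)" "\<forall>x\<in>A. (g has_derivative D' x) (at x within A)"
      "\<forall>v\<in>V. Ck_on k V A (\<lambda>x. D' x v)" by auto
  have "Ck_on k V A f" "Ck_on k V A g" using Suc.prems Ck_on_mono_Suc by blast+
  then show ?case using Suc.IH D
    by (auto intro!: exI[of _ "\<lambda>x v. P (f x) (D' x v) + P (D x v) (g x)"]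
        bounded_bilinear.FDERIV[OF P] Ck_on_add)
qed

lemmas Ck_on_mult = Ck_on_bounded_bilinear[OF bounded_bilinear_mult]
  and Ck_on_scaleR = Ck_on_bounded_bilinear[OF bounded_bilinear_scaleR]
  and Ck_on_inner = Ck_on_bounded_bilinear[OF bounded_bilinear_inner]

context
  fixes V :: "'v::euclidean_space set"
  assumes V: "subspace V"
begin

text \<open>Near parameter 0 the ray stays in \<open>A\<close>: it lies in \<open>V\<close>, and
  \<open>A\<close> is the trace on \<open>V\<close> of an open set. Hence a derivative within
  \<open>A\<close> yields an ordinary two-sided derivative in \<open>t\<close>.\<close>

lemma ray_has_vector_derivative:
  assumes A: "openin (top_of_set V) A" and x: "x \<in> A" and v: "v \<in> V"
    and D: "(f has_derivative D) (at x within A)"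
  shows "((\<lambda>t. f (x + t *\<^sub>R v)) has_vector_derivative D v) (at 0)"
proof -
  obtain T where T: "open T" "A = V \<inter> T" using A openin_open by blast
  let ?g = "\<lambda>t::real. x + t *\<^sub>R v"
  let ?J = "?g -` T"
  have J: "open ?J" by (intro open_vimage T continuous_intros)
  have gV: "?g t \<in> V" for t using T x v V by (auto intro: subspace_add subspace_scale)
  have g: "(?g has_derivative (\<lambda>t. t *\<^sub>R v)) (at 0 within ?J)"
    by (auto intro!: derivative_eq_intros)
  have "?g ` ?J \<subseteq> A" using T gV by auto
  then have "(f has_derivative D) (at (?g 0) within ?g ` ?J)"
    using D has_derivative_subset by simp blast
  from has_derivative_in_compose[OF g this]
  have "((\<lambda>t. f (?g t)) has_derivative (\<lambda>t. D (t *\<^sub>R v))) (at 0 within ?J)" .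
  moreover have "0 \<in> ?J" using x T by auto
  ultimately have "((\<lambda>t. f (?g t)) has_derivative (\<lambda>t. D (t *\<^sub>R v))) (at 0)"
    using J at_within_open by metis
  moreover have "linear D" using D has_derivative_linear by blast
  ultimately show ?thesis by (simp add: has_vector_derivative_def linear_scale)
qed

lemma ddir_eq:
  assumes "openin (top_of_set V) A" "x \<in> A" "v \<in> V" "(f has_derivative D) (at x within A)"
  shows "ddir f x v = D v"
  unfolding ddir_def using ray_has_vector_derivative[OF assms] by (rule vector_derivative_at)

lemma ddir_cong:
  assumes A: "openin (top_of_set V) A" and x: "x \<in> A" and v: "v \<in> V"
    and "\<And>y. y \<in> A \<Longrightarrow> f y = g y"
  shows "ddir f x v = ddir g x v"
proof -
  obtain T where T: "open T" "A = V \<inter> T" using A openin_open by blast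
  let ?g = "\<lambda>t::real. x + t *\<^sub>R v"
  have J: "open (?g -` T)" "0 \<in> ?g -` T" using x T
    by (auto intro!: open_vimage continuous_intros)
  have gV: "?g t \<in> V" for t using T x v V by (auto intro: subspace_add subspace_scale)
  have "\<forall>\<^sub>F t in nhds 0. f (?g t) = g (?g t)"
    unfolding eventually_nhds using J gV assms(4) T by blast
  then show ?thesis unfolding ddir_def by (intro vector_derivative_cong_eq) auto
qed

text \<open>Replaces the existentially quantified derivative of \<open>Ck_on\<close> by the
  canonical \<open>ddir\<close>, so that data from different open pieces can be compared.\<close>

lemma Ck_on_Suc_iff:
  assumes A: "openin (top_of_set V) A"
  shows "Ck_on (Suc k) V A f \<longleftrightarrow>
    (\<forall>x\<in>A. f differentiable (at x within A)) \<and> (\<forall>v\<in>V. Ck_on k V A (\<lambda>x. ddir f x v))"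
proof
  assume "Ck_on (Suc k) V A f"
  then obtain D where D: "\<forall>x\<in>A. (f has_derivative D x) (at x within A)"
      "\<forall>v\<in>V. Ck_on k V A (\<lambda>x. D x v)" by auto
  have "Ck_on k V A (\<lambda>x. ddir f x v)" if v: "v \<in> V" for v
  proof -
    have "ddir f x v = D x v" if "x \<in> A" for x using D that ddir_eq[OF A that v] by blast
    then show ?thesis using D v Ck_on_cong[of A "\<lambda>x. ddir f x v" "\<lambda>x. D x v"] by simp
  qed
  then show "(\<forall>x\<in>A. f differentiable (at x within A)) \<and> (\<forall>v\<in>V. Ck_on k V A (\<lambda>x. ddir f x v))"
    using D differentiable_def by blast
next
  assume R: "(\<forall>x\<in>A. f differentiable (at x within A)) \<and> (\<forall>v\<in>V. Ck_on k V A (\<lambda>x. ddir f x v))"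
  then obtain D where D: "\<forall>x\<in>A. (f has_derivative D x) (at x within A)"
    unfolding differentiable_def by metis
  have "Ck_on k V A (\<lambda>x. D x v)" if v: "v \<in> V" for v
  proof -
    have "ddir f x v = D x v" if "x \<in> A" for x using D that ddir_eq[OF A that v] by blast
    then show ?thesis using R v Ck_on_cong[of A "\<lambda>x. ddir f x v" "\<lambda>x. D x v" k V] by blast
  qed
  then show "Ck_on (Suc k) V A f" using D by auto
qed

text \<open>The derivatives furnished on different pieces need not be the same linear maps, but
  along \<open>V\<close> they all equal \<open>ddir f\<close>, to which the induction hypothesis
  applies.\<close>

lemma Ck_on_local:
  assumes A: "openin (top_of_set V) A"
    and "\<And>x. x \<in> A \<Longrightarrow> \<exists>B. openin (top_of_set V) B \<and> x \<in> B \<and> B \<subseteq> A \<and> Ck_on k V B f"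
  shows "Ck_on k V A f"
  using assms(2)
proof (induction k arbitrary: f)
  have sub: "A \<subseteq> V" using A openin_imp_subset by blast
  case 0
  have "continuous (at x within A) f" if x: "x \<in> A" for x
  proof -
    obtain B where B: "openin (top_of_set V) B" "x \<in> B" "B \<subseteq> A" "continuous_on B f"
      using 0[OF x] by auto
    then show ?thesis
      using at_within_openin[OF B(1,3) sub B(2)] by (metis continuous_on_eq_continuous_within)
  qed
  then show ?case by (simp add: continuous_on_eq_continuous_within)
next
  have sub: "A \<subseteq> V" using A openin_imp_subset by blast
  case (Suc k)
  have d: "f differentiable (at x within A)" if x: "x \<in> A" for x
  proof -
    obtain B where B: "openin (top_of_set V) B" "x \<in> B" "B \<subseteq> A" "Ck_on (Suc k) V B f"
      using Suc.prems[OF x] by auto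
    then show ?thesis
      using at_within_openin[OF B(1,3) sub B(2)] Ck_on_Suc_iff[OF B(1)] by metis
  qed
  have "Ck_on k V A (\<lambda>x. ddir f x v)" if v: "v \<in> V" for v
  proof (rule Suc.IH)
    fix x assume "x \<in> A"
    then show "\<exists>B. openin (top_of_set V) B \<and> x \<in> B \<and> B \<subseteq> A \<and> Ck_on k V B (\<lambda>x. ddir f x v)"
      using Suc.prems[of x] Ck_on_Suc_iff v by metis
  qed
  then show ?case using d Ck_on_Suc_iff[OF A] by blast
qed

end

lemma Ck_on_compose:
  fixes f :: "'w::euclidean_space \<Rightarrow> 'b::real_normed_vector" and g :: "'v::euclidean_space \<Rightarrow> 'w"
  assumes V: "subspace V" and W: "subspace W"
    and A: "openin (top_of_set V) A" and B: "B \<subseteq> W" and gA: "g ` A \<subseteq> B"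
  shows "Ck_on k W B f \<Longrightarrow> Ck_on k V A g \<Longrightarrow> Ck_on k V A (\<lambda>x. f (g x))"
proof (induction k arbitrary: f)
  case 0
  then show ?case using gA continuous_on_compose2 by auto
next
  case (Suc k)
  obtain Df where Df: "\<forall>y\<in>B. (f has_derivative Df y) (at y within B)"
    "\<forall>w\<in>W. Ck_on k W B (\<lambda>y. Df y w)" using Suc.prems by auto
  obtain Dg where Dg: "\<forall>x\<in>A. (g has_derivative Dg x) (at x within A)"
    "\<forall>v\<in>V. Ck_on k V A (\<lambda>x. Dg x v)" using Suc.prems by auto
  \<comment> \<open>The hypothesis on \<open>f\<close> controls \<open>Df\<close> only in directions
    of \<open>W\<close>. For \<open>n\<close> normal to \<open>W\<close> the function
    \<open>g y \<bullet> n\<close> is zero on \<open>A\<close>, and so is its derivative.\<close>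
  have DgW: "Dg x v \<in> W" if x: "x \<in> A" and v: "v \<in> V" for x v
  proof (rule in_subspace_if_orthogonal[OF W])
    fix n assume n: "\<And>w. w \<in> W \<Longrightarrow> orthogonal n w"
    have "((\<lambda>y. g y \<bullet> n) has_derivative (\<lambda>v. Dg x v \<bullet> n)) (at x within A)"
      using Dg x by (auto intro!: has_derivative_inner_left)
    then have "ddir (\<lambda>y. g y \<bullet> n) x v = Dg x v \<bullet> n" using ddir_eq[OF V A x v] by blast
    moreover have "g y \<bullet> n = 0" if "y \<in> A" for y
    proof -
      have "g y \<in> W" using that gA B by blast
      then show ?thesis using n[of "g y"] by (simp add: orthogonal_def inner_commute)
    qed
    then have "ddir (\<lambda>y. g y \<bullet> n) x v = ddir (\<lambda>y. 0) x v"
      by (rule ddir_cong[OF V A x v])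
    ultimately show "Dg x v \<bullet> n = 0" by (simp add: ddir_def)
  qed
  have d: "((\<lambda>x. f (g x)) has_derivative (\<lambda>v. Df (g x) (Dg x v))) (at x within A)" if x: "x \<in> A" for x
  proof -
    have "(g has_derivative Dg x) (at x within A)" using Dg x by blast
    moreover have "(f has_derivative Df (g x)) (at (g x) within g ` A)"
      using Df gA x by (blast intro: has_derivative_subset)
    ultimately show ?thesis by (rule has_derivative_in_compose)
  qed
  have "Ck_on k V A (\<lambda>x. Df (g x) (Dg x v))" if v: "v \<in> V" for v
  proof -
    \<comment> \<open>The direction \<open>Dg x v\<close> moves with \<open>x\<close>. Expanded in a
      fixed basis of \<open>W\<close>, it leaves only the derivatives \<open>Df y b\<close> with
      constant \<open>b\<close>, which the induction hypothesis covers.\<close>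
    have eq: "Df (g x) (Dg x v) = (\<Sum>b\<in>onb W. (Dg x v \<bullet> b) *\<^sub>R Df (g x) b)" if x: "x \<in> A" for x
    proof -
      have l: "linear (Df (g x))" using Df gA x has_derivative_linear by blast
      have "Dg x v = (\<Sum>b\<in>onb W. (Dg x v \<bullet> b) *\<^sub>R b)"
        using oproj_id[OF W DgW[OF x v]] by (simp add: oproj_def)
      then have "Df (g x) (Dg x v) = Df (g x) (\<Sum>b\<in>onb W. (Dg x v \<bullet> b) *\<^sub>R b)" by simp
      then show ?thesis by (simp add: linear_sum[OF l] linear_scale[OF l])
    qed
    have "Ck_on k V A (\<lambda>x. \<Sum>b\<in>onb W. (Dg x v \<bullet> b) *\<^sub>R Df (g x) b)"
      using Df(2) Dg(2) v onb_subset[OF W] Ck_on_mono_Suc[OF Suc.prems(2)]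
      by (intro Ck_on_sum Ck_on_scaleR Ck_on_inner Ck_on_const Suc.IH[where f = "\<lambda>y. Df y b" for b]) auto
    then show ?thesis using eq Ck_on_cong[of A "\<lambda>x. Df (g x) (Dg x v)"] by simp
  qed
  then show ?case using d by (auto intro!: exI[of _ "\<lambda>x v. Df (g x) (Dg x v)"])
qed


lemma Ck_on_continuous: "Ck_on k V A f \<Longrightarrow> continuous_on A f"
proof (induction k)
  case (Suc k)
  then show ?case using Ck_on_mono_Suc by blast
qed simp

section \<open>Differentiation under the integral, Hadamard's lemma and symmetry of second
  derivatives\<close>

context
  fixes V :: "'v::euclidean_space set"
  assumes V: "subspace V"
begin

text \<open>Differentiating under the integral sign produces one more factor \<open>t\<close>. The
  weight \<open>t ^ j\<close> makes the statement stable under this, so the induction on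
  \<open>k\<close> runs with \<open>j\<close> arbitrary.\<close>

lemma Ck_on_ray_integral:
  fixes F :: "'v \<Rightarrow> real"
  assumes B: "openin (top_of_set V) B" and cB: "convex B" and p: "p \<in> B"
    and ray: "\<And>x t. x \<in> B \<Longrightarrow> t \<in> {0..1} \<Longrightarrow> p + t *\<^sub>R (x - p) \<in> B"
  shows "Ck_on k V B F \<Longrightarrow> Ck_on k V B (\<lambda>x. integral {0..1} (\<lambda>t. t ^ j * F (p + t *\<^sub>R (x - p))))"
proof (induction k arbitrary: F j)
  case 0
  then have cF: "continuous_on B F" by simp
  have "continuous_on (B \<times> cbox 0 1) (\<lambda>xt. F (p + snd xt *\<^sub>R (fst xt - p)))"
    using ray by (intro continuous_on_compose2[OF cF] continuous_intros) auto
  then have "continuous_on (B \<times> cbox 0 1) (\<lambda>xt. snd xt ^ j * F (p + snd xt *\<^sub>R (fst xt - p)))"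
    by (intro continuous_on_mult continuous_intros)
  then have "continuous_on (B \<times> cbox 0 1) (\<lambda>(x, t). t ^ j * F (p + t *\<^sub>R (x - p)))"
    by (simp add: split_beta)
  from integral_continuous_on_param[OF this] show ?case by simp
next
  case (Suc k)
    obtain D where D: "\<And>x. x \<in> B \<Longrightarrow> (F has_derivative D x) (at x within B)"
      "\<And>v. v \<in> V \<Longrightarrow> Ck_on k V B (\<lambda>x. D x v)" using Suc.prems by auto
    have BV: "B \<subseteq> V" using B openin_imp_subset by blast
    \<comment> \<open>\<open>D x\<close> is uncontrolled off \<open>V\<close>, whereas the Leibniz
      rule asks for continuity as a map into bounded linear functions on the whole Euclidean space.
      Composing with the projection keeps it a derivative within \<open>B\<close> and makes every
      component continuous.\<close>
    define D' where "D' x = (\<lambda>v. D x (oproj V v))" for x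
    have D': "(F has_derivative D' x) (at x within B)" if x: "x \<in> B" for x
    proof -
      have "oproj V ` B = B" using oproj_id[OF V] BV by force
      then have "((\<lambda>y. F (oproj V y)) has_derivative D' x) (at x within B)"
        unfolding D'_def
        using has_derivative_in_compose[of "oproj V" "oproj V" x B F "D x"] D(1)[OF x]
          bounded_linear_imp_has_derivative[OF bounded_linear_oproj, of V "at x within B"]
          oproj_id[OF V] BV x
        by (simp add: subset_iff)
      then show ?thesis
        by (rule has_derivative_transform[OF x, rotated]) (use oproj_id[OF V] BV in auto)
    qed
    define fx where "fx x t = Blinfun (\<lambda>v. t ^ Suc j * D' (p + t *\<^sub>R (x - p)) v)" for x and t :: real
    have fx: "blinfun_apply (fx x t) = (\<lambda>v. t ^ Suc j * D' (p + t *\<^sub>R (x - p)) v)"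
      if "x \<in> B" "t \<in> {0..1}" for x t
      unfolding fx_def using D'[OF ray[OF that]] has_derivative_bounded_linear
      by (intro bounded_linear_Blinfun_apply bounded_linear_const_mult) blast
    have cD: "continuous_on B (\<lambda>y. D' y i)" for i
      unfolding D'_def using Ck_on_continuous[OF D(2)[OF oproj_in[OF V]]] .
    have cont: "continuous_on (B \<times> cbox 0 1) (\<lambda>(x, t). fx x t)"
    proof (rule continuous_on_blinfun_componentwise)
      fix i :: 'v
      have "continuous_on (B \<times> cbox 0 1) (\<lambda>xt. D' (p + snd xt *\<^sub>R (fst xt - p)) i)"
        using ray by (intro continuous_on_compose2[OF cD] continuous_intros) auto
      then have "continuous_on (B \<times> cbox 0 1) (\<lambda>xt. snd xt ^ Suc j * D' (p + snd xt *\<^sub>R (fst xt - p)) i)"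
        by (intro continuous_on_mult continuous_intros)
      then show "continuous_on (B \<times> cbox 0 1) (\<lambda>x. (case x of (x, t) \<Rightarrow> fx x t) i)"
        by (rule continuous_on_eq) (auto simp: fx)
    qed
    have cF: "continuous_on B F" using Suc.prems Ck_on_continuous by blast
    have der: "((\<lambda>x. integral (cbox 0 1) (\<lambda>t. t ^ j * F (p + t *\<^sub>R (x - p)))) has_derivative
        integral (cbox 0 1) (fx x0)) (at x0 within B)" if x0: "x0 \<in> B" for x0
    proof (rule leibniz_rule[OF _ _ cont x0 cB])
      fix x assume x: "x \<in> B"
      have "continuous_on (cbox 0 1) (\<lambda>t. F (p + t *\<^sub>R (x - p)))"
        using ray[OF x] by (intro continuous_on_compose2[OF cF] continuous_intros) auto
      then have "continuous_on (cbox 0 1) (\<lambda>t. t ^ j * F (p + t *\<^sub>R (x - p)))"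
        by (intro continuous_on_mult continuous_intros)
      then show "(\<lambda>t. t ^ j * F (p + t *\<^sub>R (x - p))) integrable_on cbox 0 1"
        using integrable_continuous by blast
      fix t :: real assume t: "t \<in> cbox 0 1"
      have "((\<lambda>x. F (p + t *\<^sub>R (x - p))) has_derivative (\<lambda>v. D' (p + t *\<^sub>R (x - p)) (t *\<^sub>R v))) (at x within B)"
      proof -
        have "((\<lambda>x. p + t *\<^sub>R (x - p)) has_derivative (\<lambda>v. t *\<^sub>R v)) (at x within B)"
          by (auto intro!: derivative_eq_intros)
        moreover have "(F has_derivative D' (p + t *\<^sub>R (x - p))) (at (p + t *\<^sub>R (x - p)) within (\<lambda>x. p + t *\<^sub>R (x - p)) ` B)"
          using ray x t by (intro has_derivative_subset[OF D']) auto
        ultimately show ?thesis by (rule has_derivative_in_compose)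
      qed
      from has_derivative_mult_right[OF this, of "t ^ j"]
      show "((\<lambda>x. t ^ j * F (p + t *\<^sub>R (x - p))) has_derivative blinfun_apply (fx x t)) (at x within B)"
        using x t linear_scale[OF has_derivative_linear[OF D'[OF ray[OF x]]], of t t]
        by (simp add: fx ac_simps)
    qed
    have val: "integral (cbox 0 1) (fx x) v = integral {0..1} (\<lambda>t. t ^ Suc j * D (p + t *\<^sub>R (x - p)) v)"
      if x: "x \<in> B" and v: "v \<in> V" for x v
    proof -
      have "continuous_on (cbox 0 1) (fx x)"
        using continuous_on_compose2[OF cont, of "cbox 0 1" "Pair x"] x
        by (simp add: continuous_on_Pair image_subset_iff)
      then have "integral (cbox 0 1) (fx x) v = integral (cbox 0 1) (\<lambda>t. fx x t v)"
        by (intro blinfun_apply_integral integrable_continuous)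
      also have "\<dots> = integral (cbox 0 1) (\<lambda>t. t ^ Suc j * D (p + t *\<^sub>R (x - p)) v)"
        using x v by (intro integral_cong) (simp add: fx D'_def oproj_id[OF V])
      finally show ?thesis by simp
    qed
    have "Ck_on k V B (\<lambda>x. integral (cbox 0 1) (fx x) v)" if v: "v \<in> V" for v
      using Suc.IH[OF D(2)[OF v], of "Suc j"] val[OF _ v]
        Ck_on_cong[of B "\<lambda>x. integral (cbox 0 1) (fx x) v"] by simp
    then show ?case using der
      by (auto intro!: exI[of _ "\<lambda>x v. blinfun_apply (integral {0..1} (fx x)) v"])
qed

lemma smooth_on_ddir: "smooth_on V A f \<Longrightarrow> v \<in> V \<Longrightarrow> smooth_on V A (\<lambda>x. ddir f x v)"
  unfolding smooth_on_def using Ck_on_Suc_iff[OF V] by metis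

lemma smooth_on_ray:
  assumes "smooth_on V A f" "x \<in> A" "v \<in> V"
  shows "((\<lambda>t. f (x + t *\<^sub>R v)) has_vector_derivative ddir f x v) (at 0)"
proof -
  have A: "openin (top_of_set V) A" and "Ck_on (Suc 0) V A f"
    using assms(1) by (auto simp: smooth_on_def simp del: Ck_on.simps)
  then obtain D where D: "(f has_derivative D x) (at x within A)" using assms(2) by auto
  show ?thesis
    using ray_has_vector_derivative[OF V A assms(2,3) D] ddir_eq[OF V A assms(2,3) D] by simp
qed

lemma smooth_on_derivative:
  assumes "smooth_on V A f"
  obtains D where "\<And>x. x \<in> A \<Longrightarrow> (f has_derivative D x) (at x within A)"
    "\<And>x v. x \<in> A \<Longrightarrow> v \<in> V \<Longrightarrow> D x v = ddir f x v"
proof -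
  have A: "openin (top_of_set V) A" and "Ck_on (Suc 0) V A f"
    using assms(1) by (auto simp: smooth_on_def simp del: Ck_on.simps)
  then obtain D where D: "\<forall>x\<in>A. (f has_derivative D x) (at x within A)" by auto
  show ?thesis using that[of D] D ddir_eq[OF V A] by metis
qed

text \<open>The fundamental theorem of calculus on the segment from \<open>p\<close> to
  \<open>x\<close>; the factors \<open>g b\<close> are the means of the directional derivatives over
  that segment.\<close>

lemma hadamard:
  fixes f :: "'v \<Rightarrow> real"
  assumes f: "smooth_on V A f" and p: "p \<in> A"
  obtains B g where "openin (top_of_set V) B" "p \<in> B" "B \<subseteq> A"
    "\<And>b. b \<in> onb V \<Longrightarrow> smooth_on V B (g b)" "\<And>b. g b p = ddir f p b"
    "\<And>x. x \<in> B \<Longrightarrow> f x = f p + (\<Sum>b\<in>onb V. ((x - p) \<bullet> b) * g b x)"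
proof -
  have A: "openin (top_of_set V) A" using f smooth_on_def by blast
  then obtain r where r: "r > 0" "ball p r \<inter> V \<subseteq> A" using p openin_contains_ball by metis
  define B where "B = V \<inter> ball p r"
  have B: "openin (top_of_set V) B" "p \<in> B" "B \<subseteq> A" "convex B"
    using r p openin_imp_subset[OF A] subspace_imp_convex[OF V]
    by (auto simp: B_def convex_Int)
  have ray: "p + t *\<^sub>R (x - p) \<in> B" if "x \<in> B" "t \<in> {0..1}" for x t
    using convexD_alt[OF B(4,2) that(1), of t] that(2) by (simp add: algebra_simps)
  \<comment> \<open>The factor \<open>t ^ 0\<close> puts the mean into the shape of
    \<open>Ck_on_ray_integral\<close> with \<open>j = 0\<close>.\<close>
  define g where "g b x = integral {0..1} (\<lambda>t. t ^ 0 * ddir f (p + t *\<^sub>R (x - p)) b)" for b x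
  have g: "smooth_on V B (g b)" if b: "b \<in> onb V" for b
  proof -
    have "b \<in> V" using b onb_subset[OF V] by blast
    then have "Ck_on k V B (\<lambda>x. ddir f x b)" for k
      using smooth_on_ddir[OF f] B(3) unfolding smooth_on_def by (blast intro: Ck_on_subset)
    then show ?thesis unfolding smooth_on_def g_def using Ck_on_ray_integral[OF B(1,4,2) ray] B(1) by blast
  qed
  obtain D where D: "\<And>x. x \<in> A \<Longrightarrow> (f has_derivative D x) (at x within A)"
    "\<And>x v. x \<in> A \<Longrightarrow> v \<in> V \<Longrightarrow> D x v = ddir f x v" using smooth_on_derivative[OF f] by blast
  have "f x = f p + (\<Sum>b\<in>onb V. ((x - p) \<bullet> b) * g b x)" if x: "x \<in> B" for x
  proof -
    note ray = ray[OF x]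
    have xp: "x - p \<in> V" using x p B(3) openin_imp_subset[OF A] by (intro subspace_diff[OF V]) auto
    have eq: "D y (x - p) = (\<Sum>b\<in>onb V. ((x - p) \<bullet> b) * ddir f y b)" if y: "y \<in> A" for y
    proof -
      have l: "linear (D y)" using D y has_derivative_linear by blast
      have "D y (x - p) = D y (\<Sum>b\<in>onb V. ((x - p) \<bullet> b) *\<^sub>R b)"
        using oproj_id[OF V xp] by (simp add: oproj_def)
      also have "\<dots> = (\<Sum>b\<in>onb V. ((x - p) \<bullet> b) * ddir f y b)"
        using D(2)[OF y] onb_subset[OF V] by (auto simp: linear_sum[OF l] linear_scale[OF l] intro!: sum.cong)
      finally show ?thesis .
    qed
    have "((\<lambda>t. D (p + t *\<^sub>R (x - p)) (x - p)) has_integral f (p + 1 *\<^sub>R (x - p)) - f (p + 0 *\<^sub>R (x - p))) {0..1}"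
    proof (rule fundamental_theorem_of_calculus)
      fix t :: real assume t: "t \<in> {0..1}"
      have "((\<lambda>t. f (p + t *\<^sub>R (x - p))) has_derivative (\<lambda>s. D (p + t *\<^sub>R (x - p)) (s *\<^sub>R (x - p)))) (at t within {0..1})"
      proof -
        have "((\<lambda>t. p + t *\<^sub>R (x - p)) has_derivative (\<lambda>s. s *\<^sub>R (x - p))) (at t within {0..1})"
          by (auto intro!: derivative_eq_intros)
        moreover have "(f has_derivative D (p + t *\<^sub>R (x - p))) (at (p + t *\<^sub>R (x - p)) within (\<lambda>t. p + t *\<^sub>R (x - p)) ` {0..1})"
          using ray t B(3) by (intro has_derivative_subset[OF D(1)]) (auto simp del: atLeastAtMost_iff)
        ultimately show ?thesis by (rule has_derivative_in_compose)
      qed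
      moreover have "linear (D (p + t *\<^sub>R (x - p)))"
        using D(1) ray[OF t] B(3) has_derivative_linear by blast
      ultimately show "((\<lambda>t. f (p + t *\<^sub>R (x - p))) has_vector_derivative D (p + t *\<^sub>R (x - p)) (x - p)) (at t within {0..1})"
        by (simp add: has_vector_derivative_def linear_scale)
    qed simp
    then have "f x - f p = integral {0..1} (\<lambda>t. D (p + t *\<^sub>R (x - p)) (x - p))"
      by (simp add: integral_unique)
    also have "\<dots> = integral {0..1} (\<lambda>t. \<Sum>b\<in>onb V. ((x - p) \<bullet> b) * ddir f (p + t *\<^sub>R (x - p)) b)"
      using ray B(3) by (intro integral_cong eq) auto
    also have "\<dots> = (\<Sum>b\<in>onb V. integral {0..1} (\<lambda>t. ((x - p) \<bullet> b) * ddir f (p + t *\<^sub>R (x - p)) b))"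
    proof (rule integral_sum[OF finite_onb[OF V]])
      fix b assume b: "b \<in> onb V"
      have "continuous_on A (\<lambda>x. ddir f x b)"
        using smooth_on_ddir[OF f, of b] b onb_subset[OF V] Ck_on_continuous unfolding smooth_on_def by blast
      then have "continuous_on {0..1} (\<lambda>t. ddir f (p + t *\<^sub>R (x - p)) b)"
        by (rule continuous_on_compose2[of A "\<lambda>x. ddir f x b"])
          (use ray B(3) in \<open>auto intro!: continuous_intros\<close>)
      then show "(\<lambda>t. ((x - p) \<bullet> b) * ddir f (p + t *\<^sub>R (x - p)) b) integrable_on {0..1}"
        by (intro integrable_continuous_interval continuous_on_mult continuous_on_const)
    qed
    also have "\<dots> = (\<Sum>b\<in>onb V. ((x - p) \<bullet> b) * g b x)" by (simp add: g_def)
    finally show ?thesis by simp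
  qed
  moreover have "g b p = ddir f p b" for b by (simp add: g_def)
  ultimately show ?thesis using B(1-3) g by (intro that[of B g])
qed

text \<open>Differentiating Hadamard's expansion twice at \<open>p\<close>, where the factors
  \<open>(x - p) \<bullet> b\<close> vanish, gives an expression that is visibly symmetric in the
  two directions.\<close>

lemma ddir_sym:
  fixes f :: "'v \<Rightarrow> real"
  assumes f: "smooth_on V A f" and p: "p \<in> A" and uw: "u \<in> V" "w \<in> V"
  shows "ddir (\<lambda>x. ddir f x u) p w = ddir (\<lambda>x. ddir f x w) p u"
proof -
  obtain B g where B: "openin (top_of_set V) B" "p \<in> B" "B \<subseteq> A"
    and g: "\<And>b. b \<in> onb V \<Longrightarrow> smooth_on V B (g b)"
    and eq: "\<And>x. x \<in> B \<Longrightarrow> f x = f p + (\<Sum>b\<in>onb V. ((x - p) \<bullet> b) * g b x)"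
    by (rule hadamard[OF f p]) (rule that; assumption)
  have ray: "((\<lambda>t. g b (x + t *\<^sub>R v)) has_real_derivative ddir (g b) x v) (at 0)"
    if "b \<in> onb V" "x \<in> B" "v \<in> V" for b x v
    using smooth_on_ray[OF g that(2,3)] that by (simp add: has_real_derivative_iff_has_vector_derivative)
  have d1: "ddir f x v = (\<Sum>b\<in>onb V. (v \<bullet> b) * g b x + ((x - p) \<bullet> b) * ddir (g b) x v)"
    if x: "x \<in> B" and v: "v \<in> V" for x v
  proof -
    have "((\<lambda>t. f p + (\<Sum>b\<in>onb V. ((x + t *\<^sub>R v - p) \<bullet> b) * g b (x + t *\<^sub>R v))) has_real_derivative
        (\<Sum>b\<in>onb V. (v \<bullet> b) * g b x + ((x - p) \<bullet> b) * ddir (g b) x v)) (at 0)"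
      using ray x v
      by (auto intro!: derivative_eq_intros sum.cong simp: inner_diff_left inner_add_left)
    then have "ddir (\<lambda>x. f p + (\<Sum>b\<in>onb V. ((x - p) \<bullet> b) * g b x)) x v =
        (\<Sum>b\<in>onb V. (v \<bullet> b) * g b x + ((x - p) \<bullet> b) * ddir (g b) x v)"
      unfolding ddir_def
      by (simp add: has_real_derivative_iff_has_vector_derivative vector_derivative_at)
    then show ?thesis using ddir_cong[OF V B(1) x v eq] by simp
  qed
  have d2: "ddir (\<lambda>x. ddir f x v) p z = (\<Sum>b\<in>onb V. (v \<bullet> b) * ddir (g b) p z + (z \<bullet> b) * ddir (g b) p v)"
    if v: "v \<in> V" "z \<in> V" for v z
  proof -
    have "((\<lambda>t. ddir (g b) (p + t *\<^sub>R z) v) has_real_derivative ddir (\<lambda>x. ddir (g b) x v) p z) (at 0)"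
      if "b \<in> onb V" for b
      using smooth_on_ray[OF smooth_on_ddir[OF g v(1)] B(2) v(2)] that
      by (simp add: has_real_derivative_iff_has_vector_derivative)
    then have "((\<lambda>t. \<Sum>b\<in>onb V. (v \<bullet> b) * g b (p + t *\<^sub>R z) + ((p + t *\<^sub>R z - p) \<bullet> b) * ddir (g b) (p + t *\<^sub>R z) v)
        has_real_derivative (\<Sum>b\<in>onb V. (v \<bullet> b) * ddir (g b) p z + (z \<bullet> b) * ddir (g b) p v)) (at 0)"
      using ray[OF _ B(2)] v by (auto intro!: derivative_eq_intros sum.cong)
    then have "ddir (\<lambda>x. \<Sum>b\<in>onb V. (v \<bullet> b) * g b x + ((x - p) \<bullet> b) * ddir (g b) x v) p z =
        (\<Sum>b\<in>onb V. (v \<bullet> b) * ddir (g b) p z + (z \<bullet> b) * ddir (g b) p v)"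
      unfolding ddir_def[of "\<lambda>x. \<Sum>b\<in>onb V. (v \<bullet> b) * g b x + ((x - p) \<bullet> b) * ddir (g b) x v"]
      by (simp add: has_real_derivative_iff_has_vector_derivative vector_derivative_at)
    then show ?thesis using ddir_cong[OF V B(1,2) v(2) d1[OF _ v(1)]] by simp
  qed
  show ?thesis unfolding d2[OF uw] d2[OF uw(2,1)] by (intro sum.cong refl) simp
qed

end


section \<open>Closure properties of \<open>smooth_on\<close>\<close>

lemma smooth_on_openin: "smooth_on V A f \<Longrightarrow> openin (top_of_set V) A"
  by (simp add: smooth_on_def)

lemma smooth_on_subset:
  "smooth_on V A f \<Longrightarrow> openin (top_of_set V) B \<Longrightarrow> B \<subseteq> A \<Longrightarrow> smooth_on V B f"
  unfolding smooth_on_def by (blast intro: Ck_on_subset)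

lemma smooth_on_subspace:
  "smooth_on V A f \<Longrightarrow> W \<subseteq> V \<Longrightarrow> openin (top_of_set W) B \<Longrightarrow> B \<subseteq> A \<Longrightarrow> smooth_on W B f"
  unfolding smooth_on_def by (blast intro: Ck_on_subset Ck_on_subspace)

lemma smooth_on_cong: "(\<And>x. x \<in> A \<Longrightarrow> f x = g x) \<Longrightarrow> smooth_on V A f \<longleftrightarrow> smooth_on V A g"
  unfolding smooth_on_def using Ck_on_cong[of A f g] by blast

lemma smooth_on_eq: "smooth_on V A f \<Longrightarrow> (\<And>x. x \<in> A \<Longrightarrow> f x = g x) \<Longrightarrow> smooth_on V A g"
  using smooth_on_cong[of A f g V] by blast

lemma smooth_on_continuous: "smooth_on V A f \<Longrightarrow> continuous_on A f"
  unfolding smooth_on_def using Ck_on_continuous by blast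

lemma smooth_on_const: "openin (top_of_set V) A \<Longrightarrow> smooth_on V A (\<lambda>x. c)"
  by (simp add: smooth_on_def Ck_on_const)

lemma smooth_on_bounded_linear:
  "bounded_linear L \<Longrightarrow> openin (top_of_set V) A \<Longrightarrow> smooth_on V A L"
  by (simp add: smooth_on_def Ck_on_bounded_linear)

lemma smooth_on_add: "smooth_on V A f \<Longrightarrow> smooth_on V A g \<Longrightarrow> smooth_on V A (\<lambda>x. f x + g x)"
  by (simp add: smooth_on_def Ck_on_add)

lemma smooth_on_mult:
  fixes f g :: "'v::real_normed_vector \<Rightarrow> real"
  shows "smooth_on V A f \<Longrightarrow> smooth_on V A g \<Longrightarrow> smooth_on V A (\<lambda>x. f x * g x)"
  by (simp add: smooth_on_def Ck_on_mult)

lemma smooth_on_sum: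
  "openin (top_of_set V) A \<Longrightarrow> (\<And>i. i \<in> I \<Longrightarrow> smooth_on V A (f i)) \<Longrightarrow>
    smooth_on V A (\<lambda>x. \<Sum>i\<in>I. f i x)"
  by (simp add: smooth_on_def Ck_on_sum)

lemma smooth_on_local:
  fixes V :: "'v::euclidean_space set"
  assumes "subspace V" "\<And>x. x \<in> A \<Longrightarrow> \<exists>B. x \<in> B \<and> B \<subseteq> A \<and> smooth_on V B f"
  shows "smooth_on V A f"
proof -
  have op: "openin (top_of_set V) A"
  proof (subst openin_subopen, intro ballI)
    fix x assume "x \<in> A"
    then obtain B where "x \<in> B" "B \<subseteq> A" "smooth_on V B f" using assms(2) by blast
    then show "\<exists>T. openin (top_of_set V) T \<and> x \<in> T \<and> T \<subseteq> A"
      using smooth_on_openin[of V B f] by blast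
  qed
  have "Ck_on k V A f" for k
  proof (rule Ck_on_local[OF assms(1) op])
    fix x assume "x \<in> A"
    then show "\<exists>B. openin (top_of_set V) B \<and> x \<in> B \<and> B \<subseteq> A \<and> Ck_on k V B f"
      using assms(2)[of x] unfolding smooth_on_def by blast
  qed
  then show ?thesis using op by (simp add: smooth_on_def)
qed

lemma smooth_on_compose:
  fixes f :: "'w::euclidean_space \<Rightarrow> 'b::real_normed_vector" and g :: "'v::euclidean_space \<Rightarrow> 'w"
  assumes "subspace V" "subspace W" "smooth_on W B f" "smooth_on V A g" "g ` A \<subseteq> B"
  shows "smooth_on V A (\<lambda>x. f (g x))"
proof -
  have "openin (top_of_set V) A" "B \<subseteq> W"
    using assms(3,4) smooth_on_openin openin_imp_subset by blast+
  then show ?thesis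
    using assms(3,4) Ck_on_compose[OF assms(1,2) _ _ assms(5)] unfolding smooth_on_def by metis
qed

section \<open>Charts and smooth functions\<close>

text \<open>The total space of the normal bundle is only needed as a manifold in this weak sense, without
  the separation and countability axioms.\<close>

definition premanifold :: "('a, 'v::euclidean_space) mfd \<Rightarrow> bool"
  where "premanifold M \<longleftrightarrow>
    subspace (model M) \<and> atlas M \<subseteq> charts M \<and> (\<Union>(U, \<phi>)\<in>atlas M. U) = points M"

lemma smooth_manifold_premanifold: "smooth_manifold M \<Longrightarrow> premanifold M"
  by (simp add: smooth_manifold_def premanifold_def)

lemma charts_chart_on:
  assumes "(U, \<phi>) \<in> charts M"
  shows "U \<subseteq> points M" "inj_on \<phi> U" "openin (top_of_set (model M)) (\<phi> ` U)" "\<phi> ` U \<subseteq> model M"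
proof -
  show *: "U \<subseteq> points M" "inj_on \<phi> U" "openin (top_of_set (model M)) (\<phi> ` U)"
    using assms by (auto simp: charts_def chart_on_def)
  show "\<phi> ` U \<subseteq> model M" using openin_imp_subset[OF *(3)] .
qed

lemma transition_preimage_openin:
  assumes c: "smooth_transition V (U, \<phi>) (U', \<psi>)" and inj: "inj_on \<phi> U"
    and V: "\<psi> ` U' \<subseteq> V" and T: "openin (top_of_set V) T"
  shows "openin (top_of_set V) (\<phi> ` {z \<in> U \<inter> U'. \<psi> z \<in> T})"
proof -
  let ?A = "\<phi> ` (U \<inter> U')" and ?g = "\<psi> \<circ> inv_into U \<phi>"
  have s: "smooth_on V ?A ?g" using c by (simp add: smooth_transition_def)
  obtain T' where T': "open T'" "T = V \<inter> T'" using T unfolding openin_open by blast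
  have "openin (top_of_set ?A) (?A \<inter> ?g -` T')"
    using continuous_openin_preimage_gen[OF smooth_on_continuous[OF s] T'(1)] .
  then have "openin (top_of_set V) (?A \<inter> ?g -` T')"
    using smooth_on_openin[OF s] openin_trans by blast
  moreover have "?A \<inter> ?g -` T' = \<phi> ` {z \<in> U \<inter> U'. \<psi> z \<in> T}"
    using V T'(2) inj by (auto simp: inv_into_f_f)
  ultimately show ?thesis by simp
qed

text \<open>Around each common point the transition is the composite of two transitions through a
  third chart. That chart may vary with the point because smoothness is local.\<close>

lemma smooth_transition_local:
  assumes V: "subspace V" and inj: "inj_on \<phi> U"
    and ex: "\<And>z. z \<in> U \<inter> U' \<Longrightarrow> \<exists>U'' \<kappa>. z \<in> U'' \<and> inj_on \<kappa> U'' \<and> \<kappa> ` U'' \<subseteq> V \<and>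
      smooth_transition V (U, \<phi>) (U'', \<kappa>) \<and> smooth_transition V (U'', \<kappa>) (U', \<psi>)"
  shows "smooth_transition V (U, \<phi>) (U', \<psi>)"
  unfolding smooth_transition_def prod.case
proof (rule smooth_on_local[OF V])
  fix x assume "x \<in> \<phi> ` (U \<inter> U')"
  then obtain z where z: "z \<in> U \<inter> U'" "x = \<phi> z" by blast
  obtain U'' \<kappa> where b: "z \<in> U''" "inj_on \<kappa> U''" "\<kappa> ` U'' \<subseteq> V"
    "smooth_transition V (U, \<phi>) (U'', \<kappa>)" "smooth_transition V (U'', \<kappa>) (U', \<psi>)"
    using ex[OF z(1)] by blast
  let ?T = "\<kappa> ` (U'' \<inter> U')" and ?B = "\<phi> ` (U \<inter> U'' \<inter> U')"
  have T: "smooth_on V ?T (\<psi> \<circ> inv_into U'' \<kappa>)" using b(5) by (simp add: smooth_transition_def)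
  have "\<phi> ` {z \<in> U \<inter> U''. \<kappa> z \<in> ?T} = ?B"
    using b(2) by (auto simp: inj_on_image_mem_iff inj_on_eq_iff)
  then have B: "openin (top_of_set V) ?B"
    using transition_preimage_openin[OF b(4) inj b(3) smooth_on_openin[OF T]] by simp
  have s: "smooth_on V ?B (\<kappa> \<circ> inv_into U \<phi>)"
    using b(4) B by (auto simp: smooth_transition_def intro: smooth_on_subset)
  have "smooth_on V ?B (\<lambda>x. (\<psi> \<circ> inv_into U'' \<kappa>) ((\<kappa> \<circ> inv_into U \<phi>) x))"
    by (rule smooth_on_compose[OF V V T s]) (use inj in \<open>auto simp: inv_into_f_f\<close>)
  moreover have "(\<psi> \<circ> inv_into U'' \<kappa>) ((\<kappa> \<circ> inv_into U \<phi>) y) = (\<psi> \<circ> inv_into U \<phi>) y" if "y \<in> ?B" for y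
    using that inj b(2) by (auto simp: inv_into_f_f)
  ultimately have "smooth_on V ?B (\<psi> \<circ> inv_into U \<phi>)"
    by (rule smooth_on_eq)
  then show "\<exists>B. x \<in> B \<and> B \<subseteq> \<phi> ` (U \<inter> U') \<and> smooth_on V B (\<psi> \<circ> inv_into U \<phi>)"
    using z b(1) by (intro exI[of _ ?B]) auto
qed

section \<open>The maximal atlas, the topology and smooth functions\<close>

context
  fixes M :: "('a, 'v::euclidean_space) mfd"
  assumes M: "premanifold M"
begin

lemma model_subspace: "subspace (model M)"
  using M by (simp add: premanifold_def)

lemma atlas_chart_exists:
  assumes "p \<in> points M"
  obtains U \<phi> where "(U, \<phi>) \<in> atlas M" "(U, \<phi>) \<in> charts M" "p \<in> U"
proof -
  have "p \<in> (\<Union>(U, \<phi>)\<in>atlas M. U)" "atlas M \<subseteq> charts M"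
    using M assms by (simp_all add: premanifold_def)
  then show ?thesis using that by blast
qed

lemma chart_exists:
  assumes "p \<in> points M"
  obtains U \<phi> where "(U, \<phi>) \<in> charts M" "p \<in> U"
  by (rule atlas_chart_exists[OF assms]) (rule that)

lemma charts_atlas_transition:
  assumes "c \<in> charts M" "d \<in> atlas M"
  shows "smooth_transition (model M) c d" "smooth_transition (model M) d c"
  using assms unfolding charts_def by blast+

text \<open>Members of \<open>charts\<close> are compatible by definition with the atlas only;
  around each common point an atlas chart mediates between them.\<close>

lemma charts_transition:
  assumes c: "(U, \<phi>) \<in> charts M" and d: "(U', \<psi>) \<in> charts M"
  shows "smooth_transition (model M) (U, \<phi>) (U', \<psi>)"
proof (rule smooth_transition_local[OF model_subspace charts_chart_on(2)[OF c]])
  fix z assume "z \<in> U \<inter> U'"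
  then have "z \<in> points M" using charts_chart_on(1)[OF c] by blast
  then obtain U'' \<kappa> where b: "(U'', \<kappa>) \<in> atlas M" "(U'', \<kappa>) \<in> charts M" "z \<in> U''"
    using atlas_chart_exists by blast
  show "\<exists>U'' \<kappa>. z \<in> U'' \<and> inj_on \<kappa> U'' \<and> \<kappa> ` U'' \<subseteq> model M \<and>
      smooth_transition (model M) (U, \<phi>) (U'', \<kappa>) \<and> smooth_transition (model M) (U'', \<kappa>) (U', \<psi>)"
    using b charts_atlas_transition[OF c b(1)] charts_atlas_transition[OF d b(1)]
      charts_chart_on(2,4)[OF b(2)] by blast
qed

lemma charts_restrict:
  assumes c: "(U, \<phi>) \<in> charts M" and sub: "U' \<subseteq> U" and op: "openin (top_of_set (model M)) (\<phi> ` U')"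
  shows "(U', \<phi>) \<in> charts M"
proof -
  note cc = charts_chart_on[OF c]
  have inj': "inj_on \<phi> U'" using cc(2) sub inj_on_subset by blast
  have "smooth_transition (model M) (U', \<phi>) (W, \<psi>) \<and> smooth_transition (model M) (W, \<psi>) (U', \<phi>)"
    if d: "(W, \<psi>) \<in> atlas M" for W \<psi>
  proof
    have dc: "(W, \<psi>) \<in> charts M" using d M by (auto simp: premanifold_def)
    note dd = charts_chart_on[OF dc]
    have t: "smooth_on (model M) (\<phi> ` (U \<inter> W)) (\<psi> \<circ> inv_into U \<phi>)"
      "smooth_on (model M) (\<psi> ` (W \<inter> U)) (\<phi> \<circ> inv_into W \<psi>)"
      using charts_atlas_transition[OF c d] by (auto simp: smooth_transition_def)
    have "\<phi> ` (U' \<inter> W) = \<phi> ` U' \<inter> \<phi> ` (U \<inter> W)"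
      using cc(2) sub by (auto simp: inj_on_eq_iff)
    then have "openin (top_of_set (model M)) (\<phi> ` (U' \<inter> W))"
      using op smooth_on_openin[OF t(1)] openin_Int by metis
    then have "smooth_on (model M) (\<phi> ` (U' \<inter> W)) (\<psi> \<circ> inv_into U \<phi>)"
      using sub by (intro smooth_on_subset[OF t(1)]) auto
    moreover have "(\<psi> \<circ> inv_into U \<phi>) x = (\<psi> \<circ> inv_into U' \<phi>) x" if "x \<in> \<phi> ` (U' \<inter> W)" for x
      using that sub cc(2) inj' by (auto simp: inv_into_f_f subset_iff)
    ultimately show "smooth_transition (model M) (U', \<phi>) (W, \<psi>)"
      unfolding smooth_transition_def prod.case by (rule smooth_on_eq)
    have "{z \<in> W \<inter> U. \<phi> z \<in> \<phi> ` U'} = W \<inter> U'"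
      using cc(2) sub by (auto simp: inj_on_eq_iff)
    then have "openin (top_of_set (model M)) (\<psi> ` (W \<inter> U'))"
      using transition_preimage_openin[OF charts_atlas_transition(2)[OF c d] dd(2) cc(4) op] by simp
    then show "smooth_transition (model M) (W, \<psi>) (U', \<phi>)"
      using sub unfolding smooth_transition_def prod.case by (intro smooth_on_subset[OF t(2)]) auto
  qed
  then show ?thesis using cc sub inj' op by (auto simp: charts_def chart_on_def)
qed

text \<open>The definition asks for some chart on whose whole domain \<open>f\<close> is smooth.
  Here the chart is prescribed and the freedom moved into the neighbourhood \<open>T\<close>, so
  that several functions can be treated in one common chart.\<close>

lemma smooth_fun_at_iff:
  assumes c: "(U, \<phi>) \<in> charts M" and p: "p \<in> U"
  shows "smooth_fun_at M p f \<longleftrightarrow>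
    (\<exists>T. \<phi> p \<in> T \<and> T \<subseteq> \<phi> ` U \<and> smooth_on (model M) T (f \<circ> inv_into U \<phi>))"
proof
  note cc = charts_chart_on[OF c]
  assume "smooth_fun_at M p f"
  then obtain U' \<psi> where d: "(U', \<psi>) \<in> charts M" "p \<in> U'"
    and f: "smooth_on (model M) (\<psi> ` U') (f \<circ> inv_into U' \<psi>)"
    unfolding smooth_fun_at_def by blast
  note dd = charts_chart_on[OF d(1)]
  have t: "smooth_on (model M) (\<phi> ` (U \<inter> U')) (\<psi> \<circ> inv_into U \<phi>)"
    using charts_transition[OF c d(1)] by (simp add: smooth_transition_def)
  have "smooth_on (model M) (\<phi> ` (U \<inter> U')) (\<lambda>x. (f \<circ> inv_into U' \<psi>) ((\<psi> \<circ> inv_into U \<phi>) x))"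
    by (rule smooth_on_compose[OF model_subspace model_subspace f t])
      (use cc in \<open>auto simp: inv_into_f_f\<close>)
  moreover have "(f \<circ> inv_into U' \<psi>) ((\<psi> \<circ> inv_into U \<phi>) x) = (f \<circ> inv_into U \<phi>) x"
    if "x \<in> \<phi> ` (U \<inter> U')" for x
    using that cc dd by (auto simp: inv_into_f_f)
  ultimately have "smooth_on (model M) (\<phi> ` (U \<inter> U')) (f \<circ> inv_into U \<phi>)"
    by (rule smooth_on_eq)
  then show "\<exists>T. \<phi> p \<in> T \<and> T \<subseteq> \<phi> ` U \<and> smooth_on (model M) T (f \<circ> inv_into U \<phi>)"
    using p d(2) by (intro exI[of _ "\<phi> ` (U \<inter> U')"]) auto
next
  note cc = charts_chart_on[OF c]
  assume "\<exists>T. \<phi> p \<in> T \<and> T \<subseteq> \<phi> ` U \<and> smooth_on (model M) T (f \<circ> inv_into U \<phi>)"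
  then obtain T where T: "\<phi> p \<in> T" "T \<subseteq> \<phi> ` U" "smooth_on (model M) T (f \<circ> inv_into U \<phi>)" by blast
  let ?U = "{z \<in> U. \<phi> z \<in> T}"
  have im: "\<phi> ` ?U = T" using T(2) by auto
  have "(?U, \<phi>) \<in> charts M" using smooth_on_openin[OF T(3)] im by (intro charts_restrict[OF c]) auto
  moreover have "(f \<circ> inv_into U \<phi>) x = (f \<circ> inv_into ?U \<phi>) x" if x: "x \<in> \<phi> ` ?U" for x
  proof -
    have inj: "inj_on \<phi> ?U" using cc(2) by (rule inj_on_subset) auto
    obtain z where z: "z \<in> ?U" "x = \<phi> z" using x by blast
    then show ?thesis using cc(2) inj inv_into_f_f[of \<phi> ?U z] by simp
  qed
  then have "smooth_on (model M) (\<phi> ` ?U) (f \<circ> inv_into ?U \<phi>)"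
    using T(3) unfolding im by (intro smooth_on_eq[OF T(3)])
  ultimately show "smooth_fun_at M p f"
    unfolding smooth_fun_at_def using p T(1) by (intro bexI[of _ "(?U, \<phi>)"]) auto
qed

lemma smooth_fun_atI:
  assumes "(U, \<phi>) \<in> charts M" "p \<in> U" "\<phi> p \<in> T" "T \<subseteq> \<phi> ` U"
    and "smooth_on (model M) T (f \<circ> inv_into U \<phi>)"
  shows "smooth_fun_at M p f"
  using assms(3-5) smooth_fun_at_iff[OF assms(1,2)] by blast

text \<open>The candidate open sets do form a topology, which is what allows \<open>topology\<close>
  to be unfolded; injectivity of the charts is used for intersections.\<close>

lemma openin_mfd_topology:
  "openin (mfd_topology M) G \<longleftrightarrow> G \<subseteq> points M \<and>
    (\<forall>(U, \<phi>)\<in>atlas M. openin (top_of_set (model M)) (\<phi> ` (G \<inter> U)))"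
proof -
  let ?P = "\<lambda>G. G \<subseteq> points M \<and> (\<forall>(U, \<phi>)\<in>atlas M. openin (top_of_set (model M)) (\<phi> ` (G \<inter> U)))"
  have "istopology ?P"
    unfolding istopology_def
  proof safe
    fix G H U \<phi> assume *: "(U, \<phi>) \<in> atlas M"
      "\<forall>(U, \<phi>)\<in>atlas M. openin (top_of_set (model M)) (\<phi> ` (G \<inter> U))"
      "\<forall>(U, \<phi>)\<in>atlas M. openin (top_of_set (model M)) (\<phi> ` (H \<inter> U))"
    have "inj_on \<phi> U" using *(1) M charts_chart_on(2) by (force simp: premanifold_def)
    then have "\<phi> ` (G \<inter> H \<inter> U) = \<phi> ` (G \<inter> U) \<inter> \<phi> ` (H \<inter> U)" by (auto simp: inj_on_eq_iff)
    then show "openin (top_of_set (model M)) (\<phi> ` (G \<inter> H \<inter> U))" using * by auto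
  next
    fix \<G> U \<phi> assume *: "(U, \<phi>) \<in> atlas M"
      "\<forall>G\<in>\<G>. G \<subseteq> points M \<and> (\<forall>(U, \<phi>)\<in>atlas M. openin (top_of_set (model M)) (\<phi> ` (G \<inter> U)))"
    have "\<phi> ` (\<Union>\<G> \<inter> U) = (\<Union>G\<in>\<G>. \<phi> ` (G \<inter> U))" by auto
    then show "openin (top_of_set (model M)) (\<phi> ` (\<Union>\<G> \<inter> U))" using * by (auto intro!: openin_Union)
  qed auto
  from topology_inverse'[OF this] show ?thesis by (simp add: mfd_topology_def)
qed

lemma chart_image_openin:
  assumes c: "(U, \<phi>) \<in> charts M" and G: "openin (mfd_topology M) G"
  shows "openin (top_of_set (model M)) (\<phi> ` (G \<inter> U))"
proof (subst openin_subopen, intro ballI)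
  fix x assume "x \<in> \<phi> ` (G \<inter> U)"
  then obtain z where z: "z \<in> G" "z \<in> U" "x = \<phi> z" by blast
  then obtain W \<psi> where d: "(W, \<psi>) \<in> atlas M" "(W, \<psi>) \<in> charts M" "z \<in> W"
    using atlas_chart_exists charts_chart_on(1)[OF c] by blast
  note dd = charts_chart_on[OF d(2)]
  have "openin (top_of_set (model M)) (\<psi> ` (G \<inter> W))" using G d openin_mfd_topology by blast
  from transition_preimage_openin[OF charts_atlas_transition(1)[OF c d(1)] charts_chart_on(2)[OF c] dd(4) this]
  show "\<exists>T. openin (top_of_set (model M)) T \<and> x \<in> T \<and> T \<subseteq> \<phi> ` (G \<inter> U)"
    using z d(3) dd(2) by (intro exI[of _ "\<phi> ` {z \<in> U \<inter> W. \<psi> z \<in> \<psi> ` (G \<inter> W)}"]) (auto simp: inj_on_eq_iff)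
qed

lemma chart_preimage_openin:
  assumes c: "(U, \<phi>) \<in> charts M" and T: "openin (top_of_set (model M)) T"
  shows "openin (mfd_topology M) {z \<in> U. \<phi> z \<in> T}"
  unfolding openin_mfd_topology
proof safe
  fix z assume "z \<in> U" then show "z \<in> points M" using charts_chart_on(1)[OF c] by blast
next
  fix W \<psi> assume d: "(W, \<psi>) \<in> atlas M"
  then have "(W, \<psi>) \<in> charts M" using M by (auto simp: premanifold_def)
  then have "openin (top_of_set (model M)) (\<psi> ` {z \<in> W \<inter> U. \<phi> z \<in> T})"
    using transition_preimage_openin[OF charts_atlas_transition(2)[OF c d] charts_chart_on(2) charts_chart_on(4)[OF c] T]
    by blast
  moreover have "{z \<in> W \<inter> U. \<phi> z \<in> T} = {z \<in> U. \<phi> z \<in> T} \<inter> W" by blast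
  ultimately show "openin (top_of_set (model M)) (\<psi> ` ({z \<in> U. \<phi> z \<in> T} \<inter> W))" by simp
qed

lemma chart_openin:
  assumes c: "(U, \<phi>) \<in> charts M"
  shows "openin (mfd_topology M) U"
proof -
  have "{z \<in> U. \<phi> z \<in> \<phi> ` U} = U" by auto
  then show ?thesis using chart_preimage_openin[OF c charts_chart_on(3)[OF c]] by simp
qed

lemma smooth_fun_at_points: "smooth_fun_at M p f \<Longrightarrow> p \<in> points M"
  unfolding smooth_fun_at_def using charts_chart_on(1) by blast

lemma openin_mfd_points: "openin (mfd_topology M) (points M)"
proof -
  have "\<phi> ` (points M \<inter> U) = \<phi> ` U" "openin (top_of_set (model M)) (\<phi> ` U)" if "(U, \<phi>) \<in> atlas M" for U \<phi>
    using that M charts_chart_on[of U \<phi> M] by (auto simp: premanifold_def)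
  then show ?thesis unfolding openin_mfd_topology by auto
qed

lemma smooth_fun_at_nhd:
  assumes "smooth_fun_at M p f"
  obtains G where "openin (mfd_topology M) G" "p \<in> G" "\<And>x. x \<in> G \<Longrightarrow> smooth_fun_at M x f"
proof -
  obtain U \<phi> where c: "(U, \<phi>) \<in> charts M" "p \<in> U" "smooth_on (model M) (\<phi> ` U) (f \<circ> inv_into U \<phi>)"
    using assms unfolding smooth_fun_at_def by blast
  then have "smooth_fun_at M x f" if "x \<in> U" for x
    using that unfolding smooth_fun_at_def by blast
  then show ?thesis by (rule that[OF chart_openin[OF c(1)] c(2)])
qed

lemma smooth_fun_at_cong:
  assumes f: "smooth_fun_at M p f" and G: "openin (mfd_topology M) G" "p \<in> G"
    and eq: "\<And>x. x \<in> G \<Longrightarrow> f x = g x"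
  shows "smooth_fun_at M p g"
proof -
  obtain U \<phi> where c: "(U, \<phi>) \<in> charts M" "p \<in> U"
    and s: "smooth_on (model M) (\<phi> ` U) (f \<circ> inv_into U \<phi>)"
    using f unfolding smooth_fun_at_def by blast
  note cc = charts_chart_on[OF c(1)]
  let ?T = "\<phi> ` (G \<inter> U)"
  have "smooth_on (model M) ?T (f \<circ> inv_into U \<phi>)"
    using chart_image_openin[OF c(1) G(1)] by (rule smooth_on_subset[OF s]) auto
  moreover have "(f \<circ> inv_into U \<phi>) x = (g \<circ> inv_into U \<phi>) x" if "x \<in> ?T" for x
    using that cc eq by (auto simp: inv_into_f_f)
  ultimately have "smooth_on (model M) ?T (g \<circ> inv_into U \<phi>)"
    by (rule smooth_on_eq)
  moreover have "\<phi> p \<in> ?T" "?T \<subseteq> \<phi> ` U" using c(2) G(2) by auto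
  ultimately show ?thesis using smooth_fun_atI[OF c] by metis
qed

lemma smooth_fun_at_const:
  assumes "p \<in> points M" shows "smooth_fun_at M p (\<lambda>x. a)"
proof -
  obtain U \<phi> where c: "(U, \<phi>) \<in> charts M" "p \<in> U" by (rule chart_exists[OF assms])
  have "smooth_on (model M) (\<phi> ` U) ((\<lambda>x. a) \<circ> inv_into U \<phi>)"
    using smooth_on_const[OF charts_chart_on(3)[OF c(1)]] by (simp add: o_def)
  then show ?thesis using smooth_fun_atI[OF c imageI[OF c(2)] subset_refl] by blast
qed

lemma smooth_fun_at_binop:
  assumes f: "smooth_fun_at M p f" and g: "smooth_fun_at M p g"
    and H: "\<And>A u v. smooth_on (model M) A u \<Longrightarrow> smooth_on (model M) A v \<Longrightarrow>
      smooth_on (model M) A (\<lambda>x. b (u x) (v x))"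
  shows "smooth_fun_at M p (\<lambda>x. b (f x) (g x))"
proof -
  obtain U \<phi> where c: "(U, \<phi>) \<in> charts M" "p \<in> U"
    by (rule chart_exists[OF smooth_fun_at_points[OF f]])
  obtain T T' where T: "\<phi> p \<in> T" "T \<subseteq> \<phi> ` U" "smooth_on (model M) T (f \<circ> inv_into U \<phi>)"
    "\<phi> p \<in> T'" "T' \<subseteq> \<phi> ` U" "smooth_on (model M) T' (g \<circ> inv_into U \<phi>)"
    using f g unfolding smooth_fun_at_iff[OF c] by blast
  have o: "openin (top_of_set (model M)) (T \<inter> T')"
    using smooth_on_openin[OF T(3)] smooth_on_openin[OF T(6)] by blast
  have "smooth_on (model M) (T \<inter> T') (\<lambda>x. b ((f \<circ> inv_into U \<phi>) x) ((g \<circ> inv_into U \<phi>) x))"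
    by (intro H smooth_on_subset[OF T(3) o] smooth_on_subset[OF T(6) o]) auto
  then have "smooth_on (model M) (T \<inter> T') ((\<lambda>x. b (f x) (g x)) \<circ> inv_into U \<phi>)"
    by (simp add: o_def)
  moreover have "\<phi> p \<in> T \<inter> T'" "T \<inter> T' \<subseteq> \<phi> ` U" using T by auto
  ultimately show ?thesis using smooth_fun_atI[OF c] by metis
qed

lemma smooth_fun_at_add:
  "smooth_fun_at M p f \<Longrightarrow> smooth_fun_at M p g \<Longrightarrow> smooth_fun_at M p (\<lambda>x. f x + g x)"
  by (rule smooth_fun_at_binop) (auto intro: smooth_on_add)

lemma smooth_fun_at_mult:
  "smooth_fun_at M p f \<Longrightarrow> smooth_fun_at M p g \<Longrightarrow> smooth_fun_at M p (\<lambda>x. f x * g x)"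
  by (rule smooth_fun_at_binop) (auto intro: smooth_on_mult)

lemma smooth_fun_at_cmult: "smooth_fun_at M p f \<Longrightarrow> smooth_fun_at M p (\<lambda>x. a * f x)"
  by (intro smooth_fun_at_mult smooth_fun_at_const smooth_fun_at_points)

lemma smooth_fun_at_uminus: "smooth_fun_at M p f \<Longrightarrow> smooth_fun_at M p (\<lambda>x. - f x)"
  using smooth_fun_at_cmult[of p f "-1"] by simp

lemma smooth_fun_at_diff:
  "smooth_fun_at M p f \<Longrightarrow> smooth_fun_at M p g \<Longrightarrow> smooth_fun_at M p (\<lambda>x. f x - g x)"
  using smooth_fun_at_add[of p f "\<lambda>x. - g x"] smooth_fun_at_uminus by simp

lemma smooth_fun_at_sum:
  assumes "p \<in> points M" "\<And>i. i \<in> I \<Longrightarrow> smooth_fun_at M p (f i)"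
  shows "smooth_fun_at M p (\<lambda>x. \<Sum>i\<in>I. f i x)"
  using assms(2)
proof (induction I rule: infinite_finite_induct)
  case (insert i I)
  then show ?case by (simp add: smooth_fun_at_add)
qed (simp_all add: smooth_fun_at_const assms)

lemma smooth_fun_at_coord:
  assumes c: "(U, \<phi>) \<in> charts M" and p: "p \<in> U"
  shows "smooth_fun_at M p (\<lambda>x. \<phi> x \<bullet> b)"
proof -
  note cc = charts_chart_on[OF c]
  have "smooth_on (model M) (\<phi> ` U) (\<lambda>u. u \<bullet> b)"
    by (rule smooth_on_bounded_linear[OF bounded_linear_inner_left cc(3)])
  moreover have "u \<bullet> b = ((\<lambda>x. \<phi> x \<bullet> b) \<circ> inv_into U \<phi>) u" if "u \<in> \<phi> ` U" for u
    using that cc by (auto simp: inv_into_f_f)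
  ultimately have "smooth_on (model M) (\<phi> ` U) ((\<lambda>x. \<phi> x \<bullet> b) \<circ> inv_into U \<phi>)"
    by (rule smooth_on_eq)
  then show ?thesis using smooth_fun_atI[OF c p imageI[OF p] subset_refl] by blast
qed

end

lemma smooth_fun_at_comp:
  assumes M: "premanifold M" and N: "premanifold N"
    and F: "smooth_map_at M N p F" and g: "smooth_fun_at N (F p) g"
  shows "smooth_fun_at M p (g \<circ> F)"
proof -
  obtain U \<phi> U' \<psi> where c: "(U, \<phi>) \<in> charts M" "(U', \<psi>) \<in> charts N" "p \<in> U" "F ` U \<subseteq> U'"
    and s: "smooth_on (model M) (\<phi> ` U) (\<psi> \<circ> F \<circ> inv_into U \<phi>)"
    using F unfolding smooth_map_at_def by blast
  note cc = charts_chart_on[OF c(1)] and dd = charts_chart_on[OF c(2)]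
  have Fp: "F p \<in> U'" using c by blast
  obtain T where T: "\<psi> (F p) \<in> T" "T \<subseteq> \<psi> ` U'" "smooth_on (model N) T (g \<circ> inv_into U' \<psi>)"
    using g unfolding smooth_fun_at_iff[OF N c(2) Fp] by blast
  let ?h = "\<psi> \<circ> F \<circ> inv_into U \<phi>"
  obtain T' where T': "open T'" "T = model N \<inter> T'"
    using smooth_on_openin[OF T(3)] unfolding openin_open by blast
  let ?A = "\<phi> ` U \<inter> ?h -` T'"
  have "openin (top_of_set (\<phi> ` U)) ?A"
    using continuous_openin_preimage_gen[OF smooth_on_continuous[OF s] T'(1)] .
  then have A: "openin (top_of_set (model M)) ?A" using cc(3) openin_trans by blast
  have hA: "?h ` ?A \<subseteq> T"
    using T'(2) c(4) dd(4) cc by (auto simp: inv_into_f_f image_subset_iff)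
  have "smooth_on (model M) ?A (\<lambda>x. (g \<circ> inv_into U' \<psi>) (?h x))"
    using smooth_on_compose[OF model_subspace[OF M] model_subspace[OF N] T(3) smooth_on_subset[OF s A] hA]
    by blast
  moreover have "(g \<circ> inv_into U' \<psi>) (?h x) = (g \<circ> F \<circ> inv_into U \<phi>) x" if "x \<in> ?A" for x
    using that c(4) dd cc by (auto simp: inv_into_f_f image_subset_iff)
  ultimately have "smooth_on (model M) ?A (g \<circ> F \<circ> inv_into U \<phi>)"
    by (rule smooth_on_eq)
  moreover have "\<phi> p \<in> ?A" using T T' c(3) cc by (auto simp: inv_into_f_f)
  ultimately show ?thesis using smooth_fun_atI[OF M c(1,3)] by (metis Int_lower1)
qed

section \<open>Tangent and cotangent vectors\<close>

lemma linear_over_dual: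
  assumes "linear_over A a" "x \<in> A" "y \<in> A"
  shows "a (x + y) = a x + a y" "a (c *\<^sub>R x) = c *\<^sub>R a x"
  using assms by (auto simp: linear_over_def)

lemma fun_sum_apply: "(\<Sum>i\<in>I. f i) x = (\<Sum>i\<in>I. f i x)"
  by (induction I rule: infinite_finite_induct) auto

lemma fun_scaleR_apply [simp]: "(c *\<^sub>R f) x = c *\<^sub>R f x"
  by (simp add: scaleR_fun_def)

lemma linear_over_sum:
  assumes "subspace A" "linear_over A a" "\<And>i. i \<in> I \<Longrightarrow> x i \<in> A"
  shows "a (\<Sum>i\<in>I. c i *\<^sub>R x i) = (\<Sum>i\<in>I. c i *\<^sub>R a (x i))"
  using assms(3)
proof (induction I rule: infinite_finite_induct)
  case (insert i I)
  have "(\<Sum>i\<in>I. c i *\<^sub>R x i) \<in> A"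
    using insert.prems assms(1) by (intro subspace_sum subspace_scale) auto
  then show ?case
    using insert linear_over_dual[OF assms(2)] assms(1) by (simp add: subspace_scale)
next
  case (infinite I)
  then show ?case using linear_over_dual(2)[OF assms(2) subspace_0[OF assms(1)] subspace_0[OF assms(1)], of 0] by simp
next
  case empty
  then show ?case using linear_over_dual(2)[OF assms(2) subspace_0[OF assms(1)] subspace_0[OF assms(1)], of 0] by simp
qed

lemma subspace_dual_space: "subspace (dual_space A)"
  by (auto simp: subspace_def dual_space_def linear_over_def algebra_simps)

lemma subspace_tangent_space: "subspace (tangent_space M p)"
  by (auto simp: subspace_def tangent_space_def algebra_simps)

lemma subspace_cotangent_space: "subspace (cotangent_space M p)"
  by (simp add: cotangent_space_def subspace_dual_space)

lemma cotangent_linear: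
  assumes "a \<in> cotangent_space M p" "v \<in> tangent_space M p" "w \<in> tangent_space M p"
  shows "a (v + w) = a v + a w" "a (v - w) = a v - a w"
proof -
  have l: "linear_over (tangent_space M p) a"
    using assms(1) by (simp add: cotangent_space_def dual_space_def)
  then show "a (v + w) = a v + a w" using assms(2,3) by (simp add: linear_over_def)
  have "(-1) *\<^sub>R w \<in> tangent_space M p" by (rule subspace_scale[OF subspace_tangent_space assms(3)])
  from linear_over_dual(1)[OF l assms(2) this] linear_over_dual(2)[OF l assms(3,3), of "-1"]
  show "a (v - w) = a v - a w" by simp
qed

lemma cotangent_scale:
  "a \<in> cotangent_space M p \<Longrightarrow> v \<in> tangent_space M p \<Longrightarrow> a (c *\<^sub>R v) = c * a v"
  by (simp add: cotangent_space_def dual_space_def linear_over_def)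

lemma cotangent_outside: "a \<in> cotangent_space M p \<Longrightarrow> v \<notin> tangent_space M p \<Longrightarrow> a v = 0"
  by (simp add: cotangent_space_def dual_space_def)

lemma cotangent_eqI:
  assumes "a \<in> cotangent_space M p" "b \<in> cotangent_space M p"
    and "\<And>v. v \<in> tangent_space M p \<Longrightarrow> a v = b v"
  shows "a = b"
proof
  fix v show "a v = b v"
    using assms(3) cotangent_outside[OF assms(1)] cotangent_outside[OF assms(2)]
    by (cases "v \<in> tangent_space M p") auto
qed

lemma tangent_not_smooth: "v \<in> tangent_space M p \<Longrightarrow> \<not> smooth_fun_at M p f \<Longrightarrow> v f = 0"
  by (simp add: tangent_space_def)

lemma tangent_add:
  "v \<in> tangent_space M p \<Longrightarrow> smooth_fun_at M p f \<Longrightarrow> smooth_fun_at M p g \<Longrightarrow>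
    v (\<lambda>x. f x + g x) = v f + v g"
  by (simp add: tangent_space_def plus_fun_def)

lemma tangent_mult:
  "v \<in> tangent_space M p \<Longrightarrow> smooth_fun_at M p f \<Longrightarrow> smooth_fun_at M p g \<Longrightarrow>
    v (\<lambda>x. f x * g x) = v f * g p + f p * v g"
  by (simp add: tangent_space_def times_fun_def)

lemma tangent_scale:
  "v \<in> tangent_space M p \<Longrightarrow> smooth_fun_at M p f \<Longrightarrow> v (\<lambda>x. c * f x) = c * v f"
  by (simp add: tangent_space_def scaleR_fun_def)

lemma tangent_spaceI:
  assumes "\<And>f. \<not> smooth_fun_at M p f \<Longrightarrow> v f = 0"
    and "\<And>f g. smooth_fun_at M p f \<Longrightarrow> smooth_fun_at M p g \<Longrightarrow> v (\<lambda>x. f x + g x) = v f + v g"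
    and "\<And>f g. smooth_fun_at M p f \<Longrightarrow> smooth_fun_at M p g \<Longrightarrow> v (\<lambda>x. f x * g x) = v f * g p + f p * v g"
    and "\<And>c f. smooth_fun_at M p f \<Longrightarrow> v (\<lambda>x. c * f x) = c * v f"
  shows "v \<in> tangent_space M p"
  using assms by (simp add: tangent_space_def plus_fun_def times_fun_def scaleR_fun_def)

lemma dfun_apply: "v \<in> tangent_space M p \<Longrightarrow> dfun M f p v = v f"
  by (simp add: dfun_def zero_ext_def)

lemma dfun_cotangent: "dfun M f p \<in> cotangent_space M p"
  using subspace_tangent_space[of M p]
  by (auto simp: cotangent_space_def dual_space_def linear_over_def dfun_def zero_ext_def subspace_def)

context
  fixes M :: "('a, 'v::euclidean_space) mfd"
  assumes M: "premanifold M"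
begin

lemma tangent_const:
  assumes v: "v \<in> tangent_space M p" and p: "p \<in> points M"
  shows "v (\<lambda>x. a) = 0"
proof -
  note s = smooth_fun_at_const[OF M p]
  have "v (\<lambda>x. 1 * 1) = v (\<lambda>x. 1) * 1 + 1 * v (\<lambda>x. 1)"
    using tangent_mult[OF v s s] by fastforce
  then have "v (\<lambda>x. 1) = 0" by simp
  then show ?thesis using tangent_scale[OF v s[of 1], of a] by simp
qed

text \<open>The product rule for the indicator function of a neighbourhood makes derivations local.\<close>

lemma tangent_cong:
  assumes v: "v \<in> tangent_space M p" and G: "openin (mfd_topology M) G" "p \<in> G"
    and eq: "\<And>x. x \<in> G \<Longrightarrow> f x = g x"
  shows "v f = v g"
proof (cases "smooth_fun_at M p f")
  case True
  have g: "smooth_fun_at M p g" by (rule smooth_fun_at_cong[OF M True G eq])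
  have p: "p \<in> points M" using smooth_fun_at_points[OF M True] .
  define k :: "'a \<Rightarrow> real" where "k x = (if x \<in> G then 1 else 0)" for x
  have k: "smooth_fun_at M p k"
    by (rule smooth_fun_at_cong[OF M smooth_fun_at_const[OF M p, of 1] G]) (simp add: k_def)
  have d: "smooth_fun_at M p (\<lambda>x. f x + (-1) * g x)"
    by (intro smooth_fun_at_add[OF M True] smooth_fun_at_cmult[OF M g])
  \<comment> \<open>\<open>k\<close> is the indicator of \<open>G\<close>. Its product with the
    difference vanishes everywhere, not just near \<open>p\<close>, so the product rule meets a
    genuine equality of functions.\<close>
  have "(\<lambda>x. k x * (f x + (-1) * g x)) = (\<lambda>x. 0)" using eq by (auto simp: k_def)
  then have "v (\<lambda>x. 0) = v k * (f p + (-1) * g p) + k p * v (\<lambda>x. f x + (-1) * g x)"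
    using tangent_mult[OF v k d] by simp
  then have "v (\<lambda>x. f x + (-1) * g x) = 0"
    using eq[OF G(2)] G(2) tangent_const[OF v p, of 0] by (simp add: k_def)
  then show ?thesis
    using tangent_add[OF v True smooth_fun_at_cmult[OF M g], of "-1"] tangent_scale[OF v g, of "-1"] by simp
next
  case False
  have "\<not> smooth_fun_at M p g"
    using smooth_fun_at_cong[OF M _ G, of g f] eq False by metis
  then show ?thesis using tangent_not_smooth[OF v] False by metis
qed

lemma tangent_uminus:
  "v \<in> tangent_space M p \<Longrightarrow> smooth_fun_at M p f \<Longrightarrow> v (\<lambda>x. - f x) = - v f"
  using tangent_scale[of v M p f "-1"] by simp

lemma tangent_diff:
  "v \<in> tangent_space M p \<Longrightarrow> smooth_fun_at M p f \<Longrightarrow> smooth_fun_at M p g \<Longrightarrow>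
    v (\<lambda>x. f x - g x) = v f - v g"
  using tangent_add[of v M p f "\<lambda>x. - g x"] tangent_uminus smooth_fun_at_uminus[OF M] by simp

lemma tangent_sum:
  assumes v: "v \<in> tangent_space M p" and p: "p \<in> points M"
  shows "(\<And>i. i \<in> I \<Longrightarrow> smooth_fun_at M p (f i)) \<Longrightarrow> v (\<lambda>x. \<Sum>i\<in>I. f i x) = (\<Sum>i\<in>I. v (f i))"
proof (induction I rule: infinite_finite_induct)
  case (insert i I)
  then show ?case
    using tangent_add[OF v _ smooth_fun_at_sum[OF M p], of "f i" I f] by simp
qed (simp_all add: tangent_const[OF v p])

section \<open>Coordinate vectors of a fixed chart\<close>

context
  fixes U :: "'a set" and \<phi> :: "'a \<Rightarrow> 'v"
  assumes c: "(U, \<phi>) \<in> charts M"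
begin

lemma
  assumes p: "p \<in> U" and u: "u \<in> model M" and f: "smooth_fun_at M p f"
  shows coord_vec_ray: "((\<lambda>t. f (inv_into U \<phi> (\<phi> p + t *\<^sub>R u))) has_real_derivative
      coord_vec M (U, \<phi>) p u f) (at 0)"
    and coord_vec_ddir: "coord_vec M (U, \<phi>) p u f = ddir (f \<circ> inv_into U \<phi>) (\<phi> p) u"
proof -
  obtain T where T: "\<phi> p \<in> T" "smooth_on (model M) T (f \<circ> inv_into U \<phi>)"
    using f unfolding smooth_fun_at_iff[OF M c p] by blast
  have "((\<lambda>t. f (inv_into U \<phi> (\<phi> p + t *\<^sub>R u))) has_real_derivative
      ddir (f \<circ> inv_into U \<phi>) (\<phi> p) u) (at 0)"
    using smooth_on_ray[OF model_subspace[OF M] T(2,1) u]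
    by (simp add: has_real_derivative_iff_has_vector_derivative)
  then show "((\<lambda>t. f (inv_into U \<phi> (\<phi> p + t *\<^sub>R u))) has_real_derivative
      coord_vec M (U, \<phi>) p u f) (at 0)"
    "coord_vec M (U, \<phi>) p u f = ddir (f \<circ> inv_into U \<phi>) (\<phi> p) u"
    using f by (simp_all add: coord_vec_def DERIV_imp_deriv)
qed

lemma coord_vec_tangent:
  assumes p: "p \<in> U" and u: "u \<in> model M"
  shows "coord_vec M (U, \<phi>) p u \<in> tangent_space M p"
proof (rule tangent_spaceI)
  fix f assume "\<not> smooth_fun_at M p f"
  then show "coord_vec M (U, \<phi>) p u f = 0" by (simp add: coord_vec_def)
next
  note cc = charts_chart_on[OF c]
  note r = coord_vec_ray[OF p u]
  have p0: "inv_into U \<phi> (\<phi> p + 0 *\<^sub>R u) = p" using p cc by (simp add: inv_into_f_f)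
  fix f g assume fg: "smooth_fun_at M p f" "smooth_fun_at M p g"
  show "coord_vec M (U, \<phi>) p u (\<lambda>x. f x + g x) = coord_vec M (U, \<phi>) p u f + coord_vec M (U, \<phi>) p u g"
    using DERIV_unique[OF r[OF smooth_fun_at_add[OF M fg]] DERIV_add[OF r[OF fg(1)] r[OF fg(2)]]] .
  show "coord_vec M (U, \<phi>) p u (\<lambda>x. f x * g x) = coord_vec M (U, \<phi>) p u f * g p + f p * coord_vec M (U, \<phi>) p u g"
    using DERIV_unique[OF r[OF smooth_fun_at_mult[OF M fg]] DERIV_mult[OF r[OF fg(1)] r[OF fg(2)]]] p0
    by simp
next
  note r = coord_vec_ray[OF p u]
  fix a f assume f: "smooth_fun_at M p f"
  show "coord_vec M (U, \<phi>) p u (\<lambda>x. a * f x) = a * coord_vec M (U, \<phi>) p u f"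
    using DERIV_unique[OF r[OF smooth_fun_at_cmult[OF M f]] DERIV_cmult[OF r[OF f]]] .
qed

lemma coord_vec_coord:
  assumes p: "p \<in> U" and u: "u \<in> model M"
  shows "coord_vec M (U, \<phi>) p u (\<lambda>x. \<phi> x \<bullet> b) = u \<bullet> b"
proof -
  note cc = charts_chart_on[OF c]
  have "coord_vec M (U, \<phi>) p u (\<lambda>x. \<phi> x \<bullet> b) = ddir ((\<lambda>x. \<phi> x \<bullet> b) \<circ> inv_into U \<phi>) (\<phi> p) u"
    by (rule coord_vec_ddir[OF p u smooth_fun_at_coord[OF M c p]])
  also have "\<dots> = ddir (\<lambda>y. y \<bullet> b) (\<phi> p) u"
    by (rule ddir_cong[OF model_subspace[OF M] cc(3) imageI[OF p] u]) (use cc in \<open>auto simp: inv_into_f_f\<close>)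
  also have "\<dots> = u \<bullet> b"
    using ddir_eq[OF model_subspace[OF M] cc(3) imageI[OF p] u
        bounded_linear_imp_has_derivative[OF bounded_linear_inner_left]] .
  finally show ?thesis .
qed

lemma vec_coords_inner:
  assumes p: "p \<in> U" and v: "v \<in> tangent_space M p"
  shows "vec_coords (U, \<phi>) v \<bullet> u = v (\<lambda>x. \<phi> x \<bullet> u)"
proof -
  have pM: "p \<in> points M" using p charts_chart_on(1)[OF c] by blast
  have "v (\<lambda>x. \<phi> x \<bullet> u) = v (\<lambda>x. \<Sum>b\<in>Basis. (u \<bullet> b) * (\<phi> x \<bullet> b))"
    by (subst euclidean_inner) (simp add: mult.commute)
  also have "\<dots> = (\<Sum>b\<in>Basis. v (\<lambda>x. (u \<bullet> b) * (\<phi> x \<bullet> b)))"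
    by (intro tangent_sum[OF v pM] smooth_fun_at_cmult[OF M] smooth_fun_at_coord[OF M c p])
  also have "\<dots> = (\<Sum>b\<in>Basis. (u \<bullet> b) * v (\<lambda>x. \<phi> x \<bullet> b))"
    by (intro sum.cong refl tangent_scale[OF v] smooth_fun_at_coord[OF M c p])
  finally show ?thesis
    unfolding vec_coords_def inner_sum_left by (simp add: inner_commute mult.commute)
qed

text \<open>For \<open>n\<close> normal to the model space the coordinate function
  \<open>\<phi> x \<bullet> n\<close> vanishes on the chart domain, so every derivation kills
  it.\<close>

lemma vec_coords_in_model:
  assumes p: "p \<in> U" and v: "v \<in> tangent_space M p"
  shows "vec_coords (U, \<phi>) v \<in> model M"
proof (rule in_subspace_if_orthogonal[OF model_subspace[OF M]])
  note cc = charts_chart_on[OF c]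
  fix n assume n: "\<And>w. w \<in> model M \<Longrightarrow> orthogonal n w"
  have "\<phi> x \<bullet> n = 0" if "x \<in> U" for x
    using n[of "\<phi> x"] that cc(4) by (auto simp: orthogonal_def inner_commute)
  then have "v (\<lambda>x. \<phi> x \<bullet> n) = v (\<lambda>x. 0)"
    by (rule tangent_cong[OF v chart_openin[OF M c] p])
  then show "vec_coords (U, \<phi>) v \<bullet> n = 0"
    using vec_coords_inner[OF p v] tangent_const[OF v] p cc(1) by auto
qed

text \<open>Near \<open>p\<close>, Hadamard's lemma writes \<open>f\<close> as a constant plus
  products of coordinate differences with smooth functions. The differences vanish at
  \<open>p\<close>, so the product rule leaves only the values of the smooth factors at
  \<open>p\<close>, which are the partial derivatives of \<open>f\<close>.\<close>

lemma tangent_expansion: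
  assumes p: "p \<in> U" and v: "v \<in> tangent_space M p" and f: "smooth_fun_at M p f"
  shows "v f = (\<Sum>b\<in>onb (model M). v (\<lambda>x. \<phi> x \<bullet> b) * coord_vec M (U, \<phi>) p b f)"
proof -
  note cc = charts_chart_on[OF c]
  have pM: "p \<in> points M" using p cc(1) by blast
  let ?f = "f \<circ> inv_into U \<phi>"
  obtain T where T: "\<phi> p \<in> T" "T \<subseteq> \<phi> ` U" "smooth_on (model M) T ?f"
    using f unfolding smooth_fun_at_iff[OF M c p] by blast
  obtain B g where B: "openin (top_of_set (model M)) B" "\<phi> p \<in> B" "B \<subseteq> T"
    and g: "\<And>b. b \<in> onb (model M) \<Longrightarrow> smooth_on (model M) B (g b)"
    and gp: "\<And>b. g b (\<phi> p) = ddir ?f (\<phi> p) b"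
    and eq: "\<And>x. x \<in> B \<Longrightarrow> ?f x = ?f (\<phi> p) + (\<Sum>b\<in>onb (model M). ((x - \<phi> p) \<bullet> b) * g b x)"
    by (rule hadamard[OF model_subspace[OF M] T(3,1)]) (rule that; assumption)
  let ?G = "{z \<in> U. \<phi> z \<in> B}"
  have G: "openin (mfd_topology M) ?G" "p \<in> ?G"
    using chart_preimage_openin[OF M c B(1)] p B(2) by auto
  have gs: "smooth_fun_at M p (\<lambda>x. g b (\<phi> x))" if b: "b \<in> onb (model M)" for b
  proof (rule smooth_fun_atI[OF M c p B(2)])
    show "B \<subseteq> \<phi> ` U" using B(3) T(2) by blast
    then show "smooth_on (model M) B ((\<lambda>x. g b (\<phi> x)) \<circ> inv_into U \<phi>)"
      by (intro smooth_on_eq[OF g[OF b]]) (auto simp: f_inv_into_f subset_iff)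
  qed
  have cs: "smooth_fun_at M p (\<lambda>x. \<phi> x \<bullet> b + - (\<phi> p \<bullet> b))" for b
    by (intro smooth_fun_at_add[OF M] smooth_fun_at_coord[OF M c p] smooth_fun_at_const[OF M pM])
  have cv: "v (\<lambda>x. \<phi> x \<bullet> b + - (\<phi> p \<bullet> b)) = v (\<lambda>x. \<phi> x \<bullet> b)" for b
    unfolding tangent_add[OF v smooth_fun_at_coord[OF M c p] smooth_fun_at_const[OF M pM]]
      tangent_const[OF v pM] by (rule add_0_right)
  have "v f = v (\<lambda>x. f p + (\<Sum>b\<in>onb (model M). (\<phi> x \<bullet> b + - (\<phi> p \<bullet> b)) * g b (\<phi> x)))"
  proof (rule tangent_cong[OF v G])
    fix x assume x: "x \<in> ?G"
    then show "f x = f p + (\<Sum>b\<in>onb (model M). (\<phi> x \<bullet> b + - (\<phi> p \<bullet> b)) * g b (\<phi> x))"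
      using eq[of "\<phi> x"] cc(2) p by (simp add: inv_into_f_f inner_diff_left)
  qed
  also have "\<dots> = (\<Sum>b\<in>onb (model M). v (\<lambda>x. (\<phi> x \<bullet> b + - (\<phi> p \<bullet> b)) * g b (\<phi> x)))"
  proof -
    have "v (\<lambda>x. f p + (\<Sum>b\<in>onb (model M). (\<phi> x \<bullet> b + - (\<phi> p \<bullet> b)) * g b (\<phi> x))) =
        v (\<lambda>x. f p) + v (\<lambda>x. \<Sum>b\<in>onb (model M). (\<phi> x \<bullet> b + - (\<phi> p \<bullet> b)) * g b (\<phi> x))"
      by (intro tangent_add[OF v] smooth_fun_at_const[OF M pM] smooth_fun_at_sum[OF M pM] smooth_fun_at_mult[OF M] cs gs)
    also have "v (\<lambda>x. \<Sum>b\<in>onb (model M). (\<phi> x \<bullet> b + - (\<phi> p \<bullet> b)) * g b (\<phi> x)) =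
        (\<Sum>b\<in>onb (model M). v (\<lambda>x. (\<phi> x \<bullet> b + - (\<phi> p \<bullet> b)) * g b (\<phi> x)))"
      by (intro tangent_sum[OF v pM] smooth_fun_at_mult[OF M] cs gs)
    finally show ?thesis unfolding tangent_const[OF v pM] by (simp only: add_0_left)
  qed
  also have "\<dots> = (\<Sum>b\<in>onb (model M). v (\<lambda>x. \<phi> x \<bullet> b) * g b (\<phi> p))"
  proof (intro sum.cong refl)
    fix b assume b: "b \<in> onb (model M)"
    show "v (\<lambda>x. (\<phi> x \<bullet> b + - (\<phi> p \<bullet> b)) * g b (\<phi> x)) = v (\<lambda>x. \<phi> x \<bullet> b) * g b (\<phi> p)"
      unfolding tangent_mult[OF v cs gs[OF b]] cv by simp
  qed
  also have "\<dots> = (\<Sum>b\<in>onb (model M). v (\<lambda>x. \<phi> x \<bullet> b) * coord_vec M (U, \<phi>) p b f)"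
    using onb_subset[OF model_subspace[OF M]] gp coord_vec_ddir[OF p _ f]
    by (intro sum.cong refl) (auto simp: subset_iff)
  finally show ?thesis .
qed

lemma tangent_onb:
  assumes p: "p \<in> U" and v: "v \<in> tangent_space M p"
  shows "v = (\<Sum>b\<in>onb (model M). v (\<lambda>x. \<phi> x \<bullet> b) *\<^sub>R coord_vec M (U, \<phi>) p b)"
proof
  fix f
  show "v f = (\<Sum>b\<in>onb (model M). v (\<lambda>x. \<phi> x \<bullet> b) *\<^sub>R coord_vec M (U, \<phi>) p b) f"
  proof (cases "smooth_fun_at M p f")
    case True
    then show ?thesis using tangent_expansion[OF p v True] by (simp add: fun_sum_apply)
  next
    case False
    then show ?thesis using tangent_not_smooth[OF v False] by (simp add: fun_sum_apply coord_vec_def)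
  qed
qed

lemma coord_vec_onb:
  assumes p: "p \<in> U" and u: "u \<in> model M"
  shows "coord_vec M (U, \<phi>) p u = (\<Sum>b\<in>onb (model M). (u \<bullet> b) *\<^sub>R coord_vec M (U, \<phi>) p b)"
  using tangent_onb[OF p coord_vec_tangent[OF p u]] coord_vec_coord[OF p u] by simp

lemma coord_vec_linear:
  assumes p: "p \<in> U" and u: "u \<in> model M" "w \<in> model M"
  shows "coord_vec M (U, \<phi>) p (u + w) = coord_vec M (U, \<phi>) p u + coord_vec M (U, \<phi>) p w"
    "coord_vec M (U, \<phi>) p (a *\<^sub>R u) = a *\<^sub>R coord_vec M (U, \<phi>) p u"
proof -
  have "u + w \<in> model M" "a *\<^sub>R u \<in> model M"
    using model_subspace[OF M] u subspace_add subspace_scale by blast+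
  then show "coord_vec M (U, \<phi>) p (u + w) = coord_vec M (U, \<phi>) p u + coord_vec M (U, \<phi>) p w"
    "coord_vec M (U, \<phi>) p (a *\<^sub>R u) = a *\<^sub>R coord_vec M (U, \<phi>) p u"
    using coord_vec_onb[OF p] u
    by (simp_all add: inner_add_left scaleR_add_left sum.distrib scaleR_sum_right)
qed

lemma coord_vec_vec_coords:
  assumes p: "p \<in> U" and v: "v \<in> tangent_space M p"
  shows "coord_vec M (U, \<phi>) p (vec_coords (U, \<phi>) v) = v"
  using coord_vec_onb[OF p vec_coords_in_model[OF p v]] tangent_onb[OF p v] vec_coords_inner[OF p v]
  by simp

lemma
  assumes p: "p \<in> U" and u: "u \<in> model M" and f: "smooth_fun_at M p f"
  shows smooth_fun_at_coord_vec: "smooth_fun_at M p (\<lambda>x. coord_vec M (U, \<phi>) x u f)"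
    and coord_vec_coord_vec: "w \<in> model M \<Longrightarrow>
      coord_vec M (U, \<phi>) p w (\<lambda>x. coord_vec M (U, \<phi>) x u f) =
      ddir (\<lambda>y. ddir (f \<circ> inv_into U \<phi>) y u) (\<phi> p) w"
proof -
  note cc = charts_chart_on[OF c]
  obtain T where T: "\<phi> p \<in> T" "T \<subseteq> \<phi> ` U" "smooth_on (model M) T (f \<circ> inv_into U \<phi>)"
    using f unfolding smooth_fun_at_iff[OF M c p] by blast
  have eq: "ddir (f \<circ> inv_into U \<phi>) y u = ((\<lambda>x. coord_vec M (U, \<phi>) x u f) \<circ> inv_into U \<phi>) y"
    if "y \<in> T" for y
  proof -
    have y: "inv_into U \<phi> y \<in> U" "\<phi> (inv_into U \<phi> y) = y"
      using that T(2) by (auto simp: inv_into_into f_inv_into_f subset_iff)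
    then have "smooth_fun_at M (inv_into U \<phi> y) f"
      using smooth_fun_atI[OF M c y(1) _ T(2,3)] that by simp
    then show ?thesis using coord_vec_ddir[OF y(1) u] y by simp
  qed
  have "smooth_on (model M) T ((\<lambda>x. coord_vec M (U, \<phi>) x u f) \<circ> inv_into U \<phi>)"
    by (rule smooth_on_eq[OF smooth_on_ddir[OF model_subspace[OF M] T(3) u] eq])
  then show 1: "smooth_fun_at M p (\<lambda>x. coord_vec M (U, \<phi>) x u f)"
    by (rule smooth_fun_atI[OF M c p T(1,2)])
  assume w: "w \<in> model M"
  show "coord_vec M (U, \<phi>) p w (\<lambda>x. coord_vec M (U, \<phi>) x u f) =
      ddir (\<lambda>y. ddir (f \<circ> inv_into U \<phi>) y u) (\<phi> p) w"
    unfolding coord_vec_ddir[OF p w 1]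
    by (rule ddir_cong[OF model_subspace[OF M] smooth_on_openin[OF T(3)] T(1) w]) (simp add: eq)
qed

text \<open>Mixed second derivatives agree by \<open>ddir_sym\<close>, so fields with constant
  coefficients in the chart commute on functions.\<close>

lemma coord_vec_commute:
  assumes p: "p \<in> U" and u: "u \<in> model M" "w \<in> model M" and f: "smooth_fun_at M p f"
  shows "coord_vec M (U, \<phi>) p w (\<lambda>x. coord_vec M (U, \<phi>) x u f) =
    coord_vec M (U, \<phi>) p u (\<lambda>x. coord_vec M (U, \<phi>) x w f)"
proof -
  obtain T where T: "\<phi> p \<in> T" "T \<subseteq> \<phi> ` U" "smooth_on (model M) T (f \<circ> inv_into U \<phi>)"
    using f unfolding smooth_fun_at_iff[OF M c p] by blast
  show ?thesis
    using coord_vec_coord_vec[OF p u(1) f u(2)] coord_vec_coord_vec[OF p u(2) f u(1)]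
      ddir_sym[OF model_subspace[OF M] T(3,1) u] by simp
qed

lemma cotangent_expansion:
  assumes p: "p \<in> U" and a: "a \<in> cotangent_space M p" and v: "v \<in> tangent_space M p"
  shows "a v = (\<Sum>b\<in>onb (model M). v (\<lambda>x. \<phi> x \<bullet> b) * a (coord_vec M (U, \<phi>) p b))"
proof -
  have l: "linear_over (tangent_space M p) a"
    using a by (simp add: cotangent_space_def dual_space_def)
  have "a v = a (\<Sum>b\<in>onb (model M). v (\<lambda>x. \<phi> x \<bullet> b) *\<^sub>R coord_vec M (U, \<phi>) p b)"
    using tangent_onb[OF p v] by simp
  also have "\<dots> = (\<Sum>b\<in>onb (model M). v (\<lambda>x. \<phi> x \<bullet> b) *\<^sub>R a (coord_vec M (U, \<phi>) p b))"
    using onb_subset[OF model_subspace[OF M]] coord_vec_tangent[OF p]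
    by (intro linear_over_sum[OF subspace_tangent_space l]) blast
  finally show ?thesis by simp
qed

end

text \<open>A linear combination of the coordinate functions with constant coefficients does it.
  Since \<open>sharp\<close> acts on functions, this is the bridge from identities for differentials
  to identities for arbitrary covectors.\<close>

lemma cotangent_eq_dfun:
  assumes p: "p \<in> points M" and a: "a \<in> cotangent_space M p"
  obtains f where "smooth_fun_at M p f" "a = dfun M f p"
proof -
  obtain U \<phi> where c: "(U, \<phi>) \<in> charts M" "p \<in> U" by (rule chart_exists[OF M p])
  let ?f = "\<lambda>x. \<Sum>b\<in>onb (model M). a (coord_vec M (U, \<phi>) p b) * (\<phi> x \<bullet> b)"
  have s: "smooth_fun_at M p (\<lambda>x. a (coord_vec M (U, \<phi>) p b) * (\<phi> x \<bullet> b))" for b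
    by (intro smooth_fun_at_cmult[OF M] smooth_fun_at_coord[OF M c])
  have "a v = dfun M ?f p v" if v: "v \<in> tangent_space M p" for v
  proof -
    have "v ?f = (\<Sum>b\<in>onb (model M). a (coord_vec M (U, \<phi>) p b) * v (\<lambda>x. \<phi> x \<bullet> b))"
      using tangent_sum[OF v p s] tangent_scale[OF v smooth_fun_at_coord[OF M c]] by simp
    then show ?thesis
      using cotangent_expansion[OF c a v] dfun_apply[OF v] by (simp add: mult.commute)
  qed
  then have "a = dfun M ?f p" by (rule cotangent_eqI[OF a dfun_cotangent])
  moreover have "smooth_fun_at M p ?f" by (rule smooth_fun_at_sum[OF M p s])
  ultimately show ?thesis using that by blast
qed

end

lemma differential_tangent:
  assumes "\<And>g. smooth_fun_at N (F p) g \<Longrightarrow> smooth_fun_at M p (g \<circ> F)"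
    and N: "premanifold N" and v: "v \<in> tangent_space M p"
  shows "differential N F p v \<in> tangent_space N (F p)"
  unfolding differential_def
  using assms(1) smooth_fun_at_add[OF N] smooth_fun_at_mult[OF N] smooth_fun_at_cmult[OF N]
    tangent_add[OF v] tangent_mult[OF v] tangent_scale[OF v]
  by (intro tangent_spaceI) (auto simp: o_def)

section \<open>Embedded submanifolds\<close>

lemma smooth_vec_atI:
  assumes "openin (mfd_topology S) G" "q \<in> G" "\<And>x. x \<in> G \<Longrightarrow> X x \<in> tangent_space M x"
    and "\<And>f. smooth_fun_at M q f \<Longrightarrow> smooth_fun_at S q (\<lambda>x. X x f)"
  shows "smooth_vec_at M S q X"
  unfolding smooth_vec_at_def
  by (intro conjI exI[of _ G] allI impI ballI) (simp_all add: assms)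

lemma smooth_covec_atI:
  assumes "openin (mfd_topology S) G" "q \<in> G" "\<And>x. x \<in> G \<Longrightarrow> a x \<in> cotangent_space M x"
    and "\<And>X. smooth_vec_at M S q X \<Longrightarrow> smooth_fun_at S q (\<lambda>x. a x (X x))"
  shows "smooth_covec_at M S q a"
  unfolding smooth_covec_at_def
  by (intro conjI exI[of _ G] allI impI ballI) (simp_all add: assms)

lemma smooth_vec_at_nhd:
  assumes "smooth_vec_at M S q X"
  obtains G where "openin (mfd_topology S) G" "q \<in> G" "\<And>x. x \<in> G \<Longrightarrow> X x \<in> tangent_space M x"
  using assms unfolding smooth_vec_at_def by blast

lemma smooth_covec_at_nhd:
  assumes "smooth_covec_at M S q a"
  obtains G where "openin (mfd_topology S) G" "q \<in> G" "\<And>x. x \<in> G \<Longrightarrow> a x \<in> cotangent_space M x"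
  using assms unfolding smooth_covec_at_def by blast

lemma smooth_vec_at_apply: "smooth_vec_at M S q X \<Longrightarrow> smooth_fun_at M q f \<Longrightarrow> smooth_fun_at S q (\<lambda>x. X x f)"
  by (simp add: smooth_vec_at_def)

lemma smooth_covec_at_apply:
  "smooth_covec_at M S q a \<Longrightarrow> smooth_vec_at M S q X \<Longrightarrow> smooth_fun_at S q (\<lambda>x. a x (X x))"
  by (simp add: smooth_covec_at_def)

text \<open>Lets facts about sections along a submanifold be applied with \<open>S = M\<close>, that
  is, to vector fields and 1-forms on a single manifold.\<close>

lemma embedded_submanifold_refl:
  assumes "smooth_manifold M"
  shows "embedded_submanifold M M"
proof -
  note M = smooth_manifold_premanifold[OF assms]
  have "\<exists>(U, \<phi>)\<in>adapted_charts M M. q \<in> U" if q: "q \<in> points M" for q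
  proof -
    obtain U \<phi> where c: "(U, \<phi>) \<in> charts M" "q \<in> U" by (rule chart_exists[OF M q])
    note cc = charts_chart_on[OF c(1)]
    have "U \<inter> points M = U" "\<phi> ` U \<inter> model M = \<phi> ` U" using cc by auto
    then have "(U, \<phi>) \<in> adapted_charts M M" using c by (simp add: adapted_charts_def)
    then show ?thesis using c by blast
  qed
  then show ?thesis using assms by (simp add: embedded_submanifold_def)
qed

context
  fixes M S :: "('a, 'v::euclidean_space) mfd"
  assumes emb: "embedded_submanifold M S"
begin

lemma
  shows ambient_premanifold: "premanifold M" and sub_premanifold: "premanifold S"
    and sub_points: "points S \<subseteq> points M" and sub_model: "model S \<subseteq> model M"
  using emb smooth_manifold_premanifold by (auto simp: embedded_submanifold_def)

lemma adapted_charts_facts: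
  assumes "(U, \<phi>) \<in> adapted_charts M S"
  shows "(U, \<phi>) \<in> charts M" "(U \<inter> points S, \<phi>) \<in> charts S"
    "\<phi> ` (U \<inter> points S) = \<phi> ` U \<inter> model S"
  using assms by (auto simp: adapted_charts_def)

lemma adapted_chart_exists:
  assumes "q \<in> points S"
  obtains U \<phi> where "(U, \<phi>) \<in> adapted_charts M S" "q \<in> U"
  using emb assms unfolding embedded_submanifold_def by blast

lemma smooth_fun_at_restrict:
  assumes f: "smooth_fun_at M q f" and q: "q \<in> points S"
  shows "smooth_fun_at S q f"
proof -
  obtain U \<phi> where a: "(U, \<phi>) \<in> adapted_charts M S" "q \<in> U" by (rule adapted_chart_exists[OF q])
  note c = adapted_charts_facts[OF a(1)]
  note cc = charts_chart_on[OF c(1)] and cs = charts_chart_on[OF c(2)]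
  obtain T where T: "\<phi> q \<in> T" "T \<subseteq> \<phi> ` U" "smooth_on (model M) T (f \<circ> inv_into U \<phi>)"
    using f unfolding smooth_fun_at_iff[OF ambient_premanifold c(1) a(2)] by blast
  obtain T' where T': "open T'" "T = model M \<inter> T'"
    using smooth_on_openin[OF T(3)] unfolding openin_open by blast
  have o: "openin (top_of_set (model S)) (model S \<inter> T')" using T'(1) by (rule openin_open_Int)
  have sub: "model S \<inter> T' \<subseteq> T" using T' sub_model by blast
  then have sub': "model S \<inter> T' \<subseteq> \<phi> ` (U \<inter> points S)" using T(2) c(3) by blast
  have "smooth_on (model S) (model S \<inter> T') (f \<circ> inv_into U \<phi>)"
    by (rule smooth_on_subspace[OF T(3) sub_model o sub])
  moreover have "(f \<circ> inv_into U \<phi>) x = (f \<circ> inv_into (U \<inter> points S) \<phi>) x" if x: "x \<in> model S \<inter> T'" for x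
  proof -
    obtain z where z: "z \<in> U \<inter> points S" "x = \<phi> z" using x sub' by blast
    then show ?thesis using cc(2) inv_into_f_f[OF cs(2) z(1)] by simp
  qed
  ultimately have "smooth_on (model S) (model S \<inter> T') (f \<circ> inv_into (U \<inter> points S) \<phi>)"
    by (rule smooth_on_eq)
  moreover have "\<phi> q \<in> model S \<inter> T'" using T(1) T'(2) cs(4) a(2) q by auto
  ultimately show ?thesis
    by (intro smooth_fun_atI[OF sub_premanifold c(2) _ _ sub']) (use a(2) q in auto)
qed

lemma openin_restrict:
  assumes G: "openin (mfd_topology M) G"
  shows "openin (mfd_topology S) (G \<inter> points S)"
proof (subst openin_subopen, intro ballI)
  fix q assume q: "q \<in> G \<inter> points S"
  then obtain U \<phi> where a: "(U, \<phi>) \<in> adapted_charts M S" "q \<in> U" using adapted_chart_exists by blast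
  note c = adapted_charts_facts[OF a(1)]
  note cc = charts_chart_on[OF c(1)] and cs = charts_chart_on[OF c(2)]
  obtain T' where T': "open T'" "\<phi> ` (G \<inter> U) = model M \<inter> T'"
    using chart_image_openin[OF ambient_premanifold c(1) G] unfolding openin_open by blast
  have o: "openin (top_of_set (model S)) (model S \<inter> T')" using T'(1) by (rule openin_open_Int)
  have "openin (mfd_topology S) {z \<in> U \<inter> points S. \<phi> z \<in> model S \<inter> T'}"
    by (rule chart_preimage_openin[OF sub_premanifold c(2) o])
  moreover have "{z \<in> U \<inter> points S. \<phi> z \<in> model S \<inter> T'} \<subseteq> G \<inter> points S"
  proof
    fix z assume z: "z \<in> {z \<in> U \<inter> points S. \<phi> z \<in> model S \<inter> T'}"
    then have "\<phi> z \<in> \<phi> ` (G \<inter> U)" using T'(2) sub_model by auto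
    then show "z \<in> G \<inter> points S" using z cc(2) by (auto simp: inj_on_eq_iff)
  qed
  moreover have "q \<in> {z \<in> U \<inter> points S. \<phi> z \<in> model S \<inter> T'}"
    using q a(2) T'(2) cs(4) by auto
  ultimately show "\<exists>T. openin (mfd_topology S) T \<and> q \<in> T \<and> T \<subseteq> G \<inter> points S" by blast
qed

lemma incl_tangent:
  assumes "q \<in> points S" "w \<in> tangent_space S q"
  shows "incl M q w \<in> tangent_space M q"
proof -
  have "differential M id q w \<in> tangent_space M (id q)"
    by (rule differential_tangent[OF _ ambient_premanifold assms(2)])
      (simp add: smooth_fun_at_restrict[OF _ assms(1)])
  then show ?thesis by (simp add: incl_def)
qed

lemma incl_apply: "smooth_fun_at M q f \<Longrightarrow> incl M q w f = w f"
  by (simp add: incl_def differential_def)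

lemma incl_linear: "incl M q (v + w) = incl M q v + incl M q w"
  "incl M q (a *\<^sub>R v) = a *\<^sub>R incl M q v"
  by (auto simp: incl_def differential_def fun_eq_iff)

lemma tan_sub_subset: "q \<in> points S \<Longrightarrow> tan_sub M S q \<subseteq> tangent_space M q"
  using incl_tangent by (auto simp: tan_sub_def)

lemma subspace_tan_sub: "subspace (tan_sub M S q)"
proof -
  have "linear (incl M q)" by (intro linearI incl_linear)
  then show ?thesis unfolding tan_sub_def using subspace_tangent_space by (rule linear_subspace_image)
qed

text \<open>The vector comes from a derivation of \<open>S\<close>, which is local in
  \<open>S\<close>. Smoothness on \<open>M\<close> enters because \<open>incl\<close> assigns 0 to
  functions that are not smooth on \<open>M\<close>. Independence of extensions rests on this
  fact.\<close>

lemma tan_sub_cong: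
  assumes q: "q \<in> points S" and v: "v \<in> tan_sub M S q"
    and fg: "smooth_fun_at M q f" "smooth_fun_at M q g"
    and G: "openin (mfd_topology S) G" "q \<in> G" "\<And>x. x \<in> G \<Longrightarrow> f x = g x"
  shows "v f = v g"
proof -
  obtain w where w: "w \<in> tangent_space S q" "v = incl M q w" using v by (auto simp: tan_sub_def)
  have "w f = w g" by (rule tangent_cong[OF sub_premanifold w(1) G])
  then show ?thesis using w fg by (simp add: incl_apply)
qed

text \<open>If \<open>n\<close> is normal to \<open>model S\<close>, the coordinate
  \<open>\<phi> x \<bullet> n\<close> vanishes on \<open>S\<close> in an adapted chart, so a vector
  tangent to \<open>S\<close> has no component along \<open>n\<close>. Conversely, for
  \<open>w\<close> in \<open>model S\<close> the coordinate ray runs inside \<open>S\<close>, and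
  the coordinate vectors of \<open>S\<close> and \<open>M\<close> correspond under
  \<open>incl\<close>.\<close>

lemma coord_vec_tan_sub:
  assumes a: "(U, \<phi>) \<in> adapted_charts M S" and q: "q \<in> U" "q \<in> points S" and w: "w \<in> model M"
  shows "coord_vec M (U, \<phi>) q w \<in> tan_sub M S q \<longleftrightarrow> w \<in> model S"
proof
  note c = adapted_charts_facts[OF a]
  note cc = charts_chart_on[OF c(1)] and cs = charts_chart_on[OF c(2)]
  have qU: "q \<in> U \<inter> points S" using q by blast
  {
    assume "coord_vec M (U, \<phi>) q w \<in> tan_sub M S q"
    note v = this
    show "w \<in> model S"
    proof (rule in_subspace_if_orthogonal[OF model_subspace[OF sub_premanifold]])
      fix n assume n: "\<And>w. w \<in> model S \<Longrightarrow> orthogonal n w"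
      have z: "\<phi> x \<bullet> n = 0" if "x \<in> U \<inter> points S" for x
        using n[of "\<phi> x"] that cs(4) by (auto simp: orthogonal_def inner_commute)
      have "coord_vec M (U, \<phi>) q w (\<lambda>x. \<phi> x \<bullet> n) = coord_vec M (U, \<phi>) q w (\<lambda>x. 0)"
        using q cc(1) by (intro tan_sub_cong[OF q(2) v smooth_fun_at_coord[OF ambient_premanifold c(1) q(1)]
              smooth_fun_at_const[OF ambient_premanifold] chart_openin[OF sub_premanifold c(2)] qU z]) auto
      also have "\<dots> = 0"
        using q cc(1) by (intro tangent_const[OF ambient_premanifold coord_vec_tangent[OF ambient_premanifold c(1) q(1) w]]) auto
      finally show "w \<bullet> n = 0" using coord_vec_coord[OF ambient_premanifold c(1) q(1) w] by simp
    qed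
  }
  assume wS: "w \<in> model S"
  have "coord_vec M (U, \<phi>) q w = incl M q (coord_vec S (U \<inter> points S, \<phi>) q w)"
  proof
    fix f show "coord_vec M (U, \<phi>) q w f = incl M q (coord_vec S (U \<inter> points S, \<phi>) q w) f"
    proof (cases "smooth_fun_at M q f")
      case True
      note S = smooth_fun_at_restrict[OF True q(2)]
      have "coord_vec S (U \<inter> points S, \<phi>) q w f = ddir (f \<circ> inv_into (U \<inter> points S) \<phi>) (\<phi> q) w"
        by (rule coord_vec_ddir[OF sub_premanifold c(2) qU wS S])
      also have "\<dots> = ddir (f \<circ> inv_into U \<phi>) (\<phi> q) w"
      proof (rule ddir_cong[OF model_subspace[OF sub_premanifold] cs(3) imageI[OF qU] wS])
        fix x assume "x \<in> \<phi> ` (U \<inter> points S)"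
        then obtain z where z: "z \<in> U \<inter> points S" "x = \<phi> z" by blast
        then show "(f \<circ> inv_into (U \<inter> points S) \<phi>) x = (f \<circ> inv_into U \<phi>) x"
          using cc(2) inv_into_f_f[OF cs(2) z(1)] by simp
      qed
      also have "\<dots> = coord_vec M (U, \<phi>) q w f"
        by (rule coord_vec_ddir[OF ambient_premanifold c(1) q(1) w True, symmetric])
      finally show ?thesis using True by (simp add: incl_apply)
    next
      case False
      then show ?thesis by (simp add: coord_vec_def incl_def differential_def)
    qed
  qed
  then show "coord_vec M (U, \<phi>) q w \<in> tan_sub M S q"
    unfolding tan_sub_def using coord_vec_tangent[OF sub_premanifold c(2) qU wS] by blast
qed

lemma smooth_covec_at_dfun:
  assumes q: "q \<in> points S" and F: "smooth_fun_at M q F"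
  shows "smooth_covec_at M S q (dfun M F)"
proof -
  have "smooth_fun_at S q (\<lambda>x. dfun M F x (X x))" if X: "smooth_vec_at M S q X" for X
  proof -
    obtain G where G: "openin (mfd_topology S) G" "q \<in> G" "\<And>x. x \<in> G \<Longrightarrow> X x \<in> tangent_space M x"
      by (rule smooth_vec_at_nhd[OF X]) (rule that; assumption)
    show ?thesis
      by (rule smooth_fun_at_cong[OF sub_premanifold smooth_vec_at_apply[OF X F] G(1,2)])
        (simp add: dfun_apply G(3))
  qed
  then show ?thesis
    by (rule smooth_covec_atI[OF openin_mfd_points[OF sub_premanifold] q dfun_cotangent])
qed

lemma smooth_covec_at_cong:
  assumes a: "smooth_covec_at M S q a" and G: "openin (mfd_topology S) G" "q \<in> G" "\<And>x. x \<in> G \<Longrightarrow> a x = b x"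
  shows "smooth_covec_at M S q b"
proof -
  obtain G' where G': "openin (mfd_topology S) G'" "q \<in> G'" "\<And>x. x \<in> G' \<Longrightarrow> a x \<in> cotangent_space M x"
    by (rule smooth_covec_at_nhd[OF a]) (rule that; assumption)
  have o: "openin (mfd_topology S) (G \<inter> G')" "q \<in> G \<inter> G'" using G G' by auto
  have m: "b x \<in> cotangent_space M x" if "x \<in> G \<inter> G'" for x
    using that G(3)[of x] G'(3)[of x] by simp
  have "smooth_fun_at S q (\<lambda>x. b x (X x))" if X: "smooth_vec_at M S q X" for X
    by (rule smooth_fun_at_cong[OF sub_premanifold smooth_covec_at_apply[OF a X] G(1,2)]) (simp add: G(3))
  note n = this
  show ?thesis by (rule smooth_covec_atI[OF o]) (erule m, erule n)
qed

lemma smooth_covec_at_diff: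
  assumes a: "smooth_covec_at M S q a" and b: "smooth_covec_at M S q b"
  shows "smooth_covec_at M S q (\<lambda>x. a x - b x)"
proof -
  obtain G where G: "openin (mfd_topology S) G" "q \<in> G" "\<And>x. x \<in> G \<Longrightarrow> a x \<in> cotangent_space M x"
    by (rule smooth_covec_at_nhd[OF a]) (rule that; assumption)
  obtain G' where G': "openin (mfd_topology S) G'" "q \<in> G'" "\<And>x. x \<in> G' \<Longrightarrow> b x \<in> cotangent_space M x"
    by (rule smooth_covec_at_nhd[OF b]) (rule that; assumption)
  have o: "openin (mfd_topology S) (G \<inter> G')" "q \<in> G \<inter> G'" using G G' by auto
  have m: "a x - b x \<in> cotangent_space M x" if "x \<in> G \<inter> G'" for x
    using that by (intro subspace_diff[OF subspace_cotangent_space] G(3) G'(3)) auto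
  have "smooth_fun_at S q (\<lambda>x. (a x - b x) (X x))" if X: "smooth_vec_at M S q X" for X
    using smooth_fun_at_diff[OF sub_premanifold smooth_covec_at_apply[OF a X] smooth_covec_at_apply[OF b X]] by simp
  note n = this
  show ?thesis by (rule smooth_covec_atI[OF o]) (erule m, erule n)
qed

lemma smooth_vec_at_cong:
  assumes X: "smooth_vec_at M S q X" and G: "openin (mfd_topology S) G" "q \<in> G" "\<And>x. x \<in> G \<Longrightarrow> X x = Y x"
  shows "smooth_vec_at M S q Y"
proof -
  obtain G' where G': "openin (mfd_topology S) G'" "q \<in> G'" "\<And>x. x \<in> G' \<Longrightarrow> X x \<in> tangent_space M x"
    by (rule smooth_vec_at_nhd[OF X]) (rule that; assumption)
  have o: "openin (mfd_topology S) (G \<inter> G')" "q \<in> G \<inter> G'" using G G' by auto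
  have m: "Y x \<in> tangent_space M x" if "x \<in> G \<inter> G'" for x
    using that G(3)[of x] G'(3)[of x] by simp
  have "smooth_fun_at S q (\<lambda>x. Y x f)" if f: "smooth_fun_at M q f" for f
    by (rule smooth_fun_at_cong[OF sub_premanifold smooth_vec_at_apply[OF X f] G(1,2)]) (simp add: G(3))
  note n = this
  show ?thesis by (rule smooth_vec_atI[OF o]) (erule m, erule n)
qed

lemma smooth_vec_at_coord_vec:
  assumes c: "(U, \<phi>) \<in> charts M" and q: "q \<in> U" "q \<in> points S" and u: "u \<in> model M"
  shows "smooth_vec_at M S q (\<lambda>x. coord_vec M (U, \<phi>) x u)"
proof -
  have o: "openin (mfd_topology S) (U \<inter> points S)" "q \<in> U \<inter> points S"
    using openin_restrict[OF chart_openin[OF ambient_premanifold c]] q by auto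
  have m: "coord_vec M (U, \<phi>) x u \<in> tangent_space M x" if "x \<in> U \<inter> points S" for x
    using coord_vec_tangent[OF ambient_premanifold c _ u] that by blast
  have "smooth_fun_at S q (\<lambda>x. coord_vec M (U, \<phi>) x u f)" if "smooth_fun_at M q f" for f
    by (rule smooth_fun_at_restrict[OF smooth_fun_at_coord_vec[OF ambient_premanifold c q(1) u that] q(2)])
  note n = this
  show ?thesis by (rule smooth_vec_atI[OF o]) (erule m, erule n)
qed

lemma restrict_covec_dfun:
  assumes "q \<in> points S" "smooth_fun_at M q F"
  shows "restrict_covec M S q (dfun M F q) = dfun S F q"
  using assms incl_tangent
  by (auto simp: restrict_covec_def dfun_def zero_ext_def fun_eq_iff incl_apply)

lemma restrict_covec_cotangent:
  assumes "q \<in> points S" "a \<in> cotangent_space M q"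
  shows "restrict_covec M S q a \<in> cotangent_space S q"
  using assms incl_tangent subspace_tangent_space[of S q] cotangent_linear[OF assms(2)] cotangent_scale[OF assms(2)]
  by (auto simp: restrict_covec_def cotangent_space_def dual_space_def linear_over_def zero_ext_def
      incl_linear subspace_def)

end

section \<open>Brackets of exact forms\<close>

lemma dfun_add:
  assumes "premanifold M" "smooth_fun_at M p f" "smooth_fun_at M p g"
  shows "dfun M (\<lambda>x. f x + g x) p = dfun M f p + dfun M g p"
  by (rule cotangent_eqI[OF dfun_cotangent subspace_add[OF subspace_cotangent_space dfun_cotangent dfun_cotangent]])
    (simp add: dfun_apply tangent_add assms)

lemma dfun_cmult:
  assumes "smooth_fun_at M p f"
  shows "dfun M (\<lambda>x. c * f x) p = c *\<^sub>R dfun M f p"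
  by (rule cotangent_eqI[OF dfun_cotangent subspace_scale[OF subspace_cotangent_space dfun_cotangent]])
    (simp add: dfun_apply tangent_scale assms)

lemma dfun_mult:
  assumes "smooth_fun_at M p f" "smooth_fun_at M p g"
  shows "dfun M (\<lambda>x. f x * g x) p = g p *\<^sub>R dfun M f p + f p *\<^sub>R dfun M g p"
  by (rule cotangent_eqI[OF dfun_cotangent])
    (auto intro!: subspace_add[OF subspace_cotangent_space] subspace_scale[OF subspace_cotangent_space] dfun_cotangent
      simp: dfun_apply tangent_mult assms)

lemma dfun_cong:
  assumes "premanifold M" "openin (mfd_topology M) G" "p \<in> G" "\<And>x. x \<in> G \<Longrightarrow> f x = g x"
  shows "dfun M f p = dfun M g p"
  by (rule cotangent_eqI[OF dfun_cotangent dfun_cotangent])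
    (use tangent_cong[OF assms(1) _ assms(2-4)] in \<open>simp add: dfun_apply\<close>)

lemma bivector_linear:
  assumes "bivector_at M p B" "a \<in> cotangent_space M p" "b \<in> cotangent_space M p" "b' \<in> cotangent_space M p"
  shows "B a (b + b') = B a b + B a b'" "B a (c *\<^sub>R b) = c * B a b" "B a b = - B b a"
    "B a (b - b') = B a b - B a b'"
proof -
  have l: "linear_over (cotangent_space M p) (B a)" using assms by (simp add: bivector_at_def)
  show "B a (b + b') = B a b + B a b'" by (rule linear_over_dual(1)[OF l assms(3,4)])
  show "B a (c *\<^sub>R b) = c * B a b" using linear_over_dual(2)[OF l assms(3,4), of c] by simp
  show "B a b = - B b a" using assms(1-3) unfolding bivector_at_def by blast
  have "(-1) *\<^sub>R b' \<in> cotangent_space M p" by (rule subspace_scale[OF subspace_cotangent_space assms(4)])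
  from linear_over_dual(1)[OF l assms(3) this] linear_over_dual(2)[OF l assms(4,4), of "-1"]
  show "B a (b - b') = B a b - B a b'" by simp
qed

lemma sharp_apply: "smooth_fun_at M p f \<Longrightarrow> sharp M P p a f = P p a (dfun M f p)"
  by (simp add: sharp_def)

lemma sharp_tangent:
  assumes M: "premanifold M" and B: "bivector_at M p (P p)" and a: "a \<in> cotangent_space M p"
  shows "sharp M P p a \<in> tangent_space M p"
proof (rule tangent_spaceI)
  note lin = bivector_linear[OF B a]
  have s: "c *\<^sub>R dfun M f p \<in> cotangent_space M p" for c f
    by (rule subspace_scale[OF subspace_cotangent_space dfun_cotangent])
  fix f g assume fg: "smooth_fun_at M p f" "smooth_fun_at M p g"
  show "sharp M P p a (\<lambda>x. f x + g x) = sharp M P p a f + sharp M P p a g"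
    using fg smooth_fun_at_add[OF M] by (simp add: sharp_apply dfun_add[OF M] lin(1)[OF dfun_cotangent dfun_cotangent])
  show "sharp M P p a (\<lambda>x. f x * g x) = sharp M P p a f * g p + f p * sharp M P p a g"
    using fg smooth_fun_at_mult[OF M]
    by (simp add: sharp_apply dfun_mult lin(1)[OF s s] lin(2)[OF dfun_cotangent dfun_cotangent])
next
  fix c f assume f: "smooth_fun_at M p f"
  then show "sharp M P p a (\<lambda>x. c * f x) = c * sharp M P p a f"
    using smooth_fun_at_cmult[OF M]
    by (simp add: sharp_apply dfun_cmult bivector_linear(2)[OF B a dfun_cotangent dfun_cotangent])
qed (simp add: sharp_def)

text \<open>\<open>sharp\<close> is prescribed by its pairing with differentials of functions;
  writing \<open>b\<close> as a differential at \<open>p\<close> transfers the formula to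
  \<open>b\<close>.\<close>

lemma cotangent_sharp:
  assumes M: "premanifold M" and p: "p \<in> points M" and B: "bivector_at M p (P p)"
    and a: "a \<in> cotangent_space M p" and b: "b \<in> cotangent_space M p"
  shows "b (sharp M P p a) = P p a b"
proof -
  obtain f where "smooth_fun_at M p f" "b = dfun M f p" by (rule cotangent_eq_dfun[OF M p b])
  then show ?thesis by (simp add: dfun_apply[OF sharp_tangent[where P = P, OF M B a]] sharp_apply)
qed

text \<open>The chart selected inside \<open>ext_deriv\<close> depends on the point alone, so a
  single name for it serves all forms and vectors there.\<close>

lemma ext_deriv_chart:
  assumes M: "premanifold M" and p: "p \<in> points M"
  obtains U \<phi> where "(U, \<phi>) \<in> charts M" "p \<in> U"
    "\<And>\<beta> v w. ext_deriv M \<beta> p v w =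
      v (\<lambda>x. \<beta> x (coord_vec M (U, \<phi>) x (vec_coords (U, \<phi>) w)))
      - w (\<lambda>x. \<beta> x (coord_vec M (U, \<phi>) x (vec_coords (U, \<phi>) v)))"
proof -
  define c where "c = (SOME c. c \<in> charts M \<and> p \<in> fst c)"
  obtain U \<phi> where "(U, \<phi>) \<in> charts M" "p \<in> U" by (rule chart_exists[OF M p])
  then have "\<exists>c. c \<in> charts M \<and> p \<in> fst c" by (intro exI[of _ "(U, \<phi>)"]) simp
  from someI_ex[OF this] have c: "c \<in> charts M" "p \<in> fst c" unfolding c_def by blast+
  obtain U \<phi> where U: "c = (U, \<phi>)" by (cases c)
  show ?thesis
  proof (rule that[of U \<phi>])
    show "(U, \<phi>) \<in> charts M" "p \<in> U" using c U by auto
    fix \<beta> v w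
    show "ext_deriv M \<beta> p v w =
      v (\<lambda>x. \<beta> x (coord_vec M (U, \<phi>) x (vec_coords (U, \<phi>) w)))
      - w (\<lambda>x. \<beta> x (coord_vec M (U, \<phi>) x (vec_coords (U, \<phi>) v)))"
      unfolding ext_deriv_def Let_def c_def[symmetric] U ..
  qed
qed

text \<open>This is d(dA) = 0 at \<open>p\<close>: the two sides are the terms whose difference
  \<open>ext_deriv\<close> forms.\<close>

lemma coord_vec_dfun_commute:
  assumes M: "premanifold M" and c: "(U, \<phi>) \<in> charts M" "p \<in> U"
    and v: "v \<in> tangent_space M p" and w: "w \<in> tangent_space M p" and A: "smooth_fun_at M p A"
  shows "v (\<lambda>x. dfun M A x (coord_vec M (U, \<phi>) x (vec_coords (U, \<phi>) w))) =
    w (\<lambda>x. dfun M A x (coord_vec M (U, \<phi>) x (vec_coords (U, \<phi>) v)))"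
proof -
  have *: "v (\<lambda>x. dfun M A x (coord_vec M (U, \<phi>) x (vec_coords (U, \<phi>) w))) =
      coord_vec M (U, \<phi>) p (vec_coords (U, \<phi>) v) (\<lambda>x. coord_vec M (U, \<phi>) x (vec_coords (U, \<phi>) w) A)"
    if v: "v \<in> tangent_space M p" and w: "w \<in> tangent_space M p" for v w
  proof -
    have "v (\<lambda>x. dfun M A x (coord_vec M (U, \<phi>) x (vec_coords (U, \<phi>) w))) =
        v (\<lambda>x. coord_vec M (U, \<phi>) x (vec_coords (U, \<phi>) w) A)"
      by (rule tangent_cong[OF M v chart_openin[OF M c(1)] c(2)])
        (simp add: dfun_apply coord_vec_tangent[OF M c(1) _ vec_coords_in_model[OF M c w]])
    then show ?thesis using coord_vec_vec_coords[OF M c v] by simp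
  qed
  show ?thesis unfolding *[OF v w] *[OF w v]
    by (rule coord_vec_commute[OF M c vec_coords_in_model[OF M c w] vec_coords_in_model[OF M c v] A])
qed

text \<open>Exact forms are closed, so both exterior derivatives drop out. The remaining term gives
  d{f, g}, because df evaluated on the Hamiltonian vector of g is -{f, g}.\<close>

lemma oneform_bracket_dfun:
  assumes M: "premanifold M" and B: "\<And>x. x \<in> points M \<Longrightarrow> bivector_at M x (P x)"
    and fg: "smooth_fun_at M p f" "smooth_fun_at M p g" and s: "smooth_fun_at M p (poisson_bracket M P f g)"
  shows "oneform_bracket M P (dfun M f) (dfun M g) p = dfun M (poisson_bracket M P f g) p"
proof
  fix v
  have p: "p \<in> points M" by (rule smooth_fun_at_points[OF M fg(1)])
  show "oneform_bracket M P (dfun M f) (dfun M g) p v = dfun M (poisson_bracket M P f g) p v"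
  proof (cases "v \<in> tangent_space M p")
    case v: True
    obtain U \<phi> where c: "(U, \<phi>) \<in> charts M" "p \<in> U"
      and ext: "\<And>\<beta> v w. ext_deriv M \<beta> p v w =
        v (\<lambda>x. \<beta> x (coord_vec M (U, \<phi>) x (vec_coords (U, \<phi>) w)))
        - w (\<lambda>x. \<beta> x (coord_vec M (U, \<phi>) x (vec_coords (U, \<phi>) v)))"
      by (rule ext_deriv_chart[OF M p]) (rule that; assumption)
    have sh: "sharp M P p (dfun M f p) \<in> tangent_space M p" for f
      by (rule sharp_tangent[where P = P, OF M B[OF p] dfun_cotangent])
    have "v (\<lambda>x. dfun M f x (sharp M P x (dfun M g x))) = v (\<lambda>x. - poisson_bracket M P f g x)"
      by (rule tangent_cong[OF M v openin_mfd_points[OF M] p])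
        (simp add: cotangent_sharp[where P = P, OF M _ B] dfun_cotangent poisson_bracket_def
          bivector_linear(3)[OF B dfun_cotangent dfun_cotangent dfun_cotangent, of _ f g])
    then show ?thesis
      using coord_vec_dfun_commute[OF M c sh v fg(1)] coord_vec_dfun_commute[OF M c sh v fg(2)]
        tangent_uminus[OF M v s] v
      by (simp add: oneform_bracket_def zero_ext_def ext dfun_apply)
  next
    case False
    then show ?thesis by (simp add: oneform_bracket_def dfun_def zero_ext_def)
  qed
qed

text \<open>When \<open>Y\<close> is expanded in coordinate fields, the derivatives of its
  coefficients are multiplied by values of \<open>\<gamma>\<close> at \<open>p\<close>, which
  vanish. Hence only \<open>Y p\<close> matters, and two fields with the same value at
  \<open>p\<close> are interchangeable.\<close>

lemma covec_vec_derivative: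
  assumes M: "premanifold M" and \<gamma>: "smooth_covec_at M M p \<gamma>" and Y: "smooth_vec_at M M p Y"
    and z: "\<And>w. w \<in> tangent_space M p \<Longrightarrow> \<gamma> p w = 0"
    and c: "(U, \<phi>) \<in> charts M" "p \<in> U" and v: "v \<in> tangent_space M p"
  shows "v (\<lambda>x. \<gamma> x (Y x)) =
    (\<Sum>b\<in>onb (model M). Y p (\<lambda>x. \<phi> x \<bullet> b) * v (\<lambda>x. \<gamma> x (coord_vec M (U, \<phi>) x b)))"
proof -
  have p: "p \<in> points M" using c charts_chart_on(1) by blast
  obtain G where G: "openin (mfd_topology M) G" "p \<in> G" "\<And>x. x \<in> G \<Longrightarrow> \<gamma> x \<in> cotangent_space M x"
    by (rule smooth_covec_at_nhd[OF \<gamma>]) (rule that; assumption)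
  obtain G' where G': "openin (mfd_topology M) G'" "p \<in> G'" "\<And>x. x \<in> G' \<Longrightarrow> Y x \<in> tangent_space M x"
    by (rule smooth_vec_at_nhd[OF Y]) (rule that; assumption)
  have b: "b \<in> model M" if "b \<in> onb (model M)" for b
    using that onb_subset[OF model_subspace[OF M]] by blast
  have o: "openin (mfd_topology M) (G \<inter> G' \<inter> U)" "p \<in> G \<inter> G' \<inter> U"
    using G G' c(2) chart_openin[OF M c(1)] by auto
  have s1: "smooth_fun_at M p (\<lambda>x. Y x (\<lambda>x. \<phi> x \<bullet> b))" for b
    by (rule smooth_vec_at_apply[OF Y smooth_fun_at_coord[OF M c]])
  have cv: "smooth_vec_at M M p (\<lambda>x. coord_vec M (U, \<phi>) x b)" if "b \<in> onb (model M)" for b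
  proof (rule smooth_vec_atI[OF chart_openin[OF M c(1)] c(2)])
    show "coord_vec M (U, \<phi>) x b \<in> tangent_space M x" if "x \<in> U" for x
      by (rule coord_vec_tangent[OF M c(1) that b[OF \<open>b \<in> onb (model M)\<close>]])
    show "smooth_fun_at M p (\<lambda>x. coord_vec M (U, \<phi>) x b f)" if "smooth_fun_at M p f" for f
      by (rule smooth_fun_at_coord_vec[OF M c b[OF \<open>b \<in> onb (model M)\<close>] that])
  qed
  have s2: "smooth_fun_at M p (\<lambda>x. \<gamma> x (coord_vec M (U, \<phi>) x b))" if "b \<in> onb (model M)" for b
    by (rule smooth_covec_at_apply[OF \<gamma> cv[OF that]])
  have "v (\<lambda>x. \<gamma> x (Y x)) =
      v (\<lambda>x. \<Sum>b\<in>onb (model M). Y x (\<lambda>x. \<phi> x \<bullet> b) * \<gamma> x (coord_vec M (U, \<phi>) x b))"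
    by (rule tangent_cong[OF M v o]) (use G(3) G'(3) in \<open>auto intro!: cotangent_expansion[OF M c(1)]\<close>)
  also have "\<dots> = (\<Sum>b\<in>onb (model M). v (\<lambda>x. Y x (\<lambda>x. \<phi> x \<bullet> b) * \<gamma> x (coord_vec M (U, \<phi>) x b)))"
    by (rule tangent_sum[OF M v p smooth_fun_at_mult[OF M s1 s2]])
  also have "\<dots> = (\<Sum>b\<in>onb (model M). Y p (\<lambda>x. \<phi> x \<bullet> b) * v (\<lambda>x. \<gamma> x (coord_vec M (U, \<phi>) x b)))"
  proof (intro sum.cong refl)
    fix k assume k: "k \<in> onb (model M)"
    show "v (\<lambda>x. Y x (\<lambda>x. \<phi> x \<bullet> k) * \<gamma> x (coord_vec M (U, \<phi>) x k)) =
        Y p (\<lambda>x. \<phi> x \<bullet> k) * v (\<lambda>x. \<gamma> x (coord_vec M (U, \<phi>) x k))"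
      unfolding tangent_mult[OF v s1 s2[OF k]] z[OF coord_vec_tangent[OF M c b[OF k]]] by simp
  qed
  finally show ?thesis .
qed

section \<open>The bracket of exact sections along a Poisson submanifold\<close>

context
  fixes M S :: "('a, 'v::euclidean_space) mfd" and P PS :: "'a \<Rightarrow> 'a bivec"
  assumes PM: "poisson_manifold M P" and PS: "poisson_submanifold M P S PS"
begin

lemma
  shows poisson_premanifold: "premanifold M" and poisson_smooth_manifold: "smooth_manifold M"
    and poisson_bivector: "\<And>p. p \<in> points M \<Longrightarrow> bivector_at M p (P p)"
    and poisson_embedded: "embedded_submanifold M S"
    and poisson_sub_bivector: "\<And>p. p \<in> points S \<Longrightarrow> bivector_at S p (PS p)"
    and poisson_restrict: "\<And>q a b. q \<in> points S \<Longrightarrow> a \<in> cotangent_space M q \<Longrightarrow> b \<in> cotangent_space M q \<Longrightarrow>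
      P q a b = PS q (restrict_covec M S q a) (restrict_covec M S q b)"
  using PM PS smooth_manifold_premanifold by (auto simp: poisson_manifold_def poisson_submanifold_def)

lemma smooth_poisson_bracket:
  "smooth_fun_at M p f \<Longrightarrow> smooth_fun_at M p g \<Longrightarrow> smooth_fun_at M p (poisson_bracket M P f g)"
  using PM smooth_fun_at_points[OF poisson_premanifold] by (simp add: poisson_manifold_def)

lemma poisson_bracket_sharp:
  "smooth_fun_at M p g \<Longrightarrow> poisson_bracket M P f g p = sharp M P p (dfun M f p) g"
  by (simp add: poisson_bracket_def sharp_apply)

lemma sharp_dfun_tangent: "p \<in> points M \<Longrightarrow> sharp M P p (dfun M f p) \<in> tangent_space M p"
  by (rule sharp_tangent[where P = P, OF poisson_premanifold poisson_bivector dfun_cotangent])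

lemma poisson_bracket_antisym: "p \<in> points M \<Longrightarrow> poisson_bracket M P f g p = - poisson_bracket M P g f p"
  unfolding poisson_bracket_def
  by (rule bivector_linear(3)[OF poisson_bivector dfun_cotangent dfun_cotangent dfun_cotangent])

lemma smooth_vec_at_hamiltonian:
  assumes f: "smooth_fun_at M p f"
  shows "smooth_vec_at M M p (\<lambda>x. sharp M P x (dfun M f x))"
proof (rule smooth_vec_atI[OF openin_mfd_points[OF poisson_premanifold] smooth_fun_at_points[OF poisson_premanifold f]])
  show "sharp M P x (dfun M f x) \<in> tangent_space M x" if "x \<in> points M" for x
    by (rule sharp_dfun_tangent[OF that])
  fix g assume g: "smooth_fun_at M p g"
  obtain G where G: "openin (mfd_topology M) G" "p \<in> G" "\<And>x. x \<in> G \<Longrightarrow> smooth_fun_at M x g"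
    by (rule smooth_fun_at_nhd[OF poisson_premanifold g]) (rule that; assumption)
  show "smooth_fun_at M p (\<lambda>x. sharp M P x (dfun M f x) g)"
    by (rule smooth_fun_at_cong[OF poisson_premanifold smooth_poisson_bracket[OF f g] G(1,2)])
      (rule poisson_bracket_sharp[OF G(3)])
qed

lemma sharp_covec_antisym:
  assumes "x \<in> points M" "a \<in> cotangent_space M x" "b \<in> cotangent_space M x"
  shows "b (sharp M P x a) = - a (sharp M P x b)"
  using cotangent_sharp[where P = P, OF poisson_premanifold assms(1) poisson_bivector[OF assms(1)]]
    bivector_linear(3)[OF poisson_bivector[OF assms(1)] assms(2,3,3)] assms
  by simp

text \<open>By antisymmetry the field acts on \<open>f\<close> as minus \<open>\<beta>\<close>
  evaluated on the Hamiltonian field of \<open>f\<close>, and that field is smooth because Poisson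
  brackets of smooth functions are.\<close>

lemma smooth_vec_at_sharp:
  assumes \<beta>: "smooth_covec_at M M p \<beta>"
  shows "smooth_vec_at M M p (\<lambda>x. sharp M P x (\<beta> x))"
proof -
  obtain G0 where G0: "openin (mfd_topology M) G0" "p \<in> G0" "\<And>x. x \<in> G0 \<Longrightarrow> \<beta> x \<in> cotangent_space M x"
    by (rule smooth_covec_at_nhd[OF \<beta>]) (rule that; assumption)
  have pts: "x \<in> points M" if "x \<in> G0" for x
    using that G0(1) openin_mfd_topology[OF poisson_premanifold] by blast
  show ?thesis
  proof (rule smooth_vec_atI[OF G0(1,2)])
    show "sharp M P x (\<beta> x) \<in> tangent_space M x" if "x \<in> G0" for x
      by (rule sharp_tangent[where P = P, OF poisson_premanifold poisson_bivector[OF pts[OF that]] G0(3)[OF that]])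
    fix f assume f: "smooth_fun_at M p f"
    obtain G where G: "openin (mfd_topology M) G" "p \<in> G" "\<And>x. x \<in> G \<Longrightarrow> smooth_fun_at M x f"
      by (rule smooth_fun_at_nhd[OF poisson_premanifold f]) (rule that; assumption)
    have "smooth_fun_at M p (\<lambda>x. - \<beta> x (sharp M P x (dfun M f x)))"
      by (rule smooth_fun_at_uminus[OF poisson_premanifold smooth_covec_at_apply[OF \<beta> smooth_vec_at_hamiltonian[OF f]]])
    then show "smooth_fun_at M p (\<lambda>x. sharp M P x (\<beta> x) f)"
    proof (rule smooth_fun_at_cong[OF poisson_premanifold])
      show "openin (mfd_topology M) (G0 \<inter> G)" "p \<in> G0 \<inter> G" using G0 G by auto
      fix x assume x: "x \<in> G0 \<inter> G"
      then have t: "sharp M P x (\<beta> x) \<in> tangent_space M x"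
        using sharp_tangent[where P = P, OF poisson_premanifold poisson_bivector[OF pts] G0(3)] by blast
      show "- \<beta> x (sharp M P x (dfun M f x)) = sharp M P x (\<beta> x) f"
        using sharp_covec_antisym[OF pts G0(3) dfun_cotangent, of x f] x dfun_apply[OF t, of f] by simp
    qed
  qed
qed

text \<open>The last clause of \<open>poisson_submanifold\<close> expresses \<open>P\<close> through
  restrictions to \<open>S\<close>; so the vector is the image under \<open>incl\<close> of
  \<open>sharp S PS\<close> applied to the restricted covector.\<close>

lemma sharp_tan_sub:
  assumes q: "q \<in> points S" and a: "a \<in> cotangent_space M q"
  shows "sharp M P q a \<in> tan_sub M S q"
proof -
  note emb = poisson_embedded
  let ?a = "restrict_covec M S q a"
  have "sharp M P q a = incl M q (sharp S PS q ?a)"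
  proof
    fix f show "sharp M P q a f = incl M q (sharp S PS q ?a) f"
      using smooth_fun_at_restrict[OF emb _ q, of f] restrict_covec_dfun[OF emb q, of f]
        poisson_restrict[OF q a dfun_cotangent]
      by (cases "smooth_fun_at M q f") (simp_all add: incl_def differential_def sharp_def)
  qed
  moreover have "sharp S PS q ?a \<in> tangent_space S q"
    by (rule sharp_tangent[where P = PS, OF sub_premanifold[OF emb] poisson_sub_bivector[OF q] restrict_covec_cotangent[OF emb q a]])
  ultimately show ?thesis by (simp add: tan_sub_def)
qed

lemma poisson_bracket_restrict:
  assumes "q \<in> points S" "smooth_fun_at M q f" "smooth_fun_at M q g"
  shows "poisson_bracket M P f g q = poisson_bracket S PS f g q"
  using assms restrict_covec_dfun[OF poisson_embedded assms(1)] poisson_restrict[OF assms(1) dfun_cotangent dfun_cotangent]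
  by (simp add: poisson_bracket_def)

text \<open>The forms \<open>\<alpha> - dA\<close> and \<open>\<beta> - dB\<close> vanish on
  \<open>S\<close> near \<open>q\<close>, but their transverse derivatives need not. These
  derivatives enter through the two exterior derivatives and again through the differential of the
  pairing, and the contributions cancel. Tangency of the Hamiltonian vectors to \<open>S\<close>
  keeps the other terms free of the extensions.\<close>

lemma oneform_bracket_exact_on_sub:
  assumes q: "q \<in> points S" and A: "smooth_fun_at M q A" and B: "smooth_fun_at M q B"
    and \<alpha>: "smooth_covec_at M M q \<alpha>" and \<beta>: "smooth_covec_at M M q \<beta>"
    and G: "openin (mfd_topology S) G" "q \<in> G" "\<And>x. x \<in> G \<Longrightarrow> \<alpha> x = dfun M A x" "\<And>x. x \<in> G \<Longrightarrow> \<beta> x = dfun M B x"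
  shows "oneform_bracket M P \<alpha> \<beta> q = dfun M (poisson_bracket M P A B) q"
proof
  fix v
  note M = poisson_premanifold and emb = poisson_embedded
  note embM = embedded_submanifold_refl[OF poisson_smooth_manifold]
  have qM: "q \<in> points M" using q sub_points[OF emb] by blast
  show "oneform_bracket M P \<alpha> \<beta> q v = dfun M (poisson_bracket M P A B) q v"
  proof (cases "v \<in> tangent_space M q")
    case False
    then show ?thesis by (simp add: oneform_bracket_def dfun_def zero_ext_def)
  next
    case v: True
    obtain U \<phi> where c: "(U, \<phi>) \<in> charts M" "q \<in> U"
      and ext: "\<And>\<beta> v w. ext_deriv M \<beta> q v w =
        v (\<lambda>x. \<beta> x (coord_vec M (U, \<phi>) x (vec_coords (U, \<phi>) w)))
        - w (\<lambda>x. \<beta> x (coord_vec M (U, \<phi>) x (vec_coords (U, \<phi>) v)))"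
      by (rule ext_deriv_chart[OF M qM]) (rule that; assumption)
    define X where "X w x = coord_vec M (U, \<phi>) x (vec_coords (U, \<phi>) w)" for w x
    have Xs: "smooth_vec_at M M q (X w)" if "w \<in> tangent_space M q" for w
      unfolding X_def by (rule smooth_vec_at_coord_vec[OF embM c qM vec_coords_in_model[OF M c that]])
    have Xq: "X w q = w" if "w \<in> tangent_space M q" for w
      unfolding X_def by (rule coord_vec_vec_coords[OF M c that])
    note dA = smooth_covec_at_dfun[OF embM qM A] and dB = smooth_covec_at_dfun[OF embM qM B]
    define \<gamma> \<gamma>' where "\<gamma> x = \<alpha> x - dfun M A x" and "\<gamma>' x = \<beta> x - dfun M B x" for x
    have \<gamma>: "smooth_covec_at M M q \<gamma>" unfolding \<gamma>_def by (rule smooth_covec_at_diff[OF embM \<alpha> dA])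
    have \<gamma>': "smooth_covec_at M M q \<gamma>'" unfolding \<gamma>'_def by (rule smooth_covec_at_diff[OF embM \<beta> dB])
    have z: "\<gamma> q w = 0" "\<gamma>' q w = 0" for w using G by (auto simp: \<gamma>_def \<gamma>'_def)
    \<comment> \<open>For a form vanishing at \<open>q\<close> only the value of the field at
      \<open>q\<close> counts. This trades a Hamiltonian field for the constant-coefficient field
      that \<open>ext_deriv\<close> uses.\<close>
    have same: "v (\<lambda>x. \<delta> x (Y x)) = v (\<lambda>x. \<delta> x (Y' x))"
      if "smooth_covec_at M M q \<delta>" "\<And>w. \<delta> q w = 0" "smooth_vec_at M M q Y" "smooth_vec_at M M q Y'" "Y q = Y' q"
      for \<delta> Y Y'
      using covec_vec_derivative[OF M that(1,3,2) c v] covec_vec_derivative[OF M that(1,4,2) c v] that(5) by simp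
    \<comment> \<open>Being tangent to \<open>S\<close>, \<open>w\<close> sees no difference between
      \<open>\<omega>\<close> and \<open>dF\<close>, and closedness of \<open>dF\<close> moves the
      derivative over to \<open>v\<close>. Only the derivative of the difference form along
      \<open>v\<close> survives.\<close>
    have ext_eq: "ext_deriv M \<omega> q w v = - v (\<lambda>x. (\<omega> x - dfun M F x) (X w x))"
      if \<omega>: "smooth_covec_at M M q \<omega>" and F: "smooth_fun_at M q F" and w: "w \<in> tan_sub M S q"
        and eq: "\<And>x. x \<in> G \<Longrightarrow> \<omega> x = dfun M F x" for \<omega> F w
    proof -
      have wT: "w \<in> tangent_space M q" using w tan_sub_subset[OF emb q] by blast
      note dF = smooth_covec_at_dfun[OF embM qM F]
      have "w (\<lambda>x. \<omega> x (X v x)) = w (\<lambda>x. dfun M F x (X v x))"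
        by (rule tan_sub_cong[OF emb q w smooth_covec_at_apply[OF \<omega> Xs[OF v]] smooth_covec_at_apply[OF dF Xs[OF v]] G(1,2)])
          (simp add: eq)
      also have "\<dots> = v (\<lambda>x. dfun M F x (X w x))"
        unfolding X_def by (rule coord_vec_dfun_commute[OF M c wT v F])
      finally show ?thesis
        unfolding ext X_def[symmetric]
        using tangent_diff[OF M v smooth_covec_at_apply[OF \<omega> Xs[OF wT]] smooth_covec_at_apply[OF dF Xs[OF wT]]]
        by simp
    qed
    define u u' where "u = sharp M P q (\<alpha> q)" and "u' = sharp M P q (\<beta> q)"
    have u: "u \<in> tan_sub M S q" "u' \<in> tan_sub M S q"
      unfolding u_def u'_def G(3)[OF G(2)] G(4)[OF G(2)] by (rule sharp_tan_sub[OF q dfun_cotangent])+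
    then have uT: "u \<in> tangent_space M q" "u' \<in> tangent_space M q"
      using tan_sub_subset[OF emb q] by blast+
    obtain G1 where G1: "openin (mfd_topology M) G1" "q \<in> G1" "\<And>x. x \<in> G1 \<Longrightarrow> \<alpha> x \<in> cotangent_space M x"
      by (rule smooth_covec_at_nhd[OF \<alpha>]) (rule that; assumption)
    obtain G2 where G2: "openin (mfd_topology M) G2" "q \<in> G2" "\<And>x. x \<in> G2 \<Longrightarrow> \<beta> x \<in> cotangent_space M x"
      by (rule smooth_covec_at_nhd[OF \<beta>]) (rule that; assumption)
    have pts: "x \<in> points M" if "x \<in> G1" for x
      using that G1(1) openin_mfd_topology[OF M] by blast
    note ss = smooth_vec_at_sharp[OF \<beta>] and sA = smooth_vec_at_hamiltonian[OF A]
    note AB = smooth_poisson_bracket[OF A B]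
    have s1: "smooth_fun_at M q (\<lambda>x. \<gamma> x (sharp M P x (\<beta> x)))" by (rule smooth_covec_at_apply[OF \<gamma> ss])
    have s2: "smooth_fun_at M q (\<lambda>x. \<gamma>' x (sharp M P x (dfun M A x)))" by (rule smooth_covec_at_apply[OF \<gamma>' sA])
    \<comment> \<open>Antisymmetry of the tensor rearranges the pairing so that each difference form
      appears exactly once, next to -{A, B}.\<close>
    have "v (\<lambda>x. \<alpha> x (sharp M P x (\<beta> x))) =
        v (\<lambda>x. (\<gamma> x (sharp M P x (\<beta> x)) - \<gamma>' x (sharp M P x (dfun M A x))) - poisson_bracket M P A B x)"
    proof (rule tangent_cong[OF M v])
      show "openin (mfd_topology M) (G1 \<inter> G2)" "q \<in> G1 \<inter> G2" using G1 G2 by auto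
      fix x assume x: "x \<in> G1 \<inter> G2"
      then have xM: "x \<in> points M" and ab: "\<alpha> x \<in> cotangent_space M x" "\<beta> x \<in> cotangent_space M x"
        using pts G1(3) G2(3) by auto
      have "dfun M A x (sharp M P x (\<beta> x)) = - \<beta> x (sharp M P x (dfun M A x))"
        by (rule sharp_covec_antisym[OF xM ab(2) dfun_cotangent])
      moreover have "dfun M B x (sharp M P x (dfun M A x)) = poisson_bracket M P A B x"
        unfolding poisson_bracket_def
        by (rule cotangent_sharp[where P = P, OF M xM poisson_bivector[OF xM] dfun_cotangent dfun_cotangent])
      ultimately show "\<alpha> x (sharp M P x (\<beta> x)) =
          (\<gamma> x (sharp M P x (\<beta> x)) - \<gamma>' x (sharp M P x (dfun M A x))) - poisson_bracket M P A B x"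
        by (simp add: \<gamma>_def \<gamma>'_def)
    qed
    also have "\<dots> = v (\<lambda>x. \<gamma> x (sharp M P x (\<beta> x))) - v (\<lambda>x. \<gamma>' x (sharp M P x (dfun M A x)))
        - v (poisson_bracket M P A B)"
      unfolding tangent_diff[OF M v smooth_fun_at_diff[OF M s1 s2] AB] tangent_diff[OF M v s1 s2] ..
    also have "v (\<lambda>x. \<gamma> x (sharp M P x (\<beta> x))) = v (\<lambda>x. \<gamma> x (X u' x))"
      by (rule same[OF \<gamma> z(1) ss Xs[OF uT(2)]]) (subst Xq[OF uT(2)], rule u'_def[symmetric])
    also have "v (\<lambda>x. \<gamma>' x (sharp M P x (dfun M A x))) = v (\<lambda>x. \<gamma>' x (X u x))"
      by (rule same[OF \<gamma>' z(2) sA Xs[OF uT(1)]]) (subst Xq[OF uT(1)], unfold u_def G(3)[OF G(2)], rule refl)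
    finally have third: "v (\<lambda>x. \<alpha> x (sharp M P x (\<beta> x))) =
        v (\<lambda>x. \<gamma> x (X u' x)) - v (\<lambda>x. \<gamma>' x (X u x)) - v (poisson_bracket M P A B)" .
    have e1: "ext_deriv M \<beta> q u v = - v (\<lambda>x. \<gamma>' x (X u x))"
      unfolding \<gamma>'_def by (rule ext_eq[OF \<beta> B u(1) G(4)])
    have e2: "ext_deriv M \<alpha> q u' v = - v (\<lambda>x. \<gamma> x (X u' x))"
      unfolding \<gamma>_def by (rule ext_eq[OF \<alpha> A u(2) G(3)])
    have "oneform_bracket M P \<alpha> \<beta> q v =
        ext_deriv M \<beta> q u v - ext_deriv M \<alpha> q u' v - v (\<lambda>x. \<alpha> x (sharp M P x (\<beta> x)))"
      using v by (simp add: oneform_bracket_def zero_ext_def u_def u'_def dfun_apply)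
    also have "\<dots> = v (poisson_bracket M P A B)"
      unfolding third e1 e2 by simp
    finally show ?thesis using v by (simp add: dfun_apply)
  qed
qed

text \<open>The choice in \<open>restricted_bracket\<close> ranges over a nonempty set, with
  \<open>dfun M A\<close> and \<open>dfun M B\<close> as witnesses, and by
  \<open>oneform_bracket_exact_on_sub\<close> all its members coincide.\<close>

lemma restricted_bracket_exact:
  assumes q: "q \<in> points S" and A: "smooth_fun_at M q A" and B: "smooth_fun_at M q B"
    and a: "\<And>x. x \<in> points S \<Longrightarrow> a x = dfun M A x" and b: "\<And>x. x \<in> points S \<Longrightarrow> b x = dfun M B x"
  shows "restricted_bracket M P S a b q = dfun M (poisson_bracket M P A B) q"
proof -
  note embM = embedded_submanifold_refl[OF poisson_smooth_manifold]
  have qM: "q \<in> points M" using q sub_points[OF poisson_embedded] by blast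
  let ?Q = "\<lambda>c. \<exists>\<alpha> \<beta>. smooth_covec_at M M q \<alpha> \<and> smooth_covec_at M M q \<beta> \<and>
       (\<exists>G. openin (mfd_topology S) G \<and> q \<in> G \<and> (\<forall>x\<in>G. \<alpha> x = a x \<and> \<beta> x = b x)) \<and>
       c = oneform_bracket M P \<alpha> \<beta> q"
  have "?Q (oneform_bracket M P (dfun M A) (dfun M B) q)"
  proof (intro exI conjI)
    show "smooth_covec_at M M q (dfun M A)" "smooth_covec_at M M q (dfun M B)"
      by (rule smooth_covec_at_dfun[OF embM qM A]) (rule smooth_covec_at_dfun[OF embM qM B])
    show "openin (mfd_topology S) (points S)"
      by (rule openin_mfd_points[OF sub_premanifold[OF poisson_embedded]])
    show "\<forall>x\<in>points S. dfun M A x = a x \<and> dfun M B x = b x" using a b by simp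
  qed (use q in auto)
  moreover have "c = dfun M (poisson_bracket M P A B) q" if c: "?Q c" for c
  proof -
    obtain \<alpha> \<beta> G where \<alpha>\<beta>: "smooth_covec_at M M q \<alpha>" "smooth_covec_at M M q \<beta>"
      and G: "openin (mfd_topology S) G" "q \<in> G" "\<forall>x\<in>G. \<alpha> x = a x \<and> \<beta> x = b x"
      and c: "c = oneform_bracket M P \<alpha> \<beta> q"
      using c by blast
    have sub: "x \<in> points S" if "x \<in> G" for x
      using that G(1) openin_mfd_topology[OF sub_premanifold[OF poisson_embedded]] by blast
    show ?thesis unfolding c
      by (rule oneform_bracket_exact_on_sub[OF q A B \<alpha>\<beta> G(1,2)]) (use G(3) a b sub in auto)
  qed
  ultimately show ?thesis unfolding restricted_bracket_def by (rule someI2[of ?Q])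
qed

end

section \<open>The normal bundle\<close>

lemma smooth_on_chart:
  assumes M: "premanifold M" and c: "(U, \<phi>) \<in> charts M" and g: "\<And>x. x \<in> U \<Longrightarrow> smooth_fun_at M x g"
  shows "smooth_on (model M) (\<phi> ` U) (g \<circ> inv_into U \<phi>)"
proof (rule smooth_on_local[OF model_subspace[OF M]])
  fix y assume "y \<in> \<phi> ` U"
  then obtain x where x: "x \<in> U" "y = \<phi> x" by blast
  then show "\<exists>B. y \<in> B \<and> B \<subseteq> \<phi> ` U \<and> smooth_on (model M) B (g \<circ> inv_into U \<phi>)"
    using g[OF x(1)] unfolding smooth_fun_at_iff[OF M c x(1)] by blast
qed

context
  fixes M S :: "('a, 'v::euclidean_space) mfd"
  assumes emb: "embedded_submanifold M S"
begin

lemma mem_nu_iff: "w \<in> nu M S q v \<longleftrightarrow> w - v \<in> tan_sub M S q"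
proof
  assume "w \<in> nu M S q v"
  then show "w - v \<in> tan_sub M S q" by (auto simp: nu_def)
next
  assume "w - v \<in> tan_sub M S q"
  then have "v + (w - v) \<in> nu M S q v" unfolding nu_def by (rule imageI)
  then show "w \<in> nu M S q v" by simp
qed

lemma nu_eq_iff: "nu M S q v = nu M S q w \<longleftrightarrow> v - w \<in> tan_sub M S q"
proof
  note s = subspace_tan_sub[OF emb, of q]
  assume "nu M S q v = nu M S q w"
  moreover have "v \<in> nu M S q v" using subspace_0[OF s] by (simp add: mem_nu_iff)
  ultimately show "v - w \<in> tan_sub M S q" using mem_nu_iff by blast
next
  note s = subspace_tan_sub[OF emb, of q]
  assume d: "v - w \<in> tan_sub M S q"
  have "x - v \<in> tan_sub M S q \<longleftrightarrow> x - w \<in> tan_sub M S q" for x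
    using subspace_add[OF s _ d, of "x - v"] subspace_diff[OF s _ d, of "x - w"] by auto
  then show "nu M S q v = nu M S q w" by (auto simp: mem_nu_iff)
qed

lemma nu_zero: "nu M S q 0 = tan_sub M S q"
  by (auto simp: mem_nu_iff)

lemma nu_in_fibre: "v \<in> tangent_space M q \<Longrightarrow> nu M S q v \<in> normal_fibre M S q"
  by (simp add: normal_fibre_def)

lemma nu_star_cotangent:
  assumes "\<xi> \<in> conormal_fibre M S q"
  shows "nu_star M S q \<xi> \<in> cotangent_space M q"
    and "v \<in> tangent_space M q \<Longrightarrow> nu_star M S q \<xi> v = \<xi> (nu M S q v)"
  using assms subspace_tangent_space[of M q]
  by (auto simp: nu_star_def conormal_fibre_def cotangent_space_def dual_space_def linear_over_def
      zero_ext_def subspace_def)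

lemma conormal_outside: "\<xi> \<in> conormal_fibre M S q \<Longrightarrow> c \<notin> normal_fibre M S q \<Longrightarrow> \<xi> c = 0"
  by (simp add: conormal_fibre_def)

lemma conormal_scale:
  "\<xi> \<in> conormal_fibre M S q \<Longrightarrow> v \<in> tangent_space M q \<Longrightarrow> \<xi> (nu M S q (t *\<^sub>R v)) = t * \<xi> (nu M S q v)"
  by (simp add: conormal_fibre_def linear_over_def)

lemma conormal_tan_sub:
  "\<xi> \<in> conormal_fibre M S q \<Longrightarrow> \<xi> (tan_sub M S q) = 0"
  using conormal_scale[of \<xi> q 0 0] subspace_0[OF subspace_tangent_space[of M q]] by (simp add: nu_zero)

lemma conormal_eqI:
  assumes "\<xi> \<in> conormal_fibre M S q" "\<zeta> \<in> conormal_fibre M S q"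
    and "\<And>v. v \<in> tangent_space M q \<Longrightarrow> \<xi> (nu M S q v) = \<zeta> (nu M S q v)"
  shows "\<xi> = \<zeta>"
proof
  fix c show "\<xi> c = \<zeta> c"
    using assms(3) conormal_outside[OF assms(1)] conormal_outside[OF assms(2)]
    by (cases "c \<in> normal_fibre M S q") (auto simp: normal_fibre_def)
qed

text \<open>Surjectivity of \<open>nu_star\<close> onto the covectors killing the tangent space of
  \<open>S\<close>: such an \<open>a\<close> is constant on cosets, so evaluating it on chosen
  representatives gives a preimage.\<close>

lemma nu_star_inv_apply:
  assumes q: "q \<in> points S" and a: "a \<in> cotangent_space M q" and z: "\<And>s. s \<in> tan_sub M S q \<Longrightarrow> a s = 0"
    and v: "v \<in> tangent_space M q"
  shows "nu_star_inv M S q a (nu M S q v) = a v"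
proof -
  define \<xi> where "\<xi> c = (if c \<in> normal_fibre M S q then a (SOME v. v \<in> tangent_space M q \<and> nu M S q v = c) else 0)" for c
  have \<xi>: "\<xi> (nu M S q v) = a v" if v: "v \<in> tangent_space M q" for v
  proof -
    let ?w = "SOME w. w \<in> tangent_space M q \<and> nu M S q w = nu M S q v"
    have w: "?w \<in> tangent_space M q \<and> nu M S q ?w = nu M S q v"
      by (rule someI[of _ v]) (simp add: v)
    then have "?w - v \<in> tan_sub M S q" using nu_eq_iff by blast
    then have "a (?w - v) = 0" by (rule z)
    then have "a ?w = a v" using cotangent_linear(2)[OF a _ v] w by simp
    then show ?thesis using nu_in_fibre[OF v] by (simp add: \<xi>_def)
  qed
  have "linear_over (tangent_space M q) (\<lambda>v. \<xi> (nu M S q v))"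
    using subspace_add[OF subspace_tangent_space[of M q]] subspace_scale[OF subspace_tangent_space[of M q]]
      cotangent_linear(1)[OF a] cotangent_scale[OF a]
    by (simp add: linear_over_def \<xi>)
  then have \<xi>c: "\<xi> \<in> conormal_fibre M S q" by (simp add: conormal_fibre_def \<xi>_def)
  have "nu_star M S q \<xi> = a"
    by (rule cotangent_eqI[OF nu_star_cotangent(1)[OF \<xi>c] a]) (simp add: nu_star_cotangent(2)[OF \<xi>c] \<xi>)
  then have im: "a \<in> nu_star M S q ` conormal_fibre M S q" using \<xi>c by blast
  have c: "nu_star_inv M S q a \<in> conormal_fibre M S q"
    unfolding nu_star_inv_def by (rule inv_into_into[OF im])
  have "nu_star M S q (nu_star_inv M S q a) = a"
    unfolding nu_star_inv_def by (rule f_inv_into_f[OF im])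
  then show ?thesis using nu_star_cotangent(2)[OF c v] by simp
qed

text \<open>For \<open>t = 0\<close> the summand from \<open>tan_sub M S q\<close> in
  \<open>scale_normal\<close> is what makes the result the whole zero coset instead of the single
  vector 0.\<close>

lemma scale_normal_nu: "scale_normal M S t (q, nu M S q v) = (q, nu M S q (t *\<^sub>R v))"
proof -
  note s = subspace_tan_sub[OF emb, of q]
  have "w \<in> {t *\<^sub>R x + s |x s. x \<in> nu M S q v \<and> s \<in> tan_sub M S q} \<longleftrightarrow> w \<in> nu M S q (t *\<^sub>R v)" for w
  proof
    assume "w \<in> {t *\<^sub>R x + s |x s. x \<in> nu M S q v \<and> s \<in> tan_sub M S q}"
    then obtain x s' where x: "w = t *\<^sub>R x + s'" "x - v \<in> tan_sub M S q" "s' \<in> tan_sub M S q"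
      by (auto simp: mem_nu_iff)
    have "w - t *\<^sub>R v = t *\<^sub>R (x - v) + s'" using x(1) by (simp add: scaleR_diff_right)
    then show "w \<in> nu M S q (t *\<^sub>R v)"
      using subspace_add[OF s subspace_scale[OF s x(2)] x(3)] by (simp add: mem_nu_iff)
  next
    assume "w \<in> nu M S q (t *\<^sub>R v)"
    then have "w - t *\<^sub>R v \<in> tan_sub M S q" by (simp add: mem_nu_iff)
    moreover have "v \<in> nu M S q v" using subspace_0[OF s] by (simp add: mem_nu_iff)
    moreover have "w = t *\<^sub>R v + (w - t *\<^sub>R v)" by simp
    ultimately show "w \<in> {t *\<^sub>R x + s |x s. x \<in> nu M S q v \<and> s \<in> tan_sub M S q}" by blast
  qed
  then show ?thesis by (auto simp: scale_normal_def)
qed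

lemma points_normal_bundle: "(q, c) \<in> points (normal_bundle M S) \<longleftrightarrow> q \<in> points S \<and> c \<in> normal_fibre M S q"
  by (simp add: normal_bundle_def)

lemma normal_point_cases:
  assumes "z \<in> points (normal_bundle M S)"
  obtains q v where "z = (q, nu M S q v)" "q \<in> points S" "v \<in> tangent_space M q"
  using assms by (auto simp: normal_bundle_def normal_fibre_def)

lemma scale_normal_point:
  "z \<in> points (normal_bundle M S) \<Longrightarrow> scale_normal M S t z \<in> points (normal_bundle M S)"
  by (erule normal_point_cases)
    (simp add: scale_normal_nu points_normal_bundle nu_in_fibre subspace_scale[OF subspace_tangent_space])

lemma scale_normal_scale:
  "z \<in> points (normal_bundle M S) \<Longrightarrow> scale_normal M S s (scale_normal M S t z) = scale_normal M S (s * t) z"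
  by (erule normal_point_cases) (simp add: scale_normal_nu)

lemma scale_normal_one: "z \<in> points (normal_bundle M S) \<Longrightarrow> scale_normal M S 1 z = z"
  by (erule normal_point_cases) (simp add: scale_normal_nu)

lemma scale_normal_zero:
  "(q, c) \<in> points (normal_bundle M S) \<Longrightarrow> scale_normal M S 0 (q, c) = zero_normal M S q"
  by (erule normal_point_cases) (simp add: scale_normal_nu nu_zero zero_normal_def)

section \<open>The trivialisation of the normal bundle over an adapted chart\<close>

context
  fixes U :: "'a set" and \<phi> :: "'a \<Rightarrow> 'v"
  assumes a: "(U, \<phi>) \<in> adapted_charts M S"
begin

abbreviation normal_dom where "normal_dom \<equiv> fst (normal_chart M S (U, \<phi>))"
abbreviation normal_map where "normal_map \<equiv> snd (normal_chart M S (U, \<phi>))"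

lemmas adapted_chart = adapted_charts_facts[OF emb a]

lemma normal_dom: "(q, c) \<in> normal_dom \<longleftrightarrow> q \<in> U \<inter> points S \<and> c \<in> normal_fibre M S q"
  by (simp add: normal_chart_def)

text \<open>The description in \<open>normal_chart\<close> is well defined: the difference of two
  candidates lies in \<open>model S\<close>, since its coordinate vector is tangent to
  \<open>S\<close>, and is also orthogonal to \<open>model S\<close>.\<close>

lemma normal_map_nu:
  assumes q: "q \<in> U" "q \<in> points S" and y: "y \<in> model M" "\<And>w. w \<in> model S \<Longrightarrow> orthogonal y w"
  shows "normal_map (q, nu M S q (coord_vec M (U, \<phi>) q y)) = \<phi> q + y"
proof -
  note M = ambient_premanifold[OF emb]
  let ?Q = "\<lambda>y'. y' \<in> model M \<and> (\<forall>w\<in>model S. orthogonal y' w) \<and>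
      coord_vec M (U, \<phi>) q y' \<in> nu M S q (coord_vec M (U, \<phi>) q y)"
  have "(THE y'. ?Q y') = y"
  proof (rule the_equality)
    show "?Q y" using y subspace_0[OF subspace_tan_sub[OF emb, of q]] by (simp add: mem_nu_iff)
    fix y' assume y': "?Q y'"
    have d: "y' - y \<in> model M" using y y' subspace_diff[OF model_subspace[OF M]] by blast
    have "coord_vec M (U, \<phi>) q y' = coord_vec M (U, \<phi>) q (y' - y) + coord_vec M (U, \<phi>) q y"
      using coord_vec_linear(1)[OF M adapted_chart(1) q(1) d y(1)] by simp
    then have "coord_vec M (U, \<phi>) q (y' - y) \<in> tan_sub M S q" using y' by (simp add: mem_nu_iff)
    then have "y' - y \<in> model S" using coord_vec_tan_sub[OF emb a q d] by blast
    then have "orthogonal (y' - y) (y' - y)" using y y' by (auto simp: orthogonal_def inner_diff_left)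
    then show "y' = y" by (simp add: orthogonal_def)
  qed
  then show ?thesis by (simp add: normal_chart_def)
qed

text \<open>Removing from the coordinates of a representative their projection to
  \<open>model S\<close> changes the vector by one tangent to \<open>S\<close>, hence leaves its
  coset unchanged.\<close>

lemma normal_rep:
  assumes q: "q \<in> U" "q \<in> points S" and c: "c \<in> normal_fibre M S q"
  obtains y where "y \<in> model M" "\<And>w. w \<in> model S \<Longrightarrow> orthogonal y w"
    "c = nu M S q (coord_vec M (U, \<phi>) q y)"
proof -
  note M = ambient_premanifold[OF emb] and WS = model_subspace[OF sub_premanifold[OF emb]]
  obtain v where v: "v \<in> tangent_space M q" "c = nu M S q v" using c by (auto simp: normal_fibre_def)
  define u where "u = vec_coords (U, \<phi>) v"
  let ?w = "oproj (model S) u"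
  have u: "u \<in> model M" unfolding u_def by (rule vec_coords_in_model[OF M adapted_chart(1) q(1) v(1)])
  have w: "?w \<in> model S" "?w \<in> model M" using oproj_in[OF WS] sub_model[OF emb] by blast+
  have y: "u - ?w \<in> model M" by (rule subspace_diff[OF model_subspace[OF M] u w(2)])
  have "coord_vec M (U, \<phi>) q u = coord_vec M (U, \<phi>) q ?w + coord_vec M (U, \<phi>) q (u - ?w)"
    using coord_vec_linear(1)[OF M adapted_chart(1) q(1) w(2) y] by simp
  moreover have "coord_vec M (U, \<phi>) q u = v"
    unfolding u_def by (rule coord_vec_vec_coords[OF M adapted_chart(1) q(1) v(1)])
  moreover have "coord_vec M (U, \<phi>) q ?w \<in> tan_sub M S q"
    using coord_vec_tan_sub[OF emb a q w(2)] w(1) by blast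
  ultimately have "nu M S q v = nu M S q (coord_vec M (U, \<phi>) q (u - ?w))"
    by (simp add: nu_eq_iff)
  then show ?thesis using that[OF y oproj_orthogonal[OF WS]] v(2) by simp
qed

text \<open>A chart value is \<phi> q + y with \<phi> q in \<open>model S\<close> and y orthogonal
  to it, so the projection separates the base point from the fibre coordinate.\<close>

lemma normal_map_inverse:
  assumes "z \<in> normal_dom"
  defines "u \<equiv> normal_map z"
  shows "oproj (model S) u = \<phi> (fst z)" "u \<in> model M"
    "snd z = nu M S (fst z) (coord_vec M (U, \<phi>) (fst z) (u - oproj (model S) u))"
    "inv_into (U \<inter> points S) \<phi> (oproj (model S) u) = fst z"
proof -
  note M = ambient_premanifold[OF emb] and WS = model_subspace[OF sub_premanifold[OF emb]]
  obtain q c where z: "z = (q, c)" by (cases z)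
  then have q: "q \<in> U" "q \<in> points S" and c: "c \<in> normal_fibre M S q" using assms(1) normal_dom by auto
  obtain y where y: "y \<in> model M" "\<And>w. w \<in> model S \<Longrightarrow> orthogonal y w"
    "c = nu M S q (coord_vec M (U, \<phi>) q y)" by (rule normal_rep[OF q c]) (rule that; assumption)
  have u: "u = \<phi> q + y" unfolding u_def z y(3) by (rule normal_map_nu[OF q y(1,2)])
  have \<phi>q: "\<phi> q \<in> model S" using charts_chart_on(4)[OF adapted_chart(2)] q by blast
  show 1: "oproj (model S) u = \<phi> (fst z)"
    unfolding u z fst_conv by (rule oproj_add_orthogonal[OF WS \<phi>q y(2)])
  show "u \<in> model M" unfolding u using \<phi>q sub_model[OF emb] y(1) by (intro subspace_add[OF model_subspace[OF M]]) auto
  show "snd z = nu M S (fst z) (coord_vec M (U, \<phi>) (fst z) (u - oproj (model S) u))"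
    unfolding 1 unfolding u z by (simp add: y(3))
  show "inv_into (U \<inter> points S) \<phi> (oproj (model S) u) = fst z"
    unfolding 1 using inv_into_f_f[OF charts_chart_on(2)[OF adapted_chart(2)]] q z by simp
qed

lemma inj_on_normal_map: "inj_on normal_map normal_dom"
proof (rule inj_onI)
  fix z z' assume *: "z \<in> normal_dom" "z' \<in> normal_dom" "normal_map z = normal_map z'"
  have "fst z = fst z'" using normal_map_inverse(4)[OF *(1)] normal_map_inverse(4)[OF *(2)] *(3) by simp
  moreover have "snd z = snd z'" using normal_map_inverse(3)[OF *(1)] normal_map_inverse(3)[OF *(2)] *(3) calculation by simp
  ultimately show "z = z'" by (rule prod_eqI)
qed

lemma normal_map_image:
  "normal_map ` normal_dom = {u \<in> model M. oproj (model S) u \<in> \<phi> ` (U \<inter> points S)}"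
proof
  show "normal_map ` normal_dom \<subseteq> {u \<in> model M. oproj (model S) u \<in> \<phi> ` (U \<inter> points S)}"
  proof
    fix u assume "u \<in> normal_map ` normal_dom"
    then obtain z where z: "z \<in> normal_dom" "u = normal_map z" by blast
    then have "fst z \<in> U \<inter> points S" using normal_dom[of "fst z" "snd z"] by simp
    then show "u \<in> {u \<in> model M. oproj (model S) u \<in> \<phi> ` (U \<inter> points S)}"
      using normal_map_inverse(1,2)[OF z(1)] z(2) by simp
  qed
  show "{u \<in> model M. oproj (model S) u \<in> \<phi> ` (U \<inter> points S)} \<subseteq> normal_map ` normal_dom"
  proof
    note M = ambient_premanifold[OF emb] and WS = model_subspace[OF sub_premanifold[OF emb]]
    fix u assume "u \<in> {u \<in> model M. oproj (model S) u \<in> \<phi> ` (U \<inter> points S)}"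
    then obtain q where u: "u \<in> model M" and q: "q \<in> U" "q \<in> points S" "oproj (model S) u = \<phi> q" by auto
    have y: "u - \<phi> q \<in> model M"
      using q oproj_in[OF WS, of u] sub_model[OF emb] by (intro subspace_diff[OF model_subspace[OF M] u]) auto
    have "normal_map (q, nu M S q (coord_vec M (U, \<phi>) q (u - \<phi> q))) = u"
      using normal_map_nu[OF q(1,2) y] oproj_orthogonal[OF WS, of _ u] q(3) by simp
    moreover have "(q, nu M S q (coord_vec M (U, \<phi>) q (u - \<phi> q))) \<in> normal_dom"
      using q nu_in_fibre[OF coord_vec_tangent[OF M adapted_chart(1) q(1) y]] by (simp add: normal_dom)
    ultimately show "u \<in> normal_map ` normal_dom" by (metis imageI)
  qed
qed

lemma normal_map_image_openin: "openin (top_of_set (model M)) (normal_map ` normal_dom)"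
proof -
  note WS = model_subspace[OF sub_premanifold[OF emb]]
  obtain T where T: "open T" "\<phi> ` (U \<inter> points S) = model S \<inter> T"
    using charts_chart_on(3)[OF adapted_chart(2)] unfolding openin_open by blast
  have "open (oproj (model S) -` T)"
    using T(1) linear_continuous_on[OF bounded_linear_oproj] by (rule open_vimage)
  moreover have "normal_map ` normal_dom = model M \<inter> oproj (model S) -` T"
    unfolding normal_map_image T(2) using oproj_in[OF WS] by auto
  ultimately show ?thesis using openin_open_Int by metis
qed

lemma chart_on_normal_chart: "chart_on (points (normal_bundle M S)) (model M) (normal_chart M S (U, \<phi>))"
proof -
  have "normal_dom \<subseteq> points (normal_bundle M S)" by (auto simp: normal_chart_def normal_bundle_def)
  then show ?thesis
    using inj_on_normal_map normal_map_image_openin unfolding chart_on_def by (simp add: case_prod_unfold)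
qed

end

lemma model_normal_bundle: "model (normal_bundle M S) = model M"
  and atlas_normal_bundle: "atlas (normal_bundle M S) = normal_chart M S ` adapted_charts M S"
  by (simp_all add: normal_bundle_def)

text \<open>A chart of the maximal atlas around every point forces the trivialisations to be compatible:
  their transition maps factor through it locally.\<close>

lemma premanifold_normal_bundle:
  assumes ex: "\<And>z. z \<in> points (normal_bundle M S) \<Longrightarrow> \<exists>(W, \<psi>)\<in>charts (normal_bundle M S). z \<in> W"
  shows "premanifold (normal_bundle M S)"
proof -
  let ?E = "normal_bundle M S"
  note V = model_subspace[OF ambient_premanifold[OF emb]]
  have co: "chart_on (points ?E) (model M) d" if "d \<in> atlas ?E" for d
    using that chart_on_normal_chart by (auto simp: atlas_normal_bundle)
  have tr: "smooth_transition (model M) d d'" if d: "d \<in> atlas ?E" and d': "d' \<in> atlas ?E" for d d'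
  proof -
    obtain W \<psi> W' \<psi>' where D: "d = (W, \<psi>)" "d' = (W', \<psi>')" by (cases d, cases d')
    have inj: "inj_on \<psi> W" "W \<subseteq> points ?E" using co[OF d] D by (auto simp: chart_on_def)
    show ?thesis unfolding D
    proof (rule smooth_transition_local[OF V inj(1)])
      fix z assume "z \<in> W \<inter> W'"
      then obtain W'' \<kappa> where c: "(W'', \<kappa>) \<in> charts ?E" "z \<in> W''" using ex inj(2) by blast
      have "smooth_transition (model M) (W, \<psi>) (W'', \<kappa>)" "smooth_transition (model M) (W'', \<kappa>) (W', \<psi>')"
        using c(1) d d' D by (auto simp: charts_def model_normal_bundle)
      then show "\<exists>W'' \<kappa>. z \<in> W'' \<and> inj_on \<kappa> W'' \<and> \<kappa> ` W'' \<subseteq> model M \<and>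
          smooth_transition (model M) (W, \<psi>) (W'', \<kappa>) \<and> smooth_transition (model M) (W'', \<kappa>) (W', \<psi>')"
        using c(2) charts_chart_on(2,4)[OF c(1)] by (auto simp: model_normal_bundle)
    qed
  qed
  have "atlas ?E \<subseteq> charts ?E" using co tr by (auto simp: charts_def model_normal_bundle)
  moreover have "(\<Union>(W, \<psi>)\<in>atlas ?E. W) = points ?E"
  proof
    show "(\<Union>(W, \<psi>)\<in>atlas ?E. W) \<subseteq> points ?E" using co by (fastforce simp: chart_on_def)
    show "points ?E \<subseteq> (\<Union>(W, \<psi>)\<in>atlas ?E. W)"
    proof
      fix z assume "z \<in> points ?E"
      then obtain q c where z: "z = (q, c)" "q \<in> points S" "c \<in> normal_fibre M S q"
        by (cases z) (auto simp: points_normal_bundle)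
      obtain U \<phi> where a: "(U, \<phi>) \<in> adapted_charts M S" "q \<in> U" by (rule adapted_chart_exists[OF emb z(2)])
      have "z \<in> fst (normal_chart M S (U, \<phi>))" using normal_dom[OF a(1)] a(2) z by simp
      moreover have "normal_chart M S (U, \<phi>) \<in> atlas ?E" using a by (auto simp: atlas_normal_bundle)
      ultimately show "z \<in> (\<Union>(W, \<psi>)\<in>atlas ?E. W)" by (intro UN_I) (auto simp: case_prod_unfold)
    qed
  qed
  ultimately show ?thesis using V by (simp add: premanifold_def model_normal_bundle)
qed

text \<open>In a trivialisation the function is \<open>f\<close> at the projected point plus the
  orthogonal part of the coordinate paired with the components \<open>?g b\<close> of the section.
  It is linear in the fibre coordinate, with coefficients that are smooth functions on
  \<open>S\<close>.\<close>

lemma smooth_aff_fun: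
  assumes E: "premanifold (normal_bundle M S)" and x: "x \<in> aff_pairs M S"
    and z: "z \<in> points (normal_bundle M S)"
  shows "smooth_fun_at (normal_bundle M S) z (aff_fun x)"
proof -
  note M = ambient_premanifold[OF emb] and S = sub_premanifold[OF emb]
  note V = model_subspace[OF M] and WS = model_subspace[OF S]
  obtain f \<xi> where x: "x = (f, \<xi>)" and f: "f \<in> smooth_funs S" and \<xi>: "\<xi> \<in> conormal_sections M S"
    using x by (auto simp: aff_pairs_def)
  obtain q c where zq: "z = (q, c)" "q \<in> points S" "c \<in> normal_fibre M S q"
    using z by (cases z) (auto simp: points_normal_bundle)
  obtain U \<phi> where a: "(U, \<phi>) \<in> adapted_charts M S" "q \<in> U" by (rule adapted_chart_exists[OF emb zq(2)])
  note c = adapted_charts_facts[OF emb a(1)]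
  let ?D = "normal_dom U \<phi>" and ?N = "normal_map U \<phi>" and ?i = "inv_into (U \<inter> points S) \<phi>"
  have "(?D, ?N) \<in> atlas (normal_bundle M S)" using a(1) by (simp add: atlas_normal_bundle)
  then have nc: "(?D, ?N) \<in> charts (normal_bundle M S)" using E by (auto simp: premanifold_def)
  have zD: "z \<in> ?D" using normal_dom[OF a(1)] zq a(2) by simp
  have op: "openin (top_of_set (model M)) (?N ` ?D)" by (rule normal_map_image_openin[OF a(1)])
  have Psm: "smooth_on (model M) (?N ` ?D) (oproj (model S))"
    by (rule smooth_on_bounded_linear[OF bounded_linear_oproj op])
  have Pim: "oproj (model S) ` (?N ` ?D) \<subseteq> \<phi> ` (U \<inter> points S)" unfolding normal_map_image[OF a(1)] by auto
  have comp: "smooth_on (model M) (?N ` ?D) (\<lambda>u. (g \<circ> ?i) (oproj (model S) u))"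
    if "\<And>x. x \<in> U \<inter> points S \<Longrightarrow> smooth_fun_at S x g" for g
    by (rule smooth_on_compose[OF V WS smooth_on_chart[OF S c(2) that] Psm Pim])
  let ?g = "\<lambda>b x. nu_star M S x (\<xi> x) (coord_vec M (U, \<phi>) x b)"
  have b: "b \<in> model M" if "b \<in> onb (model M)" for b using that onb_subset[OF V] by blast
  have g: "smooth_fun_at S x (?g b)" if x: "x \<in> U \<inter> points S" and "b \<in> onb (model M)" for x b
    using \<xi> x by (intro smooth_covec_at_apply[OF _ smooth_vec_at_coord_vec[OF emb c(1) _ _ b[OF that(2)]]])
      (auto simp: conormal_sections_def)
  have lin: "smooth_on (model M) (?N ` ?D) (\<lambda>u. (u - oproj (model S) u) \<bullet> b)" for b
    using op by (intro smooth_on_bounded_linear bounded_linear_compose[OF bounded_linear_inner_left]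
        bounded_linear_sub bounded_linear_ident bounded_linear_oproj)
  have "smooth_on (model M) (?N ` ?D) (\<lambda>u. (f \<circ> ?i) (oproj (model S) u)
      + (\<Sum>b\<in>onb (model M). ((u - oproj (model S) u) \<bullet> b) * (?g b \<circ> ?i) (oproj (model S) u)))"
    using f c(2)[THEN charts_chart_on(1)]
    by (intro smooth_on_add smooth_on_sum smooth_on_mult comp g lin op) (auto simp: smooth_funs_def)
  moreover have "(f \<circ> ?i) (oproj (model S) u)
      + (\<Sum>b\<in>onb (model M). ((u - oproj (model S) u) \<bullet> b) * (?g b \<circ> ?i) (oproj (model S) u)) =
      (aff_fun x \<circ> inv_into ?D ?N) u" if "u \<in> ?N ` ?D" for u
  proof -
    obtain w where w: "w \<in> ?D" "u = ?N w" using \<open>u \<in> ?N ` ?D\<close> by blast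
    note inv = normal_map_inverse[OF a(1) w(1), folded w(2)]
    have fw: "fst w \<in> U" "fst w \<in> points S" using w(1) normal_dom[OF a(1), of "fst w" "snd w"] by auto
    have y: "u - oproj (model S) u \<in> model M"
      using inv(2) oproj_in[OF WS] sub_model[OF emb] by (intro subspace_diff[OF V]) auto
    have \<xi>w: "\<xi> (fst w) \<in> conormal_fibre M S (fst w)" using \<xi> fw by (simp add: conormal_sections_def)
    have ct: "coord_vec M (U, \<phi>) (fst w) (u - oproj (model S) u) \<in> tangent_space M (fst w)"
      by (rule coord_vec_tangent[OF M c(1) fw(1) y])
    have "\<xi> (fst w) (snd w) = nu_star M S (fst w) (\<xi> (fst w)) (coord_vec M (U, \<phi>) (fst w) (u - oproj (model S) u))"
      using nu_star_cotangent(2)[OF \<xi>w ct] inv(3) by simp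
    also have "\<dots> = (\<Sum>b\<in>onb (model M). ((u - oproj (model S) u) \<bullet> b) * ?g b (fst w))"
      using cotangent_expansion[OF M c(1) fw(1) nu_star_cotangent(1)[OF \<xi>w] ct]
        coord_vec_coord[OF M c(1) fw(1) y] by simp
    finally have "\<xi> (fst w) (snd w) = (\<Sum>b\<in>onb (model M). ((u - oproj (model S) u) \<bullet> b) * ?g b (fst w))" .
    then show ?thesis
      using inv(4) inv_into_f_f[OF inj_on_normal_map[OF a(1)] w(1)] w(2)
      by (simp add: x aff_fun_def case_prod_unfold)
  qed
  ultimately have "smooth_on (model M) (?N ` ?D) (aff_fun x \<circ> inv_into ?D ?N)" by (rule smooth_on_eq)
  then show ?thesis
    by (intro smooth_fun_atI[OF E nc zD imageI[OF zD] subset_refl]) (simp add: model_normal_bundle)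
qed

text \<open>In the trivialisation the multiple of \<open>(q, c)\<close> by t has coordinates \<phi>
  q + t y, so fibrewise scaling is a straight line and \<open>vert\<close> is a coordinate
  vector.\<close>

lemma vert_eq_coord_vec:
  assumes E: "premanifold (normal_bundle M S)" and z: "(q, c) \<in> points (normal_bundle M S)"
  obtains W \<psi> y where "(W, \<psi>) \<in> charts (normal_bundle M S)" "zero_normal M S q \<in> W" "y \<in> model M"
    "\<And>t. inv_into W \<psi> (\<psi> (zero_normal M S q) + t *\<^sub>R y) = scale_normal M S t (q, c)"
    "vert M S (q, c) = coord_vec (normal_bundle M S) (W, \<psi>) (zero_normal M S q) y"
proof -
  note M = ambient_premanifold[OF emb] and WS = model_subspace[OF sub_premanifold[OF emb]]
  note V = model_subspace[OF M]
  have q: "q \<in> points S" "c \<in> normal_fibre M S q" using z by (auto simp: points_normal_bundle)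
  obtain U \<phi> where a: "(U, \<phi>) \<in> adapted_charts M S" "q \<in> U" by (rule adapted_chart_exists[OF emb q(1)])
  note ad = adapted_charts_facts[OF emb a(1)]
  let ?D = "normal_dom U \<phi>" and ?N = "normal_map U \<phi>"
  have "(?D, ?N) \<in> atlas (normal_bundle M S)" using a(1) by (simp add: atlas_normal_bundle)
  then have nc: "(?D, ?N) \<in> charts (normal_bundle M S)" using E by (auto simp: premanifold_def)
  obtain y where y: "y \<in> model M" "\<And>w. w \<in> model S \<Longrightarrow> orthogonal y w"
    "c = nu M S q (coord_vec M (U, \<phi>) q y)" by (rule normal_rep[OF a(1) a(2) q]) (rule that; assumption)
  have ty: "t *\<^sub>R y \<in> model M" "\<And>w. w \<in> model S \<Longrightarrow> orthogonal (t *\<^sub>R y) w" for t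
    using y subspace_scale[OF V] by (auto simp: orthogonal_def)
  have sc: "scale_normal M S t (q, c) = (q, nu M S q (coord_vec M (U, \<phi>) q (t *\<^sub>R y)))" for t
    unfolding y(3) scale_normal_nu coord_vec_linear(2)[OF M ad(1) a(2) y(1) y(1)] ..
  have N: "?N (scale_normal M S t (q, c)) = \<phi> q + t *\<^sub>R y" for t
    unfolding sc by (rule normal_map_nu[OF a(1) a(2) q(1) ty])
  have D: "scale_normal M S t (q, c) \<in> ?D" for t
    unfolding sc normal_dom[OF a(1)] using a(2) q nu_in_fibre[OF coord_vec_tangent[OF M ad(1) a(2) ty(1)]] by simp
  have z0: "scale_normal M S 0 (q, c) = zero_normal M S q" by (rule scale_normal_zero[OF z])
  have N0: "?N (zero_normal M S q) = \<phi> q" using N[of 0] z0 by simp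
  have inv: "inv_into ?D ?N (?N (zero_normal M S q) + t *\<^sub>R y) = scale_normal M S t (q, c)" for t
    unfolding N0 N[symmetric] by (rule inv_into_f_f[OF inj_on_normal_map[OF a(1)] D])
  have "vert M S (q, c) = coord_vec (normal_bundle M S) (?D, ?N) (zero_normal M S q) y"
    unfolding vert_def coord_vec_def prod.case inv fst_conv ..
  then show ?thesis using that[OF nc _ y(1) inv] D[of 0] z0 by simp
qed

lemma
  assumes E: "premanifold (normal_bundle M S)" and z: "(q, c) \<in> points (normal_bundle M S)"
  shows vert_tangent: "vert M S (q, c) \<in> tangent_space (normal_bundle M S) (zero_normal M S q)"
    and vert_derivative: "smooth_fun_at (normal_bundle M S) (zero_normal M S q) g \<Longrightarrow>
      ((\<lambda>t. g (scale_normal M S t (q, c))) has_real_derivative vert M S (q, c) g) (at 0)"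
proof -
  obtain W \<psi> y where w: "(W, \<psi>) \<in> charts (normal_bundle M S)" "zero_normal M S q \<in> W" "y \<in> model M"
    "\<And>t. inv_into W \<psi> (\<psi> (zero_normal M S q) + t *\<^sub>R y) = scale_normal M S t (q, c)"
    "vert M S (q, c) = coord_vec (normal_bundle M S) (W, \<psi>) (zero_normal M S q) y"
    by (rule vert_eq_coord_vec[OF E z]) (rule that; assumption)
  have y: "y \<in> model (normal_bundle M S)" using w(3) by (simp add: model_normal_bundle)
  show "vert M S (q, c) \<in> tangent_space (normal_bundle M S) (zero_normal M S q)"
    unfolding w(5) by (rule coord_vec_tangent[OF E w(1,2) y])
  show "((\<lambda>t. g (scale_normal M S t (q, c))) has_real_derivative vert M S (q, c) g) (at 0)"
    if "smooth_fun_at (normal_bundle M S) (zero_normal M S q) g"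
    using coord_vec_ray[OF E w(1,2) y that] unfolding w(4,5) .
qed

end

section \<open>Exponential maps\<close>

lemma conormal_sections_diff:
  assumes emb: "embedded_submanifold M S" and \<xi>: "\<xi> \<in> conormal_sections M S" and \<zeta>: "\<zeta> \<in> conormal_sections M S"
  shows "\<xi> - \<zeta> \<in> conormal_sections M S"
  unfolding conormal_sections_def
proof (intro CollectI ballI conjI)
  fix q assume q: "q \<in> points S"
  then have c: "\<xi> q \<in> conormal_fibre M S q" "\<zeta> q \<in> conormal_fibre M S q"
    and s: "smooth_covec_at M S q (nu_star_sec M S \<xi>)" "smooth_covec_at M S q (nu_star_sec M S \<zeta>)"
    using \<xi> \<zeta> by (auto simp: conormal_sections_def)
  show "(\<xi> - \<zeta>) q \<in> conormal_fibre M S q"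
    using c by (auto simp: conormal_fibre_def linear_over_def algebra_simps)
  have "nu_star_sec M S (\<xi> - \<zeta>) = (\<lambda>q. nu_star M S q (\<xi> q) - nu_star M S q (\<zeta> q))"
    by (auto simp: nu_star_def zero_ext_def fun_eq_iff)
  then show "smooth_covec_at M S q (nu_star_sec M S (\<xi> - \<zeta>))"
    using smooth_covec_at_diff[OF emb s] by simp
qed

lemma conormal_sections_zero:
  assumes emb: "embedded_submanifold M S"
  shows "0 \<in> conormal_sections M S"
  unfolding conormal_sections_def
proof (intro CollectI ballI conjI)
  fix q assume q: "q \<in> points S"
  note M = ambient_premanifold[OF emb] and S = sub_premanifold[OF emb]
  show "0 q \<in> conormal_fibre M S q" by (simp add: conormal_fibre_def linear_over_def)
  have "smooth_covec_at M S q (dfun M (\<lambda>x. 0))"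
    using q sub_points[OF emb] by (intro smooth_covec_at_dfun[OF emb q] smooth_fun_at_const[OF M]) auto
  then show "smooth_covec_at M S q (nu_star_sec M S 0)"
  proof (rule smooth_covec_at_cong[OF emb _ openin_mfd_points[OF S] q])
    fix x assume "x \<in> points S"
    then show "dfun M (\<lambda>x. 0) x = nu_star M S x (0 x)"
      using tangent_const[OF M, of _ x 0] sub_points[OF emb]
      by (auto simp: dfun_def nu_star_def zero_ext_def fun_eq_iff)
  qed
qed

text \<open>The derivative of \<open>e\<close> along the fibre at the zero section. It is a section
  of \<open>nu\<close>, and for a compatible \<open>e\<close> its values on a fibre fill the
  transversal.\<close>

definition exp_vec :: "('a, 'v::euclidean_space) mfd \<Rightarrow> ('a, 'v) mfd \<Rightarrow> ('a \<times> 'a tvec set \<Rightarrow> 'a)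
    \<Rightarrow> 'a \<Rightarrow> 'a tvec set \<Rightarrow> 'a tvec"
  where "exp_vec M S e q c = differential M e (zero_normal M S q) (vert M S (q, c))"

text \<open>An affine function carried over to the open image of \<open>e\<close>. Elsewhere
  \<open>inv_into\<close> is unspecified, which derivations at points of \<open>S\<close> cannot
  detect.\<close>

definition exp_fun :: "('a, 'v::euclidean_space) mfd \<Rightarrow> ('a, 'v) mfd \<Rightarrow> ('a \<times> 'a tvec set \<Rightarrow> 'a)
    \<Rightarrow> ('a \<Rightarrow> real) \<times> 'a conormal \<Rightarrow> 'a \<Rightarrow> real"
  where "exp_fun M S e x = aff_fun x \<circ> inv_into (points (normal_bundle M S)) e"

lemma aff_fun_add: "aff_fun (x + y) z = aff_fun x z + aff_fun y z"
  by (cases x; cases y; cases z) (simp add: aff_fun_def)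

lemma exp_fun_add: "exp_fun M S e (x + y) p = exp_fun M S e x p + exp_fun M S e y p"
  by (simp add: exp_fun_def aff_fun_add)

lemma smooth_funs_zero: "premanifold S \<Longrightarrow> 0 \<in> smooth_funs S"
  using smooth_fun_at_const[of S _ 0] by (simp add: smooth_funs_def zero_fun_def)

context
  fixes M S :: "('a, 'v::euclidean_space) mfd" and e :: "'a \<times> 'a tvec set \<Rightarrow> 'a"
  assumes emb: "embedded_submanifold M S" and ex: "exponential_map M S e"
begin

lemma
  shows exp_smooth: "\<And>z. z \<in> points (normal_bundle M S) \<Longrightarrow> smooth_map_at (normal_bundle M S) M z e"
    and exp_inj: "inj_on e (points (normal_bundle M S))"
    and exp_open: "openin (mfd_topology M) (e ` points (normal_bundle M S))"
    and exp_inv_smooth: "\<And>z. z \<in> points (normal_bundle M S) \<Longrightarrow>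
      smooth_map_at M (normal_bundle M S) (e z) (inv_into (points (normal_bundle M S)) e)"
    and exp_zero: "\<And>q. q \<in> points S \<Longrightarrow> e (zero_normal M S q) = q"
    and nu_exp_vec: "\<And>q c. (q, c) \<in> points (normal_bundle M S) \<Longrightarrow> nu M S q (exp_vec M S e q c) = c"
  using ex by (auto simp: exponential_map_def Let_def exp_vec_def)

text \<open>Smoothness of \<open>e\<close> at a point of the total space already entails a chart of
  the maximal atlas around that point, which is what \<open>premanifold_normal_bundle\<close> asks
  for.\<close>

lemma exp_premanifold: "premanifold (normal_bundle M S)"
proof (rule premanifold_normal_bundle[OF emb])
  fix z assume "z \<in> points (normal_bundle M S)"
  from exp_smooth[OF this] show "\<exists>(W, \<psi>)\<in>charts (normal_bundle M S). z \<in> W"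
    unfolding smooth_map_at_def by blast
qed

lemma zero_normal_point: "q \<in> points S \<Longrightarrow> zero_normal M S q \<in> points (normal_bundle M S)"
  using nu_in_fibre[OF emb subspace_0[OF subspace_tangent_space[of M q]], unfolded nu_zero[OF emb]]
  by (simp add: zero_normal_def points_normal_bundle[OF emb])

lemma smooth_comp_exp:
  "z \<in> points (normal_bundle M S) \<Longrightarrow> smooth_fun_at M (e z) F \<Longrightarrow> smooth_fun_at (normal_bundle M S) z (F \<circ> e)"
  by (rule smooth_fun_at_comp[OF exp_premanifold ambient_premanifold[OF emb] exp_smooth])

lemma exp_vec_tangent:
  assumes z: "(q, c) \<in> points (normal_bundle M S)"
  shows "exp_vec M S e q c \<in> tangent_space M q"
proof -
  have q: "q \<in> points S" using z by (simp add: points_normal_bundle[OF emb])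
  have "exp_vec M S e q c \<in> tangent_space M (e (zero_normal M S q))"
    unfolding exp_vec_def
    by (rule differential_tangent[OF smooth_comp_exp[OF zero_normal_point[OF q]] ambient_premanifold[OF emb]
          vert_tangent[OF emb exp_premanifold z]])
  then show ?thesis using exp_zero[OF q] by simp
qed

lemma exp_vec_vert:
  assumes z: "(q, c) \<in> points (normal_bundle M S)" and F: "smooth_fun_at M q F"
  shows "exp_vec M S e q c F = vert M S (q, c) (F \<circ> e)"
  using F exp_zero z by (simp add: exp_vec_def differential_def points_normal_bundle[OF emb])

lemma exp_vec_derivative:
  assumes z: "(q, c) \<in> points (normal_bundle M S)" and F: "smooth_fun_at M q F"
  shows "((\<lambda>t. F (e (scale_normal M S t (q, c)))) has_real_derivative exp_vec M S e q c F) (at 0)"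
proof -
  have q: "q \<in> points S" using z by (simp add: points_normal_bundle[OF emb])
  have "smooth_fun_at (normal_bundle M S) (zero_normal M S q) (F \<circ> e)"
    using smooth_comp_exp[OF zero_normal_point[OF q]] F exp_zero[OF q] by simp
  from vert_derivative[OF emb exp_premanifold z this] show ?thesis
    unfolding exp_vec_vert[OF z F] by (simp add: o_def)
qed

lemma exp_fun_exp: "z \<in> points (normal_bundle M S) \<Longrightarrow> exp_fun M S e x (e z) = aff_fun x z"
  by (simp add: exp_fun_def inv_into_f_f[OF exp_inj])

lemma smooth_exp_fun_exp:
  assumes z: "z \<in> points (normal_bundle M S)" and x: "x \<in> aff_pairs M S"
  shows "smooth_fun_at M (e z) (exp_fun M S e x)"
  unfolding exp_fun_def
  by (rule smooth_fun_at_comp[OF ambient_premanifold[OF emb] exp_premanifold exp_inv_smooth[OF z]])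
    (simp add: inv_into_f_f[OF exp_inj z] smooth_aff_fun[OF emb exp_premanifold x z])

lemma smooth_exp_fun: "q \<in> points S \<Longrightarrow> x \<in> aff_pairs M S \<Longrightarrow> smooth_fun_at M q (exp_fun M S e x)"
  using smooth_exp_fun_exp[OF zero_normal_point] exp_zero by fastforce

lemma exp_fun_sub: "q \<in> points S \<Longrightarrow> (f, \<xi>) \<in> aff_pairs M S \<Longrightarrow> exp_fun M S e (f, \<xi>) q = f q"
  using exp_fun_exp[OF zero_normal_point, of q "(f, \<xi>)"] exp_zero[of q] conormal_tan_sub[OF emb, of "\<xi> q" q]
  by (simp add: aff_fun_def zero_normal_def aff_pairs_def conormal_sections_def)

lemma aff_fun_scale:
  assumes "(f, \<xi>) \<in> aff_pairs M S" "(q, c) \<in> points (normal_bundle M S)"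
  shows "aff_fun (f, \<xi>) (scale_normal M S t (q, c)) = f q + t * \<xi> q c"
proof -
  obtain v where v: "c = nu M S q v" "v \<in> tangent_space M q" and q: "q \<in> points S"
    using assms(2) by (auto simp: points_normal_bundle[OF emb] normal_fibre_def)
  then show ?thesis
    using conormal_scale[OF emb _ v(2), of "\<xi> q" t] assms(1)
    by (simp add: scale_normal_nu[OF emb] aff_fun_def aff_pairs_def conormal_sections_def)
qed

text \<open>Along the image of the ray through \<open>(q, c)\<close> the transported function is f q
  + t \<xi> q c, and its slope is the derivative in question.\<close>

lemma exp_vec_exp_fun:
  assumes x: "(f, \<xi>) \<in> aff_pairs M S" and z: "(q, c) \<in> points (normal_bundle M S)"
  shows "exp_vec M S e q c (exp_fun M S e (f, \<xi>)) = \<xi> q c"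
proof -
  have q: "q \<in> points S" using z by (simp add: points_normal_bundle[OF emb])
  have "(\<lambda>t. exp_fun M S e (f, \<xi>) (e (scale_normal M S t (q, c)))) = (\<lambda>t. f q + t * \<xi> q c)"
    using exp_fun_exp[OF scale_normal_point[OF emb z]] aff_fun_scale[OF x z] by simp
  moreover have "((\<lambda>t. f q + t * \<xi> q c) has_real_derivative \<xi> q c) (at 0)"
    by (auto intro!: derivative_eq_intros)
  ultimately show ?thesis
    using exp_vec_derivative[OF z smooth_exp_fun[OF q x]] DERIV_unique by metis
qed

lemma tangent_minus_exp_vec:
  assumes q: "q \<in> points S" and v: "v \<in> tangent_space M q"
  shows "(q, nu M S q v) \<in> points (normal_bundle M S)"
    and "v - exp_vec M S e q (nu M S q v) \<in> tan_sub M S q"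
proof -
  show z: "(q, nu M S q v) \<in> points (normal_bundle M S)"
    using q nu_in_fibre[OF emb v] by (simp add: points_normal_bundle[OF emb])
  show "v - exp_vec M S e q (nu M S q v) \<in> tan_sub M S q"
    using nu_exp_vec[OF z] nu_eq_iff[OF emb] by metis
qed

text \<open>The tangential part of \<open>v\<close> is blind to the difference of \<open>F\<close>
  and \<open>G\<close>, so only the part determined by the coset of \<open>v\<close> counts.\<close>

lemma tangent_exp_vec_eq:
  assumes q: "q \<in> points S" and v: "v \<in> tangent_space M q"
    and FG: "smooth_fun_at M q F" "smooth_fun_at M q G" "\<And>x. x \<in> points S \<Longrightarrow> F x = G x"
  shows "v F - v G = exp_vec M S e q (nu M S q v) F - exp_vec M S e q (nu M S q v) G"
  using tan_sub_cong[OF emb q tangent_minus_exp_vec(2)[OF q v] FG(1,2) openin_mfd_points[OF sub_premanifold[OF emb]] q FG(3)]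
  by simp

lemma dfun_eq_on_sub:
  assumes q: "q \<in> points S"
    and FG: "smooth_fun_at M q F" "smooth_fun_at M q G" "\<And>x. x \<in> points S \<Longrightarrow> F x = G x"
    and eq: "\<And>c. (q, c) \<in> points (normal_bundle M S) \<Longrightarrow> exp_vec M S e q c F = exp_vec M S e q c G"
  shows "dfun M F q = dfun M G q"
proof (rule cotangent_eqI[OF dfun_cotangent dfun_cotangent])
  fix v assume v: "v \<in> tangent_space M q"
  then show "dfun M F q v = dfun M G q v"
    using tangent_exp_vec_eq[OF q v FG] eq[OF tangent_minus_exp_vec(1)[OF q v]] by (simp add: dfun_apply)
qed

lemma zero_pair: "\<xi> \<in> conormal_sections M S \<Longrightarrow> (0, \<xi>) \<in> aff_pairs M S"
  using smooth_funs_zero[OF sub_premanifold[OF emb]] by (simp add: aff_pairs_def)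

text \<open>Both covectors vanish on vectors tangent to \<open>S\<close> and agree on the vectors
  \<open>exp_vec\<close>. Since any exponential map will do, the same conormal section can be
  extended through whichever map is at hand.\<close>

lemma nu_star_eq_dfun:
  assumes \<xi>: "\<xi> \<in> conormal_sections M S" and q: "q \<in> points S"
  shows "nu_star M S q (\<xi> q) = dfun M (exp_fun M S e (0, \<xi>)) q"
proof (rule cotangent_eqI[OF _ dfun_cotangent])
  note M = ambient_premanifold[OF emb]
  have c: "\<xi> q \<in> conormal_fibre M S q" using \<xi> q by (simp add: conormal_sections_def)
  show "nu_star M S q (\<xi> q) \<in> cotangent_space M q" by (rule nu_star_cotangent(1)[OF emb c])
  fix v assume v: "v \<in> tangent_space M q"
  note z = tangent_minus_exp_vec(1)[OF q v]
  have qM: "q \<in> points M" using q sub_points[OF emb] by blast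
  have "v (exp_fun M S e (0, \<xi>)) - v (\<lambda>x. 0) =
      exp_vec M S e q (nu M S q v) (exp_fun M S e (0, \<xi>)) - exp_vec M S e q (nu M S q v) (\<lambda>x. 0)"
    by (rule tangent_exp_vec_eq[OF q v smooth_exp_fun[OF q zero_pair[OF \<xi>]] smooth_fun_at_const[OF M qM]])
      (simp add: exp_fun_sub[OF _ zero_pair[OF \<xi>]])
  then have "v (exp_fun M S e (0, \<xi>)) = \<xi> q (nu M S q v)"
    unfolding tangent_const[OF M v qM] tangent_const[OF M exp_vec_tangent[OF z] qM]
      exp_vec_exp_fun[OF zero_pair[OF \<xi>] z] by simp
  then show "nu_star M S q (\<xi> q) v = dfun M (exp_fun M S e (0, \<xi>)) q v"
    using nu_star_cotangent(2)[OF emb c v] v by (simp add: dfun_apply)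
qed

text \<open>The differential of a function vanishing on \<open>S\<close> kills the tangent space of
  \<open>S\<close>; the resulting functional on the quotient is evaluated on the representative
  \<open>exp_vec\<close> of \<open>c\<close>.\<close>

lemma nu_star_inv_dfun:
  assumes z: "(q, c) \<in> points (normal_bundle M S)"
    and F: "smooth_fun_at M q F" "\<And>x. x \<in> points S \<Longrightarrow> F x = 0"
  shows "nu_star_inv M S q (dfun M F q) c = exp_vec M S e q c F"
proof -
  note M = ambient_premanifold[OF emb]
  have q: "q \<in> points S" using z by (simp add: points_normal_bundle[OF emb])
  have qM: "q \<in> points M" using q sub_points[OF emb] by blast
  have zero: "dfun M F q s = 0" if s: "s \<in> tan_sub M S q" for s
  proof -
    have sT: "s \<in> tangent_space M q" using s tan_sub_subset[OF emb q] by blast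
    have "s F = s (\<lambda>x. 0)"
      by (rule tan_sub_cong[OF emb q s F(1) smooth_fun_at_const[OF M qM] openin_mfd_points[OF sub_premanifold[OF emb]] q F(2)])
    then show ?thesis using tangent_const[OF M sT qM, of 0] sT by (simp add: dfun_apply)
  qed
  have "nu_star_inv M S q (dfun M F q) (nu M S q (exp_vec M S e q c)) = dfun M F q (exp_vec M S e q c)"
    by (rule nu_star_inv_apply[OF emb q dfun_cotangent zero exp_vec_tangent[OF z]])
  then show ?thesis
    unfolding nu_exp_vec[OF z] dfun_apply[OF exp_vec_tangent[OF z]] .
qed

end

section \<open>The first variation on affine functions\<close>

context
  fixes M S :: "('a, 'v::euclidean_space) mfd" and P PS :: "'a \<Rightarrow> 'a bivec"
  assumes PM: "poisson_manifold M P" and PSub: "poisson_submanifold M P S PS"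
begin

text \<open>The Hamiltonian vector of \<open>f\<close> at a point of \<open>S\<close> is tangent to
  \<open>S\<close>, and for such vectors \<open>g\<close> is indistinguishable from 0.\<close>

lemma poisson_bracket_vanish:
  assumes q: "q \<in> points S" and g: "smooth_fun_at M q g" "\<And>x. x \<in> points S \<Longrightarrow> g x = 0"
  shows "poisson_bracket M P f g q = 0"
proof -
  note M = poisson_premanifold[OF PM PSub] and emb = poisson_embedded[OF PM PSub]
  have qM: "q \<in> points M" using q sub_points[OF emb] by blast
  have s: "sharp M P q (dfun M f q) \<in> tan_sub M S q" by (rule sharp_tan_sub[OF PM PSub q dfun_cotangent])
  have "sharp M P q (dfun M f q) g = sharp M P q (dfun M f q) (\<lambda>x. 0)"
    by (rule tan_sub_cong[OF emb q s g(1) smooth_fun_at_const[OF M qM] openin_mfd_points[OF sub_premanifold[OF emb]] q g(2)])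
  then show ?thesis
    using poisson_bracket_sharp[OF PM PSub g(1)] tangent_const[OF M sharp_dfun_tangent[OF PM PSub qM] qM] by simp
qed

text \<open>Inverting the rescaled map multiplies the fibre coordinate by 1/\<epsilon>, so the
  linear part of the function acquires that factor and the part pulled back from \<open>S\<close>
  does not. The bracket of \<open>H\<close> with the linear part vanishes on \<open>S\<close>, hence
  its quotient by \<epsilon> converges to its fibre derivative.\<close>

lemma first_variation_aff_fun:
  assumes ex: "exponential_map M S e" and H: "H \<in> smooth_funs M" and x: "(f, \<xi>) \<in> aff_pairs M S"
    and z: "(q, c) \<in> points (normal_bundle M S)"
  shows "first_variation M S e (hamiltonian_vf M P H) (q, c) (aff_fun (f, \<xi>)) =
    poisson_bracket M P H (exp_fun M S e (f, 0)) q
    + exp_vec M S e q c (poisson_bracket M P H (exp_fun M S e (0, \<xi>)))"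
proof -
  note M = poisson_premanifold[OF PM PSub] and emb = poisson_embedded[OF PM PSub]
  let ?E = "normal_bundle M S"
  let ?\<rho> = "\<lambda>t. scale_normal M S t (q, c)"
  let ?f = "exp_fun M S e (f, 0)" and ?\<xi> = "exp_fun M S e (0, \<xi>)"
  note E = exp_premanifold[OF emb ex]
  have q: "q \<in> points S" using z by (simp add: points_normal_bundle[OF emb])
  have fp: "(f, 0) \<in> aff_pairs M S" and \<xi>p: "(0, \<xi>) \<in> aff_pairs M S"
    using x conormal_sections_zero[OF emb] zero_pair[OF emb ex] by (auto simp: aff_pairs_def)
  have \<rho>E: "?\<rho> t \<in> points ?E" for t by (rule scale_normal_point[OF emb z])
  have inj: "inj_on (e \<circ> scale_normal M S \<epsilon>) (points ?E)" if "\<epsilon> > 0" for \<epsilon> :: real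
  proof (rule inj_onI)
    fix w w' assume w: "w \<in> points ?E" "w' \<in> points ?E"
      and eq: "(e \<circ> scale_normal M S \<epsilon>) w = (e \<circ> scale_normal M S \<epsilon>) w'"
    then have "scale_normal M S \<epsilon> w = scale_normal M S \<epsilon> w'"
      using inj_onD[OF exp_inj[OF emb ex]] scale_normal_point[OF emb] by simp
    then have "scale_normal M S (1/\<epsilon>) (scale_normal M S \<epsilon> w) = scale_normal M S (1/\<epsilon>) (scale_normal M S \<epsilon> w')"
      by simp
    then show "w = w'" using w that by (simp add: scale_normal_scale[OF emb] scale_normal_one[OF emb])
  qed
  have inv: "inv_into (points ?E) (e \<circ> scale_normal M S \<epsilon>) (e w) = scale_normal M S (1/\<epsilon>) w"
    if \<epsilon>: "\<epsilon> > 0" and w: "w \<in> points ?E" for \<epsilon> :: real and w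
  proof -
    have "(e \<circ> scale_normal M S \<epsilon>) (scale_normal M S (1/\<epsilon>) w) = e w"
      using \<epsilon> w by (simp add: scale_normal_scale[OF emb] scale_normal_one[OF emb])
    then show ?thesis
      using inv_into_f_f[OF inj[OF \<epsilon>] scale_normal_point[OF emb w]] by metis
  qed
  have val: "pullback_vf ?E (e \<circ> scale_normal M S \<epsilon>) (hamiltonian_vf M P H) (q, c) (aff_fun (f, \<xi>)) =
      poisson_bracket M P H ?f (e (?\<rho> \<epsilon>)) + poisson_bracket M P H ?\<xi> (e (?\<rho> \<epsilon>)) / \<epsilon>"
    if \<epsilon>: "\<epsilon> > 0" for \<epsilon> :: real
  proof -
    let ?p = "e (?\<rho> \<epsilon>)" and ?i = "inv_into (points ?E) (e \<circ> scale_normal M S \<epsilon>)"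
    have ip: "?i ?p = (q, c)"
      using inv[OF \<epsilon> \<rho>E] \<epsilon> z by (simp add: scale_normal_scale[OF emb] scale_normal_one[OF emb])
    note sf = smooth_exp_fun_exp[OF emb ex \<rho>E fp] and s\<xi> = smooth_exp_fun_exp[OF emb ex \<rho>E \<xi>p]
    have pM: "?p \<in> points M" by (rule smooth_fun_at_points[OF M sf])
    note t = sharp_dfun_tangent[OF PM PSub pM, of H]
    have sE: "smooth_fun_at ?E (q, c) (aff_fun (f, \<xi>))" by (rule smooth_aff_fun[OF emb E x z])
    have "pullback_vf ?E (e \<circ> scale_normal M S \<epsilon>) (hamiltonian_vf M P H) (q, c) (aff_fun (f, \<xi>)) =
        sharp M P ?p (dfun M H ?p) (aff_fun (f, \<xi>) \<circ> ?i)"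
      using sE ip by (simp add: pullback_vf_def differential_def hamiltonian_vf_def)
    also have "\<dots> = sharp M P ?p (dfun M H ?p) (\<lambda>y. ?f y + (1/\<epsilon>) * ?\<xi> y)"
    proof (rule tangent_cong[OF M t exp_open[OF emb ex]])
      show "?p \<in> e ` points ?E" using \<rho>E by blast
      fix y assume "y \<in> e ` points ?E"
      then obtain w where w: "w \<in> points ?E" "y = e w" by blast
      obtain q' c' where w': "w = (q', c')" by (cases w)
      have s: "aff_fun (f, \<xi>) (scale_normal M S (1/\<epsilon>) w) = f q' + (1/\<epsilon>) * \<xi> q' c'"
        unfolding w' by (rule aff_fun_scale[OF emb ex x w(1)[unfolded w']])
      have "aff_fun (f, 0) w = f q'" "aff_fun (0, \<xi>) w = \<xi> q' c'" by (simp_all add: w' aff_fun_def)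
      then show "(aff_fun (f, \<xi>) \<circ> ?i) y = ?f y + (1/\<epsilon>) * ?\<xi> y"
        unfolding w(2) o_apply inv[OF \<epsilon> w(1)] exp_fun_exp[OF emb ex w(1)] s by simp
    qed
    also have "\<dots> = sharp M P ?p (dfun M H ?p) ?f + (1/\<epsilon>) * sharp M P ?p (dfun M H ?p) ?\<xi>"
      unfolding tangent_add[OF t sf smooth_fun_at_cmult[OF M s\<xi>]] tangent_scale[OF t s\<xi>] ..
    finally show ?thesis
      using poisson_bracket_sharp[OF PM PSub sf] poisson_bracket_sharp[OF PM PSub s\<xi>] by simp
  qed
  have Hq: "smooth_fun_at M q H" using H q sub_points[OF emb] by (auto simp: smooth_funs_def)
  note sf = smooth_exp_fun[OF emb ex q fp] and s\<xi> = smooth_exp_fun[OF emb ex q \<xi>p]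
  note bf = smooth_poisson_bracket[OF PM PSub Hq sf] and b\<xi> = smooth_poisson_bracket[OF PM PSub Hq s\<xi>]
  have e0: "e (?\<rho> 0) = q"
    using scale_normal_zero[OF emb z] exp_zero[OF emb ex q] by simp
  have "isCont (\<lambda>t. poisson_bracket M P H ?f (e (?\<rho> t))) 0"
    by (rule DERIV_isCont[OF exp_vec_derivative[OF emb ex z bf]])
  then have "((\<lambda>t. poisson_bracket M P H ?f (e (?\<rho> t))) \<longlongrightarrow> poisson_bracket M P H ?f q) (at 0)"
    using e0 by (simp add: isCont_def)
  then have l1: "((\<lambda>t. poisson_bracket M P H ?f (e (?\<rho> t))) \<longlongrightarrow> poisson_bracket M P H ?f q) (at_right 0)"
    by (rule filterlim_mono) (simp_all add: at_le)
  have "poisson_bracket M P H ?\<xi> q = 0"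
    by (rule poisson_bracket_vanish[OF q s\<xi>]) (simp add: exp_fun_sub[OF emb ex _ \<xi>p])
  \<comment> \<open>Because the bracket vanishes at \<open>q\<close>, dividing it by
    \<open>t\<close> gives a difference quotient along the fibre.\<close>
  then have "((\<lambda>t. poisson_bracket M P H ?\<xi> (e (?\<rho> t)) / t) \<longlongrightarrow>
      exp_vec M S e q c (poisson_bracket M P H ?\<xi>)) (at 0)"
    using exp_vec_derivative[OF emb ex z b\<xi>] e0 by (simp add: DERIV_def)
  then have l2: "((\<lambda>t. poisson_bracket M P H ?\<xi> (e (?\<rho> t)) / t) \<longlongrightarrow>
      exp_vec M S e q c (poisson_bracket M P H ?\<xi>)) (at_right 0)"
    by (rule filterlim_mono) (simp_all add: at_le)
  have "((\<lambda>\<epsilon>. pullback_vf ?E (e \<circ> scale_normal M S \<epsilon>) (hamiltonian_vf M P H) (q, c) (aff_fun (f, \<xi>))) \<longlongrightarrow>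
      poisson_bracket M P H ?f q + exp_vec M S e q c (poisson_bracket M P H ?\<xi>)) (at_right 0)"
  proof (rule Lim_transform_eventually[OF tendsto_add[OF l1 l2]])
    show "\<forall>\<^sub>F \<epsilon> in at_right 0. poisson_bracket M P H ?f (e (?\<rho> \<epsilon>)) + poisson_bracket M P H ?\<xi> (e (?\<rho> \<epsilon>)) / \<epsilon> =
        pullback_vf ?E (e \<circ> scale_normal M S \<epsilon>) (hamiltonian_vf M P H) (q, c) (aff_fun (f, \<xi>))"
      using eventually_at_right_less[of "0::real"] by eventually_elim (simp add: val)
  qed
  then show ?thesis unfolding first_variation_def by (intro tendsto_Lim) simp_all
qed

end

section \<open>Brackets in terms of a compatible exponential map\<close>

text \<open>The expression called B in the overview. It depends on \<open>e\<close> both through the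
  extensions and through the vector on which the differential is evaluated.\<close>

definition exp_bracket :: "('a, 'v::euclidean_space) mfd \<Rightarrow> ('a \<Rightarrow> 'a bivec) \<Rightarrow> ('a, 'v) mfd \<Rightarrow>
    ('a \<times> 'a tvec set \<Rightarrow> 'a) \<Rightarrow> ('a \<Rightarrow> real) \<times> 'a conormal \<Rightarrow> ('a \<Rightarrow> real) \<times> 'a conormal \<Rightarrow> 'a conormal"
  where "exp_bracket M P S e x y q c =
    exp_vec M S e q c (poisson_bracket M P (exp_fun M S e x) (exp_fun M S e y))"

lemma annihilator_eqI:
  assumes emb: "embedded_submanifold M S" and q: "q \<in> points S"
    and ab: "a \<in> cotangent_space M q" "b \<in> cotangent_space M q"
    and sub: "A \<subseteq> tangent_space M q"
    and dec: "\<And>v. v \<in> tangent_space M q \<Longrightarrow> \<exists>s\<in>tan_sub M S q. \<exists>l\<in>A. v = s + l"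
    and "\<And>s. s \<in> tan_sub M S q \<Longrightarrow> a s = b s" "\<And>l. l \<in> A \<Longrightarrow> a l = b l"
  shows "a = b"
proof (rule cotangent_eqI[OF ab])
  fix v assume "v \<in> tangent_space M q"
  then obtain s l where sl: "s \<in> tan_sub M S q" "l \<in> A" "v = s + l" using dec by blast
  then have "s \<in> tangent_space M q" "l \<in> tangent_space M q" using tan_sub_subset[OF emb q] sub by blast+
  then show "a v = b v" using assms(7,8) sl cotangent_linear(1)[OF ab(1)] cotangent_linear(1)[OF ab(2)] by simp
qed

context
  fixes M S :: "('a, 'v::euclidean_space) mfd" and P PS :: "'a \<Rightarrow> 'a bivec"
    and e :: "'a \<times> 'a tvec set \<Rightarrow> 'a"
  assumes PM: "poisson_manifold M P" and PSub: "poisson_submanifold M P S PS"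
    and ex: "exponential_map M S e"
begin

lemmas ambient = poisson_premanifold[OF PM PSub]
lemmas embedded = poisson_embedded[OF PM PSub]
lemmas submanifold = sub_premanifold[OF poisson_embedded[OF PM PSub]]

lemma exp_point_sub: "(q, c) \<in> points (normal_bundle M S) \<Longrightarrow> q \<in> points S"
  by (simp add: points_normal_bundle[OF embedded])

lemma smooth_exp_bracket:
  assumes "q \<in> points S" "x \<in> aff_pairs M S" "y \<in> aff_pairs M S"
  shows "smooth_fun_at M q (poisson_bracket M P (exp_fun M S e x) (exp_fun M S e y))"
  by (intro smooth_poisson_bracket[OF PM PSub] smooth_exp_fun[OF embedded ex] assms)

lemma exp_bracket_antisym:
  assumes xy: "x \<in> aff_pairs M S" "y \<in> aff_pairs M S" and z: "(q, c) \<in> points (normal_bundle M S)"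
  shows "exp_bracket M P S e x y q c = - exp_bracket M P S e y x q c"
proof -
  have q: "q \<in> points S" by (rule exp_point_sub[OF z])
  then have qM: "q \<in> points M" using sub_points[OF embedded] by blast
  note t = exp_vec_tangent[OF embedded ex z]
  have "exp_bracket M P S e x y q c =
      exp_vec M S e q c (\<lambda>p. - poisson_bracket M P (exp_fun M S e y) (exp_fun M S e x) p)"
    unfolding exp_bracket_def
    by (rule tangent_cong[OF ambient t openin_mfd_points[OF ambient] qM]) (rule poisson_bracket_antisym[OF PM PSub])
  then show ?thesis
    unfolding tangent_uminus[OF ambient t smooth_exp_bracket[OF q xy(2,1)]] exp_bracket_def .
qed

lemma exp_bracket_add_right:
  assumes xy: "x \<in> aff_pairs M S" "y \<in> aff_pairs M S" and w: "w \<in> aff_pairs M S"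
    and z: "(q, c) \<in> points (normal_bundle M S)"
  shows "exp_bracket M P S e w (x + y) q c = exp_bracket M P S e w x q c + exp_bracket M P S e w y q c"
proof -
  have q: "q \<in> points S" by (rule exp_point_sub[OF z])
  note t = exp_vec_tangent[OF embedded ex z]
  let ?F = "exp_fun M S e"
  have q': "q \<in> e ` points (normal_bundle M S)"
    using exp_zero[OF embedded ex q] zero_normal_point[OF embedded ex q] by force
  have "exp_bracket M P S e w (x + y) q c =
      exp_vec M S e q c (\<lambda>p. poisson_bracket M P (?F w) (?F x) p + poisson_bracket M P (?F w) (?F y) p)"
    unfolding exp_bracket_def
  \<comment> \<open>Differentiating at \<open>q\<close> requires additivity of the bracket on a
    neighbourhood, not just at \<open>q\<close>. The open image of \<open>e\<close> is one on which
    the transported functions are smooth.\<close>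
  proof (rule tangent_cong[OF ambient t exp_open[OF embedded ex] q'])
    fix p assume "p \<in> e ` points (normal_bundle M S)"
    then obtain k where k: "k \<in> points (normal_bundle M S)" "p = e k" by blast
    have s: "smooth_fun_at M p (?F x)" "smooth_fun_at M p (?F y)"
      unfolding k(2) by (rule smooth_exp_fun_exp[OF embedded ex k(1)], rule xy)+
    have eq: "?F (x + y) = (\<lambda>p. ?F x p + ?F y p)" by (rule ext) (rule exp_fun_add)
    have pM: "p \<in> points M" by (rule smooth_fun_at_points[OF ambient s(1)])
    show "poisson_bracket M P (?F w) (?F (x + y)) p =
        poisson_bracket M P (?F w) (?F x) p + poisson_bracket M P (?F w) (?F y) p"
      unfolding eq poisson_bracket_sharp[OF PM PSub smooth_fun_at_add[OF ambient s]]
        poisson_bracket_sharp[OF PM PSub s(1)] poisson_bracket_sharp[OF PM PSub s(2)]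
      by (rule tangent_add[OF sharp_dfun_tangent[OF PM PSub pM] s])
  qed
  also have "\<dots> = exp_bracket M P S e w x q c + exp_bracket M P S e w y q c"
    unfolding exp_bracket_def by (rule tangent_add[OF t smooth_exp_bracket[OF q w xy(1)] smooth_exp_bracket[OF q w xy(2)]])
  finally show ?thesis .
qed

lemma aff_pairs_add:
  assumes "x \<in> aff_pairs M S" "y \<in> aff_pairs M S"
  shows "x + y \<in> aff_pairs M S"
proof -
  obtain f \<xi> g \<zeta> where x: "x = (f, \<xi>)" "y = (g, \<zeta>)" by (cases x, cases y)
  have "f + g \<in> smooth_funs S"
    using assms smooth_fun_at_add[OF submanifold, of _ f g] unfolding x by (simp add: aff_pairs_def smooth_funs_def plus_fun_def)
  moreover have "\<xi> - (0 - \<zeta>) \<in> conormal_sections M S"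
    using assms unfolding x
    by (intro conormal_sections_diff[OF embedded] conormal_sections_zero[OF embedded]) (auto simp: aff_pairs_def)
  ultimately show ?thesis by (simp add: x aff_pairs_def)
qed

lemma exp_bracket_add_left:
  assumes "x \<in> aff_pairs M S" "y \<in> aff_pairs M S" "w \<in> aff_pairs M S"
    and "(q, c) \<in> points (normal_bundle M S)"
  shows "exp_bracket M P S e (x + y) w q c = exp_bracket M P S e x w q c + exp_bracket M P S e y w q c"
  using exp_bracket_antisym[OF aff_pairs_add[OF assms(1,2)] assms(3,4)] exp_bracket_add_right[OF assms]
    exp_bracket_antisym[OF assms(1,3,4)] exp_bracket_antisym[OF assms(2,3,4)] by simp

lemma bracket_exp_fun_sub:
  assumes q: "q \<in> points S" and x: "(f, \<xi>) \<in> aff_pairs M S" and y: "(g, \<zeta>) \<in> aff_pairs M S"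
  shows "poisson_bracket M P (exp_fun M S e (f, \<xi>)) (exp_fun M S e (g, \<zeta>)) q = poisson_bracket S PS f g q"
proof -
  have d: "dfun S (exp_fun M S e (f, \<xi>)) q = dfun S f q" if "(f, \<xi>) \<in> aff_pairs M S" for f \<xi>
    by (rule dfun_cong[OF submanifold openin_mfd_points[OF submanifold] q]) (rule exp_fun_sub[OF embedded ex _ that])
  show ?thesis
    unfolding poisson_bracket_restrict[OF PM PSub q smooth_exp_fun[OF embedded ex q x] smooth_exp_fun[OF embedded ex q y]]
    by (simp add: poisson_bracket_def d[OF x] d[OF y])
qed

text \<open>\<open>poisson_submanifold\<close> describes \<open>PS\<close> pointwise. Smoothness is
  inherited from \<open>M\<close>: along \<open>S\<close> the bracket is the restriction of the
  bracket of two transported functions.\<close>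

lemma smooth_funs_sub_bracket:
  assumes f: "f \<in> smooth_funs S" and g: "g \<in> smooth_funs S"
  shows "poisson_bracket S PS f g \<in> smooth_funs S"
  unfolding smooth_funs_def
proof (intro CollectI ballI)
  fix q assume q: "q \<in> points S"
  have fg: "(f, 0) \<in> aff_pairs M S" "(g, 0) \<in> aff_pairs M S"
    using f g conormal_sections_zero[OF embedded] by (auto simp: aff_pairs_def)
  show "smooth_fun_at S q (poisson_bracket S PS f g)"
    by (rule smooth_fun_at_cong[OF submanifold smooth_fun_at_restrict[OF embedded smooth_exp_bracket[OF q fg] q]
          openin_mfd_points[OF submanifold] q]) (rule bracket_exp_fun_sub[OF _ fg])
qed

text \<open>The bracket with a function vanishing on \<open>S\<close> again vanishes on
  \<open>S\<close>; this is the ideal property of the conormal sections, and it makes the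
  differential accessible to \<open>nu_star_inv_dfun\<close>. The free argument \<open>a\<close>
  covers both the fibrewise bracket and the covariant derivative.\<close>

lemma nu_star_inv_bracket:
  assumes x: "(f, \<xi>) \<in> aff_pairs M S" and \<zeta>: "\<zeta> \<in> conormal_sections M S"
    and z: "(q, c) \<in> points (normal_bundle M S)"
    and a: "\<And>q. q \<in> points S \<Longrightarrow> a q = dfun M (exp_fun M S e (f, \<xi>)) q"
  shows "nu_star_inv M S q (restricted_bracket M P S a (nu_star_sec M S \<zeta>) q) c =
    exp_bracket M P S e (f, \<xi>) (0, \<zeta>) q c"
proof -
  note y = zero_pair[OF embedded ex \<zeta>]
  have q: "q \<in> points S" by (rule exp_point_sub[OF z])
  have b: "nu_star M S q (\<zeta> q) = dfun M (exp_fun M S e (0, \<zeta>)) q" if "q \<in> points S" for q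
    by (rule nu_star_eq_dfun[OF embedded ex \<zeta> that])
  have r: "restricted_bracket M P S a (nu_star_sec M S \<zeta>) q =
      dfun M (poisson_bracket M P (exp_fun M S e (f, \<xi>)) (exp_fun M S e (0, \<zeta>))) q"
    by (rule restricted_bracket_exact[OF PM PSub q smooth_exp_fun[OF embedded ex q x] smooth_exp_fun[OF embedded ex q y] a b])
  have v: "poisson_bracket M P (exp_fun M S e (f, \<xi>)) (exp_fun M S e (0, \<zeta>)) p = 0" if "p \<in> points S" for p
    by (rule poisson_bracket_vanish[OF PM PSub that smooth_exp_fun[OF embedded ex that y]])
      (simp add: exp_fun_sub[OF embedded ex _ y])
  show ?thesis
    unfolding r exp_bracket_def by (rule nu_star_inv_dfun[OF embedded ex z smooth_exp_bracket[OF q x y] v])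
qed

lemma conormal_bracket_eq:
  assumes "\<xi> \<in> conormal_sections M S" "\<zeta> \<in> conormal_sections M S" "(q, c) \<in> points (normal_bundle M S)"
  shows "conormal_bracket M P S \<xi> \<zeta> q c = exp_bracket M P S e (0, \<xi>) (0, \<zeta>) q c"
  unfolding conormal_bracket_def
  by (rule nu_star_inv_bracket[OF zero_pair[OF embedded ex assms(1)] assms(2,3)])
    (rule nu_star_eq_dfun[OF embedded ex assms(1)])

text \<open>A transversal \<open>T\<close> is described by the operator \<open>\<sigma>\<close> for which the differential of
  \<open>exp_fun M S e (f, \<sigma> f)\<close> annihilates \<open>T\<close>; for the transversal compatible with \<open>e\<close> this is
  \<open>\<sigma> = 0\<close>.\<close>

context
  fixes T :: "'a \<Rightarrow> 'a tvec set" and \<sigma> :: "('a \<Rightarrow> real) \<Rightarrow> 'a conormal"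
  assumes T: "\<And>q. q \<in> points S \<Longrightarrow> T q \<subseteq> tangent_space M q"
    and dec: "\<And>q v. q \<in> points S \<Longrightarrow> v \<in> tangent_space M q \<Longrightarrow> \<exists>s\<in>tan_sub M S q. \<exists>l\<in>T q. v = s + l"
    and \<sigma>: "\<And>f. f \<in> smooth_funs S \<Longrightarrow> \<sigma> f \<in> conormal_sections M S"
    and ann: "\<And>f q l. f \<in> smooth_funs S \<Longrightarrow> q \<in> points S \<Longrightarrow> l \<in> T q \<Longrightarrow> l (exp_fun M S e (f, \<sigma> f)) = 0"
begin

lemma shift_pair: "f \<in> smooth_funs S \<Longrightarrow> (f, \<sigma> f) \<in> aff_pairs M S"
  using \<sigma> by (simp add: aff_pairs_def)

text \<open>The differential of the transported f \<oplus> \<sigma> f has both defining properties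
  of the lift, and a covector is determined by its restrictions to \<open>tan_sub M S q\<close> and
  \<open>T q\<close>, which together span.\<close>

lemma transv_lift_eq:
  assumes f: "f \<in> smooth_funs S" and q: "q \<in> points S"
  shows "transv_lift M S T (dfun S f) q = dfun M (exp_fun M S e (f, \<sigma> f)) q"
proof -
  let ?F = "exp_fun M S e (f, \<sigma> f)"
  note x = shift_pair[OF f]
  have 1: "dfun M ?F q \<in> annihilator M q (T q)"
    using dfun_cotangent ann[OF f q] dfun_apply[of _ M q ?F] T[OF q] by (auto simp: annihilator_def)
  have "restrict_covec M S q (dfun M ?F q) = dfun S ?F q"
    by (rule restrict_covec_dfun[OF embedded q smooth_exp_fun[OF embedded ex q x]])
  also have "\<dots> = dfun S f q"
    by (rule dfun_cong[OF submanifold openin_mfd_points[OF submanifold] q]) (rule exp_fun_sub[OF embedded ex _ x])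
  finally have 2: "restrict_covec M S q (dfun M ?F q) = dfun S f q" .
  show ?thesis unfolding transv_lift_def
  proof (rule the_equality)
    show "dfun M ?F q \<in> annihilator M q (T q) \<and> restrict_covec M S q (dfun M ?F q) = dfun S f q"
      using 1 2 by blast
    fix a assume a: "a \<in> annihilator M q (T q) \<and> restrict_covec M S q a = dfun S f q"
    show "a = dfun M ?F q"
    proof (rule annihilator_eqI[OF embedded q _ dfun_cotangent T[OF q] dec[OF q]])
      show "a \<in> cotangent_space M q" using a by (simp add: annihilator_def)
      show "a l = dfun M ?F q l" if "l \<in> T q" for l using a 1 that by (simp add: annihilator_def)
      fix s assume "s \<in> tan_sub M S q"
      then obtain w where w: "w \<in> tangent_space S q" "s = incl M q w" by (auto simp: tan_sub_def)
      have "restrict_covec M S q a w = restrict_covec M S q (dfun M ?F q) w" using a 2 by simp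
      then show "a s = dfun M ?F q s" using w by (simp add: restrict_covec_def zero_ext_def)
    qed
  qed
qed

text \<open>Subtracting from \<open>F\<close> the transported function that has the same values on
  \<open>S\<close> and a differential annihilating \<open>T\<close> leaves a function vanishing on
  \<open>S\<close>. This realises the splitting of dF between the two annihilators.\<close>

lemma transv_proj_eq:
  assumes k: "k \<in> smooth_funs S" and q: "q \<in> points S"
    and F: "smooth_fun_at M q F" "\<And>x. x \<in> points S \<Longrightarrow> F x = k x"
  shows "transv_proj M S T q (dfun M F q) = dfun M (\<lambda>x. F x - exp_fun M S e (k, \<sigma> k) x) q"
proof -
  let ?K = "exp_fun M S e (k, \<sigma> k)"
  let ?D = "\<lambda>x. F x - ?K x"
  note x = shift_pair[OF k]
  have qM: "q \<in> points M" using q sub_points[OF embedded] by blast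
  note sK = smooth_exp_fun[OF embedded ex q x]
  note sD = smooth_fun_at_diff[OF ambient F(1) sK]
  have D: "dfun M ?D q v = dfun M F q v - dfun M ?K q v" if "v \<in> tangent_space M q" for v
    using tangent_diff[OF ambient that F(1) sK] that by (simp add: dfun_apply)
  have K: "dfun M ?K q l = 0" if "l \<in> T q" for l
    using ann[OF k q that] T[OF q] that by (auto simp: dfun_apply subset_iff)
  have 1: "dfun M ?D q s = 0" if s: "s \<in> tan_sub M S q" for s
  proof -
    have sT: "s \<in> tangent_space M q" using s tan_sub_subset[OF embedded q] by blast
    have "s ?D = s (\<lambda>x. 0)"
      by (rule tan_sub_cong[OF embedded q s sD smooth_fun_at_const[OF ambient qM] openin_mfd_points[OF submanifold] q])
        (simp add: F(2) exp_fun_sub[OF embedded ex _ x])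
    then show ?thesis using sT tangent_const[OF ambient sT qM, of 0] by (simp add: dfun_apply)
  qed
  show ?thesis unfolding transv_proj_def
  proof (rule the_equality)
    have "dfun M F q - dfun M ?D q \<in> cotangent_space M q"
      by (rule subspace_diff[OF subspace_cotangent_space dfun_cotangent dfun_cotangent])
    then show "dfun M ?D q \<in> annihilator M q (tan_sub M S q) \<and>
        dfun M F q - dfun M ?D q \<in> annihilator M q (T q)"
      using dfun_cotangent 1 D K T[OF q] by (auto simp: annihilator_def subset_iff)
    fix b assume b: "b \<in> annihilator M q (tan_sub M S q) \<and> dfun M F q - b \<in> annihilator M q (T q)"
    show "b = dfun M ?D q"
    proof (rule annihilator_eqI[OF embedded q _ dfun_cotangent T[OF q] dec[OF q]])
      show "b \<in> cotangent_space M q" using b by (simp add: annihilator_def)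
      show "b s = dfun M ?D q s" if "s \<in> tan_sub M S q" for s
        using b 1[OF that] that by (simp add: annihilator_def)
      show "b l = dfun M ?D q l" if l: "l \<in> T q" for l
      proof -
        have "(dfun M F q - b) l = 0" using b l by (simp add: annihilator_def)
        then show ?thesis using D[of l] K[OF l] l T[OF q] by auto
      qed
    qed
  qed
qed

lemma transv_deriv_eq:
  assumes f: "f \<in> smooth_funs S" and \<xi>: "\<xi> \<in> conormal_sections M S"
    and z: "(q, c) \<in> points (normal_bundle M S)"
  shows "transv_deriv M P S T (dfun S f) \<xi> q c = exp_bracket M P S e (f, \<sigma> f) (0, \<xi>) q c"
  unfolding transv_deriv_def by (rule nu_star_inv_bracket[OF shift_pair[OF f] \<xi> z transv_lift_eq[OF f]])

text \<open>The bracket of the two lifts is the differential of a function restricting to {f, g} on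
  \<open>S\<close>. Projecting it removes the lift of d{f, g}, whose fibre component is \<sigma> {f,
  g}; this is the origin of the correction term.\<close>

lemma transv_curv_eq:
  assumes f: "f \<in> smooth_funs S" and g: "g \<in> smooth_funs S"
    and z: "(q, c) \<in> points (normal_bundle M S)"
  shows "transv_curv M P S T (dfun S f) (dfun S g) q c =
    exp_bracket M P S e (f, \<sigma> f) (g, \<sigma> g) q c - \<sigma> (poisson_bracket S PS f g) q c"
proof -
  let ?k = "poisson_bracket S PS f g"
  let ?F = "exp_fun M S e (f, \<sigma> f)" and ?G = "exp_fun M S e (g, \<sigma> g)" and ?K = "exp_fun M S e (?k, \<sigma> ?k)"
  have q: "q \<in> points S" by (rule exp_point_sub[OF z])
  note k = smooth_funs_sub_bracket[OF f g]
  note x = shift_pair[OF f] and y = shift_pair[OF g] and w = shift_pair[OF k]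
  note sF = smooth_exp_fun[OF embedded ex q x] and sG = smooth_exp_fun[OF embedded ex q y] and sK = smooth_exp_fun[OF embedded ex q w]
  note sB = smooth_exp_bracket[OF q x y]
  have r: "restricted_bracket M P S (transv_lift M S T (dfun S f)) (transv_lift M S T (dfun S g)) q =
      dfun M (poisson_bracket M P ?F ?G) q"
    by (rule restricted_bracket_exact[OF PM PSub q sF sG transv_lift_eq[OF f] transv_lift_eq[OF g]])
  have p: "transv_proj M S T q (dfun M (poisson_bracket M P ?F ?G) q) =
      dfun M (\<lambda>x. poisson_bracket M P ?F ?G x - ?K x) q"
    by (rule transv_proj_eq[OF k q sB bracket_exp_fun_sub[OF _ x y]])
  have "transv_curv M P S T (dfun S f) (dfun S g) q c =
      exp_vec M S e q c (\<lambda>x. poisson_bracket M P ?F ?G x - ?K x)"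
    unfolding transv_curv_def r p
    by (rule nu_star_inv_dfun[OF embedded ex z smooth_fun_at_diff[OF ambient sB sK]])
      (simp add: bracket_exp_fun_sub[OF _ x y] exp_fun_sub[OF embedded ex _ w])
  also have "\<dots> = exp_bracket M P S e (f, \<sigma> f) (g, \<sigma> g) q c - \<sigma> ?k q c"
    unfolding tangent_diff[OF ambient exp_vec_tangent[OF embedded ex z] sB sK] exp_vec_exp_fun[OF embedded ex w z] exp_bracket_def ..
  finally show ?thesis .
qed

end

end

section \<open>Transversals\<close>

lemma transversal_facts:
  assumes "transversal M S L" "q \<in> points S"
  shows "subspace (L q)" "L q \<subseteq> tangent_space M q" "tan_sub M S q \<inter> L q = {0}"
    "v \<in> tangent_space M q \<Longrightarrow> \<exists>s\<in>tan_sub M S q. \<exists>l\<in>L q. v = s + l"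
  using assms unfolding transversal_def by blast+

lemma smooth_vec_at_add:
  assumes emb: "embedded_submanifold M S" and X: "smooth_vec_at M S q X" and Y: "smooth_vec_at M S q Y"
  shows "smooth_vec_at M S q (\<lambda>x. X x + Y x)"
proof -
  obtain G where G: "openin (mfd_topology S) G" "q \<in> G" "\<And>x. x \<in> G \<Longrightarrow> X x \<in> tangent_space M x"
    by (rule smooth_vec_at_nhd[OF X]) (rule that; assumption)
  obtain G' where G': "openin (mfd_topology S) G'" "q \<in> G'" "\<And>x. x \<in> G' \<Longrightarrow> Y x \<in> tangent_space M x"
    by (rule smooth_vec_at_nhd[OF Y]) (rule that; assumption)
  have o: "openin (mfd_topology S) (G \<inter> G')" "q \<in> G \<inter> G'" using G G' by auto
  show ?thesis
  proof (rule smooth_vec_atI[OF o])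
    show "X x + Y x \<in> tangent_space M x" if "x \<in> G \<inter> G'" for x
      using that by (intro subspace_add[OF subspace_tangent_space] G(3) G'(3)) auto
    show "smooth_fun_at S q (\<lambda>x. (X x + Y x) f)" if "smooth_fun_at M q f" for f
      using smooth_fun_at_add[OF sub_premanifold[OF emb] smooth_vec_at_apply[OF X that] smooth_vec_at_apply[OF Y that]]
      by simp
  qed
qed

lemma smooth_vec_at_incl:
  assumes emb: "embedded_submanifold M S" and q: "q \<in> points S" and X: "smooth_vec_at S S q X"
  shows "smooth_vec_at M S q (\<lambda>x. incl M x (X x))"
proof -
  note S = sub_premanifold[OF emb]
  obtain G where G: "openin (mfd_topology S) G" "q \<in> G" "\<And>x. x \<in> G \<Longrightarrow> X x \<in> tangent_space S x"
    by (rule smooth_vec_at_nhd[OF X]) (rule that; assumption)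
  have pts: "x \<in> points S" if "x \<in> G" for x using that G(1) openin_mfd_topology[OF S] by blast
  show ?thesis
  proof (rule smooth_vec_atI[OF G(1,2)])
    show "incl M x (X x) \<in> tangent_space M x" if "x \<in> G" for x
      by (rule incl_tangent[OF emb pts[OF that] G(3)[OF that]])
    fix f assume f: "smooth_fun_at M q f"
    obtain G' where G': "openin (mfd_topology M) G'" "q \<in> G'" "\<And>x. x \<in> G' \<Longrightarrow> smooth_fun_at M x f"
      by (rule smooth_fun_at_nhd[OF ambient_premanifold[OF emb] f]) (rule that; assumption)
    show "smooth_fun_at S q (\<lambda>x. incl M x (X x) f)"
    proof (rule smooth_fun_at_cong[OF S smooth_vec_at_apply[OF X smooth_fun_at_restrict[OF emb f q]]])
      show "openin (mfd_topology S) (G' \<inter> points S)" by (rule openin_restrict[OF emb G'(1)])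
      show "q \<in> G' \<inter> points S" using G'(2) q by blast
      show "X x f = incl M x (X x) f" if "x \<in> G' \<inter> points S" for x
        using incl_apply[OF emb G'(3)] that by simp
    qed
  qed
qed

section \<open>The shifted transversal\<close>

context
  fixes M S :: "('a, 'v::euclidean_space) mfd" and L :: "'a \<Rightarrow> 'a tvec set" and \<delta> :: "'a \<Rightarrow> 'a tvec \<Rightarrow> 'a tvec"
  assumes emb: "embedded_submanifold M S" and tr: "transversal M S L" and \<delta>: "transv_morphism M S L \<delta>"
begin

lemma
  shows transv_morphism_tangent: "\<And>q l. q \<in> points S \<Longrightarrow> l \<in> L q \<Longrightarrow> \<delta> q l \<in> tangent_space S q"
    and transv_morphism_linear: "\<And>q. q \<in> points S \<Longrightarrow> linear_over (L q) (\<delta> q)"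
    and transv_morphism_smooth: "\<And>q X. q \<in> points S \<Longrightarrow> smooth_vec_at M S q X \<Longrightarrow>
      (\<And>x. x \<in> points S \<Longrightarrow> X x \<in> L x) \<Longrightarrow> smooth_vec_at S S q (\<lambda>x. \<delta> x (X x))"
  using \<delta> by (auto simp: transv_morphism_def)

lemma shift_linear:
  assumes q: "q \<in> points S" and l: "l \<in> L q" "k \<in> L q"
  shows "(l + k) + incl M q (\<delta> q (l + k)) = (l + incl M q (\<delta> q l)) + (k + incl M q (\<delta> q k))"
    "t *\<^sub>R l + incl M q (\<delta> q (t *\<^sub>R l)) = t *\<^sub>R (l + incl M q (\<delta> q l))"
  using linear_over_dual[OF transv_morphism_linear[OF q] l] incl_linear[OF emb]
  by (simp_all add: scaleR_add_right)

lemma shift_tan_sub: "q \<in> points S \<Longrightarrow> l \<in> L q \<Longrightarrow> incl M q (\<delta> q l) \<in> tan_sub M S q"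
  using transv_morphism_tangent by (auto simp: tan_sub_def)

text \<open>The decomposition rests on s + l = (s - \<delta> l) + (l + \<delta> l), with \<delta> l
  regarded in the tangent space of M: a shift along \<open>S\<close> does not change the coset
  modulo its tangent space.\<close>

lemma shift_fibre:
  assumes q: "q \<in> points S"
  shows "subspace (shift_transversal M \<delta> L q)" "shift_transversal M \<delta> L q \<subseteq> tangent_space M q"
    "tan_sub M S q \<inter> shift_transversal M \<delta> L q = {0}"
    "v \<in> tangent_space M q \<Longrightarrow> \<exists>s\<in>tan_sub M S q. \<exists>l\<in>shift_transversal M \<delta> L q. v = s + l"
proof -
  note t = transversal_facts[OF tr q]
  note ts = subspace_tan_sub[OF emb, of q]
  let ?g = "\<lambda>l. l + incl M q (\<delta> q l)"
  have g0: "?g 0 = 0" using shift_linear(2)[OF q subspace_0[OF t(1)] subspace_0[OF t(1)], of 0] by simp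
  show "subspace (shift_transversal M \<delta> L q)"
  proof (rule subspaceI)
    show "0 \<in> shift_transversal M \<delta> L q" using g0 subspace_0[OF t(1)] by (force simp: shift_transversal_def)
    show "x + y \<in> shift_transversal M \<delta> L q"
      if xy: "x \<in> shift_transversal M \<delta> L q" "y \<in> shift_transversal M \<delta> L q" for x y
    proof -
      obtain l k where lk: "l \<in> L q" "k \<in> L q" "x = ?g l" "y = ?g k"
        using xy unfolding shift_transversal_def by blast
      have "x + y = ?g (l + k)" unfolding lk(3,4) by (rule shift_linear(1)[OF q lk(1,2), symmetric])
      then show ?thesis using subspace_add[OF t(1) lk(1,2)] by (auto simp: shift_transversal_def)
    qed
    show "r *\<^sub>R x \<in> shift_transversal M \<delta> L q" if x: "x \<in> shift_transversal M \<delta> L q" for r x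
    proof -
      obtain l where l: "l \<in> L q" "x = ?g l" using x unfolding shift_transversal_def by blast
      have "r *\<^sub>R x = ?g (r *\<^sub>R l)" unfolding l(2) by (rule shift_linear(2)[OF q l(1,1), symmetric])
      then show ?thesis using subspace_scale[OF t(1) l(1)] by (auto simp: shift_transversal_def)
    qed
  qed
  show "shift_transversal M \<delta> L q \<subseteq> tangent_space M q"
  proof
    fix x assume "x \<in> shift_transversal M \<delta> L q"
    then obtain l where l: "l \<in> L q" "x = ?g l" by (auto simp: shift_transversal_def)
    have "incl M q (\<delta> q l) \<in> tangent_space M q" using shift_tan_sub[OF q l(1)] tan_sub_subset[OF emb q] by blast
    then show "x \<in> tangent_space M q"
      unfolding l(2) using l(1) t(2) by (intro subspace_add[OF subspace_tangent_space]) auto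
  qed
  show "tan_sub M S q \<inter> shift_transversal M \<delta> L q = {0}"
  proof
    show "{0} \<subseteq> tan_sub M S q \<inter> shift_transversal M \<delta> L q"
      using subspace_0[OF ts] subspace_0[OF \<open>subspace (shift_transversal M \<delta> L q)\<close>] by blast
    show "tan_sub M S q \<inter> shift_transversal M \<delta> L q \<subseteq> {0}"
    proof
      fix x assume x: "x \<in> tan_sub M S q \<inter> shift_transversal M \<delta> L q"
      then obtain l where l: "l \<in> L q" "x = ?g l" by (auto simp: shift_transversal_def)
      have "x - incl M q (\<delta> q l) \<in> tan_sub M S q"
        using x shift_tan_sub[OF q l(1)] by (intro subspace_diff[OF ts]) auto
      then have "l = 0" using l t(3) by auto
      then show "x \<in> {0}" using l(2) g0 by simp
    qed
  qed
  show "\<exists>s\<in>tan_sub M S q. \<exists>l\<in>shift_transversal M \<delta> L q. v = s + l" if v: "v \<in> tangent_space M q"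
  proof -
    obtain s l where sl: "s \<in> tan_sub M S q" "l \<in> L q" "v = s + l" using t(4)[OF v] by blast
    have "v = (s - incl M q (\<delta> q l)) + ?g l" using sl(3) by simp
    moreover have "s - incl M q (\<delta> q l) \<in> tan_sub M S q" by (rule subspace_diff[OF ts sl(1) shift_tan_sub[OF q sl(2)]])
    moreover have "?g l \<in> shift_transversal M \<delta> L q" using sl(2) by (auto simp: shift_transversal_def)
    ultimately show ?thesis by blast
  qed
qed

text \<open>The shift is linear on \<open>L q\<close> only, so a globally defined linear map
  \<open>h\<close> agreeing with it there is used to transport independence and spans. It is
  injective on \<open>L q\<close>: if l + \<delta> l = 0, then l lies both in \<open>L q\<close> and
  in the tangent space of \<open>S\<close>, hence is 0.\<close>

lemma shift_frame:
  assumes q: "q \<in> points S" and inj: "inj_on X I" and ind: "independent (X ` I)" and L: "L q = span (X ` I)"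
  defines "Y \<equiv> \<lambda>i. X i + incl M q (\<delta> q (X i))"
  shows "inj_on Y I" "independent (Y ` I)" "shift_transversal M \<delta> L q = span (Y ` I)"
proof -
  note t = transversal_facts[OF tr q] and ts = subspace_tan_sub[OF emb, of q]
  let ?g = "\<lambda>l. l + incl M q (\<delta> q l)"
  obtain h where h: "linear h" "\<And>x. x \<in> X ` I \<Longrightarrow> h x = ?g x"
    using linear_independent_extend[OF ind, of ?g] by blast
  have "subspace {l \<in> L q. h l = ?g l}"
  proof (rule subspaceI)
    show "0 \<in> {l \<in> L q. h l = ?g l}"
      using shift_linear(2)[OF q subspace_0[OF t(1)] subspace_0[OF t(1)], of 0] subspace_0[OF t(1)] linear_0[OF h(1)]
      by simp
    show "x + y \<in> {l \<in> L q. h l = ?g l}" if "x \<in> {l \<in> L q. h l = ?g l}" "y \<in> {l \<in> L q. h l = ?g l}" for x y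
      using that shift_linear(1)[OF q, of x y] subspace_add[OF t(1)] linear_add[OF h(1)] by simp
    show "r *\<^sub>R x \<in> {l \<in> L q. h l = ?g l}" if "x \<in> {l \<in> L q. h l = ?g l}" for r x
      using that shift_linear(2)[OF q, of x x r] subspace_scale[OF t(1)] linear_scale[OF h(1)] by simp
  qed
  moreover have "X ` I \<subseteq> {l \<in> L q. h l = ?g l}"
  proof
    fix x assume x: "x \<in> X ` I"
    then show "x \<in> {l \<in> L q. h l = ?g l}" using h(2)[OF x] span_base[OF x] L by simp
  qed
  ultimately have "span (X ` I) \<subseteq> {l \<in> L q. h l = ?g l}" by (rule span_minimal[rotated])
  then have hg: "h l = ?g l" if "l \<in> L q" for l using that L by blast
  have YI: "Y ` I = h ` (X ` I)" using h(2) by (auto simp: Y_def image_image)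
  have hinj: "inj_on h (span (X ` I))"
  proof (rule inj_onI)
    fix x y assume xy: "x \<in> span (X ` I)" "y \<in> span (X ` I)" "h x = h y"
    have d: "x - y \<in> L q" unfolding L by (rule span_diff[OF xy(1,2)])
    have "h (x - y) = 0" using xy(3) linear_diff[OF h(1)] by simp
    then have "x - y + incl M q (\<delta> q (x - y)) = 0" using hg[OF d] by simp
    then have "x - y = - incl M q (\<delta> q (x - y))" by (rule eq_neg_iff_add_eq_0[THEN iffD2])
    moreover have "- incl M q (\<delta> q (x - y)) \<in> tan_sub M S q" by (rule subspace_neg[OF ts shift_tan_sub[OF q d]])
    ultimately have "x - y \<in> tan_sub M S q \<inter> L q" using d by simp
    then show "x = y" using t(3) by simp
  qed
  show "independent (Y ` I)" unfolding YI by (rule linear_independent_injective_image[OF h(1) ind hinj])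
  have "inj_on h (X ` I)" using hinj span_superset by (rule inj_on_subset)
  then have "inj_on (h \<circ> X) I" using inj by (intro comp_inj_on)
  moreover have "(h \<circ> X) i = Y i" if "i \<in> I" for i using h(2) that by (simp add: Y_def)
  ultimately show "inj_on Y I" using inj_on_cong[of I "h \<circ> X" Y] by blast
  have "shift_transversal M \<delta> L q = h ` span (X ` I)" using hg L by (auto simp: shift_transversal_def)
  also have "\<dots> = span (Y ` I)" unfolding YI by (rule linear_span_image[OF h(1), symmetric])
  finally show "shift_transversal M \<delta> L q = span (Y ` I)" .
qed

lemma transversal_shift: "transversal M S (shift_transversal M \<delta> L)"
  unfolding transversal_def
proof (intro conjI ballI)
  fix q assume q: "q \<in> points S"
  note s = shift_fibre[OF q]
  show "subspace (shift_transversal M \<delta> L q)" "shift_transversal M \<delta> L q \<subseteq> tangent_space M q"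
    "tan_sub M S q \<inter> shift_transversal M \<delta> L q = {0}" by (rule s)+
  show "tangent_space M q = {s + l |s l. s \<in> tan_sub M S q \<and> l \<in> shift_transversal M \<delta> L q}"
  proof
    show "tangent_space M q \<subseteq> {s + l |s l. s \<in> tan_sub M S q \<and> l \<in> shift_transversal M \<delta> L q}"
      using s(4) by blast
    show "{s + l |s l. s \<in> tan_sub M S q \<and> l \<in> shift_transversal M \<delta> L q} \<subseteq> tangent_space M q"
      using s(2) tan_sub_subset[OF emb q] subspace_add[OF subspace_tangent_space[of M q]] by blast
  qed
next
  fix q assume q: "q \<in> points S"
  note S = sub_premanifold[OF emb]
  obtain m G and X :: "nat \<Rightarrow> 'a \<Rightarrow> 'a tvec" where *: "openin (mfd_topology S) G \<and> q \<in> G \<and>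
      (\<forall>i<m. smooth_vec_at M S q (X i)) \<and>
      (\<forall>x\<in>G. inj_on (\<lambda>i. X i x) {..<m} \<and> independent ((\<lambda>i. X i x) ` {..<m}) \<and>
              L x = span ((\<lambda>i. X i x) ` {..<m}))"
    using tr[unfolded transversal_def, THEN conjunct2, rule_format, OF q] by (elim exE) (rule that)
  then have G: "openin (mfd_topology S) G" "q \<in> G"
    and X: "\<And>i. i < m \<Longrightarrow> smooth_vec_at M S q (X i)"
    and fr: "\<And>x. x \<in> G \<Longrightarrow> inj_on (\<lambda>i. X i x) {..<m} \<and> independent ((\<lambda>i. X i x) ` {..<m}) \<and>
              L x = span ((\<lambda>i. X i x) ` {..<m})"
    by simp_all
  have pts: "x \<in> points S" if "x \<in> G" for x using that G(1) openin_mfd_topology[OF S] by blast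
  have XL: "X i x \<in> L x" if "i < m" "x \<in> G" for i x
    using fr[OF that(2)] that(1) span_superset[of "(\<lambda>i. X i x) ` {..<m}"] by auto
  define Y where "Y i x = X i x + incl M x (\<delta> x (X i x))" for i x
  have Y: "smooth_vec_at M S q (Y i)" if i: "i < m" for i
  proof -
    \<comment> \<open>The smoothness clause of \<open>transv_morphism\<close> concerns fields lying
      in \<open>L\<close> at all points of \<open>S\<close>, whereas the frame does so only on
      \<open>G\<close>; extension by 0 repairs this without changing the germ at
      \<open>q\<close>.\<close>
    define X0 where "X0 x = (if x \<in> G then X i x else 0)" for x
    have eq: "X i x = X0 x" if "x \<in> G" for x using that by (simp add: X0_def)
    have "smooth_vec_at M S q X0" by (rule smooth_vec_at_cong[OF emb X[OF i] G eq])
    moreover have "X0 x \<in> L x" if "x \<in> points S" for x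
      using XL[OF i] subspace_0[OF transversal_facts(1)[OF tr that]] by (simp add: X0_def)
    ultimately have "smooth_vec_at S S q (\<lambda>x. \<delta> x (X0 x))" using transv_morphism_smooth[OF q] by blast
    then have "smooth_vec_at M S q (\<lambda>x. X i x + incl M x (\<delta> x (X0 x)))"
      by (intro smooth_vec_at_add[OF emb X[OF i]] smooth_vec_at_incl[OF emb q])
    then show ?thesis
      by (rule smooth_vec_at_cong[OF emb _ G]) (simp add: Y_def eq)
  qed
  have "inj_on (\<lambda>i. Y i x) {..<m} \<and> independent ((\<lambda>i. Y i x) ` {..<m}) \<and>
      shift_transversal M \<delta> L x = span ((\<lambda>i. Y i x) ` {..<m})" if "x \<in> G" for x
    using shift_frame[OF pts[OF that], of "\<lambda>i. X i x" "{..<m}"] fr[OF that] unfolding Y_def by blast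
  then show "\<exists>m (X :: nat \<Rightarrow> 'a \<Rightarrow> 'a tvec) G.
       openin (mfd_topology S) G \<and> q \<in> G \<and> (\<forall>i<m. smooth_vec_at M S q (X i)) \<and>
       (\<forall>x\<in>G. inj_on (\<lambda>i. X i x) {..<m} \<and> independent ((\<lambda>i. X i x) ` {..<m}) \<and>
              shift_transversal M \<delta> L x = span ((\<lambda>i. X i x) ` {..<m}))"
    using G Y by (intro exI[of _ m] exI[of _ Y] exI[of _ G]) blast
qed

end

section \<open>A transversal with a compatible exponential map\<close>

context
  fixes M S :: "('a, 'v::euclidean_space) mfd" and L :: "'a \<Rightarrow> 'a tvec set" and e :: "'a \<times> 'a tvec set \<Rightarrow> 'a"
  assumes emb: "embedded_submanifold M S" and tr: "transversal M S L"
    and ex: "exponential_map M S e" and comp: "compatible M S e L"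
begin

lemma exp_vec_in_transversal: "(q, c) \<in> points (normal_bundle M S) \<Longrightarrow> exp_vec M S e q c \<in> L q"
  using comp by (auto simp: compatible_def exp_vec_def points_normal_bundle[OF emb])

lemma exp_vec_nu_transversal:
  assumes q: "q \<in> points S" and l: "l \<in> L q"
  shows "exp_vec M S e q (nu M S q l) = l"
proof -
  obtain c where c: "c \<in> normal_fibre M S q" "l = exp_vec M S e q c"
    using comp q l by (auto simp: compatible_def exp_vec_def)
  then show ?thesis using nu_exp_vec[OF emb ex] q by (simp add: points_normal_bundle[OF emb])
qed

text \<open>For a compatible map the vector attached to the coset of \<open>v\<close> is the
  component of \<open>v\<close> in \<open>L q\<close>. Linearity is therefore that of the projection
  along the tangent space of \<open>S\<close>, and follows from uniqueness of the
  decomposition.\<close>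

lemma exp_vec_linear:
  assumes q: "q \<in> points S" and v: "v \<in> tangent_space M q" and w: "w \<in> tangent_space M q"
  shows "exp_vec M S e q (nu M S q (v + w)) = exp_vec M S e q (nu M S q v) + exp_vec M S e q (nu M S q w)"
    "exp_vec M S e q (nu M S q (t *\<^sub>R v)) = t *\<^sub>R exp_vec M S e q (nu M S q v)"
proof -
  let ?x = "\<lambda>v. exp_vec M S e q (nu M S q v)"
  note tL = transversal_facts[OF tr q] and ts = subspace_tan_sub[OF emb, of q]
  have m: "?x v \<in> L q" "v - ?x v \<in> tan_sub M S q" if "v \<in> tangent_space M q" for v
    using exp_vec_in_transversal tangent_minus_exp_vec[OF emb ex q that] by blast+
  have vw: "v + w \<in> tangent_space M q" "t *\<^sub>R v \<in> tangent_space M q"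
    using v w by (auto intro: subspace_add[OF subspace_tangent_space] subspace_scale[OF subspace_tangent_space])
  have "?x (v + w) - (?x v + ?x w) = ((v - ?x v) + (w - ?x w)) - ((v + w) - ?x (v + w))" by simp
  also have "\<dots> \<in> tan_sub M S q" by (intro subspace_diff[OF ts] subspace_add[OF ts] m v w vw)
  finally have "?x (v + w) - (?x v + ?x w) \<in> tan_sub M S q \<inter> L q"
    using m(1)[OF v] m(1)[OF w] m(1)[OF vw(1)] subspace_diff[OF tL(1)] subspace_add[OF tL(1)] by blast
  then show "?x (v + w) = ?x v + ?x w" using tL(3) by simp
  have "?x (t *\<^sub>R v) - t *\<^sub>R ?x v = t *\<^sub>R (v - ?x v) - (t *\<^sub>R v - ?x (t *\<^sub>R v))" by (simp add: scaleR_diff_right)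
  also have "\<dots> \<in> tan_sub M S q" by (intro subspace_diff[OF ts] subspace_scale[OF ts] m v vw)
  finally have "?x (t *\<^sub>R v) - t *\<^sub>R ?x v \<in> tan_sub M S q \<inter> L q"
    using m(1)[OF v] m(1)[OF vw(2)] subspace_diff[OF tL(1)] subspace_scale[OF tL(1)] by blast
  then show "?x (t *\<^sub>R v) = t *\<^sub>R ?x v" using tL(3) by simp
qed

text \<open>\<open>exp_vec\<close> inverts \<open>nu\<close> on \<open>L q\<close>, so a functional
  on \<open>L q\<close> composed with it gives a preimage. Together with
  \<open>inj_on_transv_nu_star\<close> the adjoint becomes bijective onto the dual.\<close>

lemma conormal_transversal_ext:
  assumes q: "q \<in> points S" and a: "linear_over (L q) a"
  shows "zero_ext (L q) a \<in> transv_nu_star M S L q ` conormal_fibre M S q"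
proof -
  define \<xi> where "\<xi> c = (if c \<in> normal_fibre M S q then a (exp_vec M S e q c) else 0)" for c
  have L: "exp_vec M S e q (nu M S q v) \<in> L q" if "v \<in> tangent_space M q" for v
    using exp_vec_in_transversal tangent_minus_exp_vec(1)[OF emb ex q that] by blast
  have \<xi>v: "\<xi> (nu M S q v) = a (exp_vec M S e q (nu M S q v))" if "v \<in> tangent_space M q" for v
    using nu_in_fibre[OF emb that] by (simp add: \<xi>_def)
  have "linear_over (tangent_space M q) (\<lambda>v. \<xi> (nu M S q v))"
    unfolding linear_over_def
  proof (intro conjI ballI allI)
    fix x y assume xy: "x \<in> tangent_space M q" "y \<in> tangent_space M q"
    show "\<xi> (nu M S q (x + y)) = \<xi> (nu M S q x) + \<xi> (nu M S q y)"
      unfolding \<xi>v[OF xy(1)] \<xi>v[OF xy(2)] \<xi>v[OF subspace_add[OF subspace_tangent_space xy]] exp_vec_linear(1)[OF q xy]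
      by (rule linear_over_dual(1)[OF a L[OF xy(1)] L[OF xy(2)]])
  next
    fix t x assume x: "x \<in> tangent_space M q"
    show "\<xi> (nu M S q (t *\<^sub>R x)) = t *\<^sub>R \<xi> (nu M S q x)"
      unfolding \<xi>v[OF x] \<xi>v[OF subspace_scale[OF subspace_tangent_space x]] exp_vec_linear(2)[OF q x x]
      by (rule linear_over_dual(2)[OF a L[OF x] L[OF x]])
  qed
  then have "\<xi> \<in> conormal_fibre M S q" by (simp add: conormal_fibre_def \<xi>_def)
  moreover have "transv_nu_star M S L q \<xi> = zero_ext (L q) a"
  proof
    fix l show "transv_nu_star M S L q \<xi> l = zero_ext (L q) a l"
      using \<xi>v[of l] exp_vec_nu_transversal[OF q, of l] transversal_facts(2)[OF tr q]
      by (auto simp: transv_nu_star_def zero_ext_def)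
  qed
  ultimately show ?thesis by (metis imageI)
qed

lemma inj_on_transv_nu_star:
  assumes q: "q \<in> points S"
  shows "inj_on (transv_nu_star M S L q) (conormal_fibre M S q)"
proof (rule inj_onI)
  fix \<xi> \<zeta> assume *: "\<xi> \<in> conormal_fibre M S q" "\<zeta> \<in> conormal_fibre M S q"
    "transv_nu_star M S L q \<xi> = transv_nu_star M S L q \<zeta>"
  show "\<xi> = \<zeta>"
  proof (rule conormal_eqI[OF emb *(1,2)])
    fix v assume v: "v \<in> tangent_space M q"
    note z = tangent_minus_exp_vec(1)[OF emb ex q v]
    show "\<xi> (nu M S q v) = \<zeta> (nu M S q v)"
      using fun_cong[OF *(3), of "exp_vec M S e q (nu M S q v)"] exp_vec_in_transversal[OF z] nu_exp_vec[OF emb ex z]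
      by (simp add: transv_nu_star_def zero_ext_def)
  qed
qed

text \<open>Bijectivity of the adjoint of \<open>nu\<close> on \<open>L\<close> allows the inverse
  in \<open>determined_by\<close> to be cleared; evaluating on \<open>l\<close> then gives a
  pointwise condition free of \<open>inv_into\<close>.\<close>

lemma determined_by_iff:
  assumes \<delta>: "transv_morphism M S L \<delta>" and \<mu>: "conormal_form M S \<mu>"
  shows "determined_by M S L \<mu> \<delta> \<longleftrightarrow>
    (\<forall>q\<in>points S. \<forall>l\<in>L q. \<forall>\<alpha>\<in>cotangent_space S q. \<alpha> (\<delta> q l) = - \<mu> q \<alpha> (nu M S q l))"
proof -
  have "\<mu> q \<alpha> = - inv_into (conormal_fibre M S q) (transv_nu_star M S L q) (transv_adjoint L \<delta> q \<alpha>) \<longleftrightarrow>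
      (\<forall>l\<in>L q. \<alpha> (\<delta> q l) = - \<mu> q \<alpha> (nu M S q l))" if q: "q \<in> points S" and \<alpha>: "\<alpha> \<in> cotangent_space S q" for q \<alpha>
  proof -
    let ?A = "conormal_fibre M S q" and ?n = "transv_nu_star M S L q"
    have \<mu>c: "\<mu> q \<alpha> \<in> ?A" using \<mu> q \<alpha> by (simp add: conormal_form_def)
    then have m: "- \<mu> q \<alpha> \<in> ?A" by (auto simp: conormal_fibre_def linear_over_def)
    have "linear_over (L q) (\<lambda>l. \<alpha> (\<delta> q l))"
      using linear_over_dual[OF transv_morphism_linear[OF emb tr \<delta> q]] transv_morphism_tangent[OF emb tr \<delta> q]
        cotangent_linear(1)[OF \<alpha>] cotangent_scale[OF \<alpha>]
      unfolding linear_over_def by (simp cong: ball_cong)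
    then have im: "transv_adjoint L \<delta> q \<alpha> \<in> ?n ` ?A"
      unfolding transv_adjoint_def by (rule conormal_transversal_ext[OF q])
    have "\<mu> q \<alpha> = - inv_into ?A ?n (transv_adjoint L \<delta> q \<alpha>) \<longleftrightarrow>
        inv_into ?A ?n (transv_adjoint L \<delta> q \<alpha>) = - \<mu> q \<alpha>" by (metis minus_minus)
    also have "\<dots> \<longleftrightarrow> transv_adjoint L \<delta> q \<alpha> = ?n (- \<mu> q \<alpha>)"
      using f_inv_into_f[OF im] inv_into_f_f[OF inj_on_transv_nu_star[OF q] m] by metis
    also have "\<dots> \<longleftrightarrow> (\<forall>l\<in>L q. \<alpha> (\<delta> q l) = - \<mu> q \<alpha> (nu M S q l))"
      by (auto simp: transv_adjoint_def transv_nu_star_def zero_ext_def fun_eq_iff)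
    finally show ?thesis .
  qed
  then show ?thesis unfolding determined_by_def by blast
qed

text \<open>The morphism \<open>\<delta>\<close> determined by \<open>\<mu>\<close> sends \<open>l\<close> to the derivation
  \<open>f \<mapsto> - \<mu> (df) (\<nu> l)\<close>.\<close>

lemma ex1_transv_morphism:
  assumes \<mu>: "conormal_form M S \<mu>"
  shows "\<exists>!\<delta>. transv_morphism M S L \<delta> \<and> determined_by M S L \<mu> \<delta>"
proof -
  note S = sub_premanifold[OF emb] and Ssm = emb[unfolded embedded_submanifold_def, THEN conjunct2, THEN conjunct1]
  note embS = embedded_submanifold_refl[OF Ssm]
  have \<mu>c: "\<mu> q \<alpha> \<in> conormal_fibre M S q" if "q \<in> points S" "\<alpha> \<in> cotangent_space S q" for q \<alpha>
    using \<mu> that by (simp add: conormal_form_def)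
  have \<mu>l: "linear_over (cotangent_space S q) (\<mu> q)" if "q \<in> points S" for q
    using \<mu> that by (simp add: conormal_form_def)
  define \<delta> where "\<delta> q l = (if q \<in> points S \<and> l \<in> L q then
      (\<lambda>f. if smooth_fun_at S q f then - \<mu> q (dfun S f q) (nu M S q l) else 0) else 0)" for q l
  have \<delta>f: "\<delta> q l f = - \<mu> q (dfun S f q) (nu M S q l)" if "q \<in> points S" "l \<in> L q" "smooth_fun_at S q f" for q l f
    using that by (simp add: \<delta>_def)
  have tan: "\<delta> q l \<in> tangent_space S q" if q: "q \<in> points S" and l: "l \<in> L q" for q l
  proof (rule tangent_spaceI)
    note lin = linear_over_dual[OF \<mu>l[OF q]]
    have sc: "t *\<^sub>R dfun S f q \<in> cotangent_space S q" for t f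
      by (rule subspace_scale[OF subspace_cotangent_space dfun_cotangent])
    show "\<delta> q l f = 0" if "\<not> smooth_fun_at S q f" for f using that by (simp add: \<delta>_def)
    fix f g assume fg: "smooth_fun_at S q f" "smooth_fun_at S q g"
    show "\<delta> q l (\<lambda>x. f x + g x) = \<delta> q l f + \<delta> q l g"
      unfolding \<delta>f[OF q l fg(1)] \<delta>f[OF q l fg(2)] \<delta>f[OF q l smooth_fun_at_add[OF S fg]] dfun_add[OF S fg]
        lin(1)[OF dfun_cotangent dfun_cotangent] by simp
    show "\<delta> q l (\<lambda>x. f x * g x) = \<delta> q l f * g q + f q * \<delta> q l g"
      unfolding \<delta>f[OF q l fg(1)] \<delta>f[OF q l fg(2)] \<delta>f[OF q l smooth_fun_at_mult[OF S fg]] dfun_mult[OF fg]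
        lin(1)[OF sc sc] lin(2)[OF dfun_cotangent dfun_cotangent] by simp
  next
    fix t f assume f: "smooth_fun_at S q f"
    show "\<delta> q l (\<lambda>x. t * f x) = t * \<delta> q l f"
      unfolding \<delta>f[OF q l f] \<delta>f[OF q l smooth_fun_at_cmult[OF S f]] dfun_cmult[OF f]
        linear_over_dual(2)[OF \<mu>l[OF q] dfun_cotangent dfun_cotangent] by simp
  qed
  have lin: "linear_over (L q) (\<delta> q)" if q: "q \<in> points S" for q
  proof -
    note tL = transversal_facts[OF tr q]
    have c: "linear_over (tangent_space M q) (\<lambda>v. \<mu> q (dfun S f q) (nu M S q v))" for f
      using \<mu>c[OF q dfun_cotangent] by (simp add: conormal_fibre_def)
    show ?thesis unfolding linear_over_def
    proof (intro conjI ballI allI ext)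
      fix x y f assume xy: "x \<in> L q" "y \<in> L q"
      then have "x \<in> tangent_space M q" "y \<in> tangent_space M q" using tL(2) by blast+
      then show "\<delta> q (x + y) f = (\<delta> q x + \<delta> q y) f"
        using xy q subspace_add[OF tL(1) xy] linear_over_dual(1)[OF c[of f]] by (simp add: \<delta>_def)
    next
      fix t x f assume x: "x \<in> L q"
      then have "x \<in> tangent_space M q" using tL(2) by blast
      then show "\<delta> q (t *\<^sub>R x) f = (t *\<^sub>R \<delta> q x) f"
        using x q subspace_scale[OF tL(1) x] linear_over_dual(2)[OF c[of f]] by (simp add: \<delta>_def)
    qed
  qed
  have sm: "smooth_vec_at S S q (\<lambda>x. \<delta> x (X x))"
    if q: "q \<in> points S" and X: "smooth_vec_at M S q X" and XL: "\<forall>x\<in>points S. X x \<in> L x" for q X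
  proof (rule smooth_vec_atI[OF openin_mfd_points[OF S] q])
    show "\<delta> x (X x) \<in> tangent_space S x" if "x \<in> points S" for x using tan that XL by blast
    fix f assume f: "smooth_fun_at S q f"
    obtain G where G: "openin (mfd_topology S) G" "q \<in> G" "\<And>x. x \<in> G \<Longrightarrow> smooth_fun_at S x f"
      by (rule smooth_fun_at_nhd[OF S f]) (rule that; assumption)
    have "smooth_covec_at M S q (\<lambda>x. nu_star M S x (\<mu> x (dfun S f x)))"
      using \<mu> q smooth_covec_at_dfun[OF embS q f] by (simp add: conormal_form_def)
    then have "smooth_fun_at S q (\<lambda>x. - nu_star M S x (\<mu> x (dfun S f x)) (X x))"
      by (intro smooth_fun_at_uminus[OF S] smooth_covec_at_apply[OF _ X])
    then show "smooth_fun_at S q (\<lambda>x. \<delta> x (X x) f)"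
    proof (rule smooth_fun_at_cong[OF S _ G(1,2)])
      fix x assume x: "x \<in> G"
      then have xS: "x \<in> points S" using G(1) openin_mfd_topology[OF S] by blast
      then have "X x \<in> L x" "X x \<in> tangent_space M x" using XL transversal_facts(2)[OF tr xS] by blast+
      then show "- nu_star M S x (\<mu> x (dfun S f x)) (X x) = \<delta> x (X x) f"
        using \<delta>f[OF xS _ G(3)[OF x]] nu_star_cotangent(2)[OF emb \<mu>c[OF xS dfun_cotangent]] by simp
    qed
  qed
  have mor: "transv_morphism M S L \<delta>"
    unfolding transv_morphism_def using tan lin sm by (auto simp: \<delta>_def)
  have det: "determined_by M S L \<mu> \<delta>"
    unfolding determined_by_iff[OF mor \<mu>]
  proof (intro ballI)
    fix q l \<alpha> assume *: "q \<in> points S" "l \<in> L q" "\<alpha> \<in> cotangent_space S q"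
    obtain f where f: "smooth_fun_at S q f" "\<alpha> = dfun S f q" by (rule cotangent_eq_dfun[OF S *(1,3)])
    show "\<alpha> (\<delta> q l) = - \<mu> q \<alpha> (nu M S q l)"
      unfolding f(2) dfun_apply[OF tan[OF *(1,2)]] by (rule \<delta>f[OF *(1,2) f(1)])
  qed
  show ?thesis
  proof (rule ex1I[of _ \<delta>])
    show "transv_morphism M S L \<delta> \<and> determined_by M S L \<mu> \<delta>" using mor det by blast
    fix \<delta>' assume d: "transv_morphism M S L \<delta>' \<and> determined_by M S L \<mu> \<delta>'"
    then have mor': "transv_morphism M S L \<delta>'" by blast
    note eq' = determined_by_iff[OF mor' \<mu>, THEN iffD1, OF d[THEN conjunct2], rule_format]
    show "\<delta>' = \<delta>"
    proof (intro ext)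
      fix q l f show "\<delta>' q l f = \<delta> q l f"
      proof (cases "q \<in> points S \<and> l \<in> L q")
        case True
        then have ql: "q \<in> points S" "l \<in> L q" by auto
        note t' = transv_morphism_tangent[OF emb tr mor' ql]
        show ?thesis
        proof (cases "smooth_fun_at S q f")
          case True
          then show ?thesis using eq'[OF ql dfun_cotangent, of f] \<delta>f[OF ql True] dfun_apply[OF t', of f] by simp
        next
          case False
          then show ?thesis using tangent_not_smooth[OF t' False] tangent_not_smooth[OF tan[OF ql] False] by simp
        qed
      next
        case False
        then show ?thesis using mor' by (auto simp: transv_morphism_def \<delta>_def)
      qed
    qed
  qed
qed

end

section \<open>The Hamiltonian derivation\<close>

context
  fixes M S :: "('a, 'v::euclidean_space) mfd" and L :: "'a \<Rightarrow> 'a tvec set" and e :: "'a \<times> 'a tvec set \<Rightarrow> 'a"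
    and H :: "'a \<Rightarrow> real"
  assumes emb: "embedded_submanifold M S" and tr: "transversal M S L"
    and ex: "exponential_map M S e" and comp: "compatible M S e L" and H: "H \<in> smooth_funs M"
begin

lemma smooth_at_sub: "q \<in> points S \<Longrightarrow> smooth_fun_at M q H"
  using H sub_points[OF emb] by (auto simp: smooth_funs_def)

lemma normal_deriv_exp_vec:
  assumes z: "(q, c) \<in> points (normal_bundle M S)"
  shows "normal_deriv M S H e q c = exp_vec M S e q c H"
proof -
  have q: "q \<in> points S" "c \<in> normal_fibre M S q" using z by (auto simp: points_normal_bundle[OF emb])
  show ?thesis
    using q(2) dfun_apply[OF vert_tangent[OF emb exp_premanifold[OF emb ex] z]]
      exp_vec_vert[OF emb ex z smooth_at_sub[OF q(1)]]
    by (simp add: normal_deriv_def zero_ext_def)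
qed

lemma smooth_restrict_sub: "restrict H (points S) \<in> smooth_funs S"
  unfolding smooth_funs_def
proof (intro CollectI ballI)
  note S = sub_premanifold[OF emb]
  fix q assume q: "q \<in> points S"
  show "smooth_fun_at S q (restrict H (points S))"
    by (rule smooth_fun_at_cong[OF S smooth_fun_at_restrict[OF emb smooth_at_sub[OF q] q] openin_mfd_points[OF S] q]) simp
qed

text \<open>Linearity on fibres comes from \<open>exp_vec_linear\<close>. For smoothness, the
  section is exhibited along \<open>S\<close> as the difference of dH and the differential of the
  transported h \<oplus> 0, both of which are smooth.\<close>

lemma normal_deriv_conormal_section: "normal_deriv M S H e \<in> conormal_sections M S"
  unfolding conormal_sections_def
proof (intro CollectI ballI conjI)
  note S = sub_premanifold[OF emb] and M = ambient_premanifold[OF emb]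
  have fibre: "normal_deriv M S H e q \<in> conormal_fibre M S q" if q: "q \<in> points S" for q
  proof -
    note T = subspace_tangent_space[of M q]
    have nd: "normal_deriv M S H e q (nu M S q v) = exp_vec M S e q (nu M S q v) H" if "v \<in> tangent_space M q" for v
      by (rule normal_deriv_exp_vec[OF tangent_minus_exp_vec(1)[OF emb ex q that]])
    have "linear_over (tangent_space M q) (\<lambda>v. normal_deriv M S H e q (nu M S q v))"
      unfolding linear_over_def
      using nd subspace_add[OF T] subspace_scale[OF T] exp_vec_linear[OF emb tr ex comp q] by simp
    then show ?thesis by (simp add: conormal_fibre_def normal_deriv_def zero_ext_def)
  qed
  fix q assume q: "q \<in> points S"
  show "normal_deriv M S H e q \<in> conormal_fibre M S q" by (rule fibre[OF q])
  let ?h = "restrict H (points S)"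
  have x: "(?h, 0) \<in> aff_pairs M S"
    using smooth_restrict_sub conormal_sections_zero[OF emb] by (simp add: aff_pairs_def)
  let ?h' = "exp_fun M S e (?h, 0)"
  have "smooth_covec_at M S q (\<lambda>x. dfun M H x - dfun M ?h' x)"
    by (rule smooth_covec_at_diff[OF emb smooth_covec_at_dfun[OF emb q smooth_at_sub[OF q]]
          smooth_covec_at_dfun[OF emb q smooth_exp_fun[OF emb ex q x]]])
  then show "smooth_covec_at M S q (nu_star_sec M S (normal_deriv M S H e))"
  proof (rule smooth_covec_at_cong[OF emb _ openin_mfd_points[OF S] q])
    fix p assume p: "p \<in> points S"
    show "dfun M H p - dfun M ?h' p = nu_star M S p (normal_deriv M S H e p)"
    proof (rule cotangent_eqI)
      show "dfun M H p - dfun M ?h' p \<in> cotangent_space M p"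
        by (rule subspace_diff[OF subspace_cotangent_space dfun_cotangent dfun_cotangent])
      show "nu_star M S p (normal_deriv M S H e p) \<in> cotangent_space M p"
        by (rule nu_star_cotangent(1)[OF emb fibre[OF p]])
      fix v assume v: "v \<in> tangent_space M p"
      note z = tangent_minus_exp_vec(1)[OF emb ex p v]
      have "v H - v ?h' = exp_vec M S e p (nu M S p v) H - exp_vec M S e p (nu M S p v) ?h'"
        by (rule tangent_exp_vec_eq[OF emb ex p v smooth_at_sub[OF p] smooth_exp_fun[OF emb ex p x]])
          (simp add: exp_fun_sub[OF emb ex _ x])
      then show "(dfun M H p - dfun M ?h' p) v = nu_star M S p (normal_deriv M S H e p) v"
        using exp_vec_exp_fun[OF emb ex x z] nu_star_cotangent(2)[OF emb fibre[OF p] v]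
          normal_deriv_exp_vec[OF z] v by (simp add: dfun_apply)
    qed
  qed
qed

text \<open>\<open>H\<close> and the transported affine function agree on \<open>S\<close> and have
  the same fibre derivatives there, so h \<oplus> \<eta> encodes the whole first jet of
  \<open>H\<close> along \<open>S\<close>.\<close>

lemma dfun_eq_exp_fun:
  assumes q: "q \<in> points S"
  shows "dfun M H q = dfun M (exp_fun M S e (restrict H (points S), normal_deriv M S H e)) q"
proof -
  have x: "(restrict H (points S), normal_deriv M S H e) \<in> aff_pairs M S"
    using smooth_restrict_sub normal_deriv_conormal_section by (simp add: aff_pairs_def)
  show ?thesis
    by (rule dfun_eq_on_sub[OF emb ex q smooth_at_sub[OF q] smooth_exp_fun[OF emb ex q x]])
      (simp_all add: exp_fun_sub[OF emb ex _ x] exp_vec_exp_fun[OF emb ex x] normal_deriv_exp_vec)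
qed

end

text \<open>Both exponential maps compute the first variation through the same bracket of sections of
  the restricted cotangent bundle, which does not depend on any extension.\<close>

lemma first_variation_exp_bracket:
  assumes PM: "poisson_manifold M P" and PSub: "poisson_submanifold M P S PS"
    and H: "H \<in> smooth_funs M" and tr: "transversal M S L"
    and ex': "exponential_map M S e'" and ex: "exponential_map M S e" and comp: "compatible M S e L"
    and x: "(f, \<xi>) \<in> aff_pairs M S" and z: "(q, c) \<in> points (normal_bundle M S)"
  shows "first_variation M S e' (hamiltonian_vf M P H) (q, c) (aff_fun (f, \<xi>)) =
    poisson_bracket S PS (restrict H (points S)) f q +
    exp_bracket M P S e (restrict H (points S), normal_deriv M S H e) (0, \<xi>) q c"
proof -
  note emb = poisson_embedded[OF PM PSub]
  note M = ambient_premanifold[OF emb] and S = sub_premanifold[OF emb]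
  let ?h = "restrict H (points S)" and ?\<eta> = "normal_deriv M S H e"
  have q: "q \<in> points S" using z by (simp add: points_normal_bundle[OF emb])
  have \<xi>: "\<xi> \<in> conormal_sections M S" and fp: "(f, 0) \<in> aff_pairs M S"
    using x conormal_sections_zero[OF emb] by (auto simp: aff_pairs_def)
  have hp: "(?h, ?\<eta>) \<in> aff_pairs M S"
    using smooth_restrict_sub[OF emb tr ex comp H] normal_deriv_conormal_section[OF emb tr ex comp H]
    by (simp add: aff_pairs_def)
  note Hs = smooth_at_sub[OF emb tr ex comp H]
  let ?f = "exp_fun M S e' (f, 0)" and ?\<xi>' = "exp_fun M S e' (0, \<xi>)" and ?\<xi> = "exp_fun M S e (0, \<xi>)"
    and ?H = "exp_fun M S e (?h, ?\<eta>)"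
  note \<xi>p' = zero_pair[OF emb ex' \<xi>] and \<xi>p = zero_pair[OF emb ex \<xi>]
  note sf = smooth_exp_fun[OF emb ex' q fp] and s\<xi>' = smooth_exp_fun[OF emb ex' _ \<xi>p']
    and s\<xi> = smooth_exp_fun[OF emb ex _ \<xi>p] and sH = smooth_exp_fun[OF emb ex _ hp]
  have "dfun S H q = dfun S ?h q" "dfun S ?f q = dfun S f q"
    by (rule dfun_cong[OF S openin_mfd_points[OF S] q], simp add: exp_fun_sub[OF emb ex' _ fp])+
  then have 1: "poisson_bracket M P H ?f q = poisson_bracket S PS ?h f q"
    unfolding poisson_bracket_restrict[OF PM PSub q Hs[OF q] sf] by (simp add: poisson_bracket_def)
  have "dfun M (poisson_bracket M P H ?\<xi>') q = restricted_bracket M P S (dfun M H) (nu_star_sec M S \<xi>) q"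
    by (rule restricted_bracket_exact[OF PM PSub q Hs[OF q] s\<xi>'[OF q] refl nu_star_eq_dfun[OF emb ex' \<xi>], symmetric])
  also have "\<dots> = dfun M (poisson_bracket M P ?H ?\<xi>) q"
    by (rule restricted_bracket_exact[OF PM PSub q sH[OF q] s\<xi>[OF q] dfun_eq_exp_fun[OF emb tr ex comp H] nu_star_eq_dfun[OF emb ex \<xi>]])
  finally have d: "dfun M (poisson_bracket M P H ?\<xi>') q = dfun M (poisson_bracket M P ?H ?\<xi>) q" .
  let ?w = "exp_vec M S e' q c"
  have w: "?w \<in> tangent_space M q" by (rule exp_vec_tangent[OF emb ex' z])
  have qM: "q \<in> points M" using q sub_points[OF emb] by blast
  have van: "poisson_bracket M P ?H ?\<xi> p = 0" if "p \<in> points S" for p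
    by (rule poisson_bracket_vanish[OF PM PSub that s\<xi>[OF that]]) (simp add: exp_fun_sub[OF emb ex _ \<xi>p])
  have "?w (poisson_bracket M P H ?\<xi>') = ?w (poisson_bracket M P ?H ?\<xi>)"
    using fun_cong[OF d, of ?w] by (simp add: dfun_apply[OF w])
  \<comment> \<open>The vectors that the two exponential maps attach to \<open>c\<close> lie in the
    same coset, and the bracket vanishes on \<open>S\<close>, so both give the same
    derivative.\<close>
  also have "\<dots> = exp_vec M S e q c (poisson_bracket M P ?H ?\<xi>)"
    using tangent_exp_vec_eq[OF emb ex q w smooth_poisson_bracket[OF PM PSub sH[OF q] s\<xi>[OF q]]
        smooth_fun_at_const[OF M qM, of 0] van]
      tangent_const[OF M w qM, of 0] tangent_const[OF M exp_vec_tangent[OF emb ex z] qM, of 0]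
    unfolding nu_exp_vec[OF emb ex' z] by simp
  finally show ?thesis
    unfolding first_variation_aff_fun[OF PM PSub ex' H x z] 1 exp_bracket_def by simp
qed

lemma apply_form_dfun_section:
  assumes emb: "embedded_submanifold M S" and \<mu>: "conormal_form M S \<mu>" and f: "f \<in> smooth_funs S"
  shows "apply_form \<mu> (dfun S f) \<in> conormal_sections M S"
proof -
  have "smooth_manifold S" using emb by (simp add: embedded_submanifold_def)
  note embS = embedded_submanifold_refl[OF this]
  show ?thesis
    using \<mu> f dfun_cotangent[of S f] smooth_covec_at_dfun[OF embS]
    by (simp add: conormal_sections_def conormal_form_def apply_form_def smooth_funs_def)
qed

lemma dfun_one_forms:
  assumes "smooth_manifold S" "f \<in> smooth_funs S"
  shows "dfun S f \<in> one_forms S"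
  using smooth_covec_at_dfun[OF embedded_submanifold_refl[OF assms(1)]] assms(2)
  by (simp add: one_forms_def smooth_funs_def)

theorem proposition7p8:
  fixes M S :: "('a, 'v::euclidean_space) mfd"
    and P PS :: "'a \<Rightarrow> 'a bivec"
    and H h :: "'a \<Rightarrow> real"
    and L :: "'a \<Rightarrow> 'a tvec set"
    and e e\<^sub>L :: "'a \<times> 'a tvec set \<Rightarrow> 'a"
    and \<eta> :: "'a conormal"
    and \<mu> :: "'a conormal_form"
  assumes "poisson_manifold M P"
    and "poisson_submanifold M P S PS"
    and "H \<in> smooth_funs M"
    and "transversal M S L"
    and "exponential_map M S e"
    and "exponential_map M S e\<^sub>L" and "compatible M S e\<^sub>L L"
    and "h = restrict H (points S)"
    and "\<eta> = normal_deriv M S H e\<^sub>L"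
    and "conormal_form M S \<mu>"
    and "\<forall>\<alpha>\<in>one_forms S. \<forall>q\<in>points S.
      (transv_ext_deriv M P S PS L \<mu> (dfun S h) \<alpha>
        + conormal_bracket M P S \<eta> (apply_form \<mu> \<alpha>)
        + transv_deriv M P S L \<alpha> (apply_form \<mu> (dfun S h))) q
      = (transv_deriv M P S L \<alpha> \<eta> - transv_curv M P S L (dfun S h) \<alpha>) q"
  shows "(\<exists>!\<delta>. transv_morphism M S L \<delta> \<and> determined_by M S L \<mu> \<delta>) \<and>
    (\<forall>\<delta>. transv_morphism M S L \<delta> \<and> determined_by M S L \<mu> \<delta> \<longrightarrow>
      transversal M S (shift_transversal M \<delta> L) \<and>
      hamiltonian_derivation M P S PS (shift_transversal M \<delta> L)
        (first_variation M S e (hamiltonian_vf M P H))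
        (h, \<eta> - apply_form \<mu> (dfun S h)))"
proof (intro conjI allI impI)
  note PM = assms(1) and PSub = assms(2) and H = assms(3) and tr = assms(4) and ex' = assms(5)
    and ex = assms(6) and comp = assms(7) and h = assms(8) and \<eta> = assms(9) and \<mu> = assms(10)
    and eqn = assms(11)
  note emb = poisson_embedded[OF PM PSub]
  note M = ambient_premanifold[OF emb] and S = sub_premanifold[OF emb]
  show "\<exists>!\<delta>. transv_morphism M S L \<delta> \<and> determined_by M S L \<mu> \<delta>"
    by (rule ex1_transv_morphism[OF emb tr ex comp \<mu>])
  fix \<delta> assume "transv_morphism M S L \<delta> \<and> determined_by M S L \<mu> \<delta>"
  then have \<delta>: "transv_morphism M S L \<delta>" and det: "determined_by M S L \<mu> \<delta>" by blast+
  let ?L = "shift_transversal M \<delta> L"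
  show trL: "transversal M S ?L" by (rule transversal_shift[OF emb tr \<delta>])
  note \<delta>eq = determined_by_iff[OF emb tr ex comp \<delta> \<mu>, THEN iffD1, OF det, rule_format]
  let ?m = "\<lambda>f. apply_form \<mu> (dfun S f)"
  let ?B = "exp_bracket M P S e\<^sub>L"
  have m: "?m f \<in> conormal_sections M S" if "f \<in> smooth_funs S" for f
    by (rule apply_form_dfun_section[OF emb \<mu> that])
  have zero: "0 \<in> conormal_sections M S" by (rule conormal_sections_zero[OF emb])
  have hS: "h \<in> smooth_funs S" unfolding h by (rule smooth_restrict_sub[OF emb tr ex comp H])
  have \<eta>S: "\<eta> \<in> conormal_sections M S" unfolding \<eta> by (rule normal_deriv_conormal_section[OF emb tr ex comp H])
  have \<zeta>S: "\<eta> - ?m h \<in> conormal_sections M S" by (rule conormal_sections_diff[OF emb \<eta>S m[OF hS]])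
  have pair: "(f, \<xi>) \<in> aff_pairs M S" if "f \<in> smooth_funs S" "\<xi> \<in> conormal_sections M S" for f \<xi>
    using that by (simp add: aff_pairs_def)
  have pair0: "(0, \<xi>) \<in> aff_pairs M S" if "\<xi> \<in> conormal_sections M S" for \<xi>
    by (rule pair[OF smooth_funs_zero[OF S] that])
  note tL = transversal_facts(2,4)[OF tr] and tL' = transversal_facts(2,4)[OF trL]
  have annL: "l (exp_fun M S e\<^sub>L (f, 0)) = 0" if "f \<in> smooth_funs S" "q \<in> points S" "l \<in> L q" for f q l
  proof -
    have "l \<in> tangent_space M q" using tL(1)[OF that(2)] that(3) by blast
    from exp_vec_exp_fun[OF emb ex pair[OF that(1) zero] tangent_minus_exp_vec(1)[OF emb ex that(2) this]]
    show ?thesis unfolding exp_vec_nu_transversal[OF emb tr ex comp that(2,3)] by simp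
  qed
  \<comment> \<open>On l + \<delta> l the fibre contribution \<mu> (df) (\<nu> l) is cancelled by
    the tangential one, \<delta> l f; the minus sign in \<open>determined_by\<close> is the one that
    achieves this.\<close>
  have annL': "k (exp_fun M S e\<^sub>L (f, ?m f)) = 0"
    if f: "f \<in> smooth_funs S" and q: "q \<in> points S" and k: "k \<in> ?L q" for f q k
  proof -
    let ?F = "exp_fun M S e\<^sub>L (f, ?m f)"
    obtain l where l: "l \<in> L q" "k = l + incl M q (\<delta> q l)" using k unfolding shift_transversal_def by blast
    have lT: "l \<in> tangent_space M q" using tL(1)[OF q] l(1) by blast
    note x = pair[OF f m[OF f]]
    have d: "\<delta> q l \<in> tangent_space S q" by (rule transv_morphism_tangent[OF emb tr \<delta> q l(1)])
    have "l ?F = \<mu> q (dfun S f q) (nu M S q l)"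
      using exp_vec_exp_fun[OF emb ex x tangent_minus_exp_vec(1)[OF emb ex q lT]]
      unfolding exp_vec_nu_transversal[OF emb tr ex comp q l(1)] by (simp add: apply_form_def)
    moreover have "incl M q (\<delta> q l) ?F = \<delta> q l f"
      unfolding incl_apply[OF emb smooth_exp_fun[OF emb ex q x]]
      by (rule tangent_cong[OF S d openin_mfd_points[OF S] q]) (rule exp_fun_sub[OF emb ex _ x])
    moreover have "\<delta> q l f = - \<mu> q (dfun S f q) (nu M S q l)"
      using \<delta>eq[OF q l(1) dfun_cotangent, of f] by (simp add: dfun_apply[OF d])
    ultimately show ?thesis by (simp add: l(2))
  qed
  \<comment> \<open>The original transversal is the case \<sigma> = 0 of the general formulas. The
    shifted one, in \<open>opL'\<close>, is the case \<sigma> f = \<mu> df, where curvature acquires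
    the correction term.\<close>
  have opL: "transv_deriv M P S L (dfun S g) \<zeta> q c = ?B (g, 0) (0, \<zeta>) q c"
    "transv_curv M P S L (dfun S g) (dfun S f) q c = ?B (g, 0) (f, 0) q c"
    if "g \<in> smooth_funs S" "f \<in> smooth_funs S" "\<zeta> \<in> conormal_sections M S" "(q, c) \<in> points (normal_bundle M S)"
    for f g \<zeta> q c
    using that tL zero annL
      transv_deriv_eq[where T = L and \<sigma> = "\<lambda>_. 0", OF PM PSub ex _ _ _ _ that(1,3,4)]
      transv_curv_eq[where T = L and \<sigma> = "\<lambda>_. 0", OF PM PSub ex _ _ _ _ that(1,2,4)]
    by simp_all
  have opL': "transv_deriv M P S ?L (dfun S g) \<zeta> q c = ?B (g, ?m g) (0, \<zeta>) q c"
    "transv_curv M P S ?L (dfun S g) (dfun S f) q c =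
      ?B (g, ?m g) (f, ?m f) q c - ?m (poisson_bracket S PS g f) q c"
    if "g \<in> smooth_funs S" "f \<in> smooth_funs S" "\<zeta> \<in> conormal_sections M S" "(q, c) \<in> points (normal_bundle M S)"
    for f g \<zeta> q c
    using that tL' m annL'
      transv_deriv_eq[where T = ?L and \<sigma> = ?m, OF PM PSub ex _ _ _ _ that(1,3,4)]
      transv_curv_eq[where T = ?L and \<sigma> = ?m, OF PM PSub ex _ _ _ _ that(1,2,4)]
    by simp_all
  note cb = conormal_bracket_eq[OF PM PSub ex]
  show "hamiltonian_derivation M P S PS ?L (first_variation M S e (hamiltonian_vf M P H)) (h, \<eta> - ?m h)"
    unfolding hamiltonian_derivation_def
  proof (intro conjI ballI)
    show "(h, \<eta> - ?m h) \<in> aff_pairs M S" by (rule pair[OF hS \<zeta>S])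
    fix x z assume x: "x \<in> aff_pairs M S" and z: "z \<in> points (normal_bundle M S)"
    obtain f \<xi> where fx: "x = (f, \<xi>)" by (cases x)
    obtain q c where zq: "z = (q, c)" by (cases z)
    have f: "f \<in> smooth_funs S" and \<xi>: "\<xi> \<in> conormal_sections M S" using x fx by (auto simp: aff_pairs_def)
    have z: "(q, c) \<in> points (normal_bundle M S)" using z zq by simp
    have q: "q \<in> points S" using z by (simp add: points_normal_bundle[OF emb])
    let ?k = "poisson_bracket S PS h f"
    have kS: "?k \<in> smooth_funs S" by (rule smooth_funs_sub_bracket[OF PM PSub ex hS f])
    have splitL: "?B (g, \<zeta>) y q c = ?B (g, 0) y q c + ?B (0, \<zeta>) y q c"
      if "g \<in> smooth_funs S" "\<zeta> \<in> conormal_sections M S" "y \<in> aff_pairs M S" for g \<zeta> y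
      using exp_bracket_add_left[OF PM PSub ex pair[OF that(1) zero] pair0[OF that(2)] that(3) z] by simp
    have splitR: "?B y (g, \<zeta>) q c = ?B y (g, 0) q c + ?B y (0, \<zeta>) q c"
      if "g \<in> smooth_funs S" "\<zeta> \<in> conormal_sections M S" "y \<in> aff_pairs M S" for g \<zeta> y
      using exp_bracket_add_right[OF PM PSub ex pair[OF that(1) zero] pair0[OF that(2)] that(3) z] by simp
    have diffL: "?B (0, \<eta> - ?m h) y q c = ?B (0, \<eta>) y q c - ?B (0, ?m h) y q c" if "y \<in> aff_pairs M S" for y
      using exp_bracket_add_left[OF PM PSub ex pair0[OF \<zeta>S] pair0[OF m[OF hS]] that z] by simp
    have diffR: "?B y (0, \<eta> - ?m h) q c = ?B y (0, \<eta>) q c - ?B y (0, ?m h) q c" if "y \<in> aff_pairs M S" for y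
      using exp_bracket_add_right[OF PM PSub ex pair0[OF \<zeta>S] pair0[OF m[OF hS]] that z] by simp
    note anti = exp_bracket_antisym[OF PM PSub ex _ _ z]
    have k: "oneform_bracket S PS (dfun S h) (dfun S f) q = dfun S ?k q"
      using kS q hS f by (intro oneform_bracket_dfun[OF S poisson_sub_bivector[OF PM PSub]]) (auto simp: smooth_funs_def)
    have k': "apply_form \<mu> (oneform_bracket S PS (dfun S h) (dfun S f)) q = ?m ?k q"
      by (simp add: apply_form_def k)
    \<comment> \<open>The bracket of affine functions involves the base functions through their
      differentials, so the equation is instantiated at \<alpha> = df; there the bracket of dh and
      df is d{h, f}.\<close>
    have "(transv_ext_deriv M P S PS L \<mu> (dfun S h) (dfun S f)
        + conormal_bracket M P S \<eta> (?m f) + transv_deriv M P S L (dfun S f) (?m h)) q c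
      = (transv_deriv M P S L (dfun S f) \<eta> - transv_curv M P S L (dfun S h) (dfun S f)) q c"
    proof -
      have "smooth_manifold S" using emb by (simp add: embedded_submanifold_def)
      from eqn[rule_format, OF dfun_one_forms[OF this f] q] show ?thesis by simp
    qed
    \<comment> \<open>The two occurrences of \<open>?B (f, 0) (0, ?m h)\<close> carry opposite signs
      and cancel: one stems from \<open>transv_ext_deriv\<close>, the other from the summand that
      differentiates \<mu> dh.\<close>
    then have eq: "?B (h, 0) (0, ?m f) q c - ?B (f, 0) (0, ?m h) q c - ?m ?k q c
        + ?B (0, \<eta>) (0, ?m f) q c + ?B (f, 0) (0, ?m h) q c
      = ?B (f, 0) (0, \<eta>) q c - ?B (h, 0) (f, 0) q c"
      by (simp add: transv_ext_deriv_def opL(1)[OF _ f _ z] opL(2)[OF _ _ \<eta>S z] hS f m \<eta>S cb[OF _ _ z] k')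
    have "first_variation M S e (hamiltonian_vf M P H) (q, c) (aff_fun (f, \<xi>)) =
        ?k q + ?B (h, \<eta>) (0, \<xi>) q c"
      unfolding h \<eta> by (rule first_variation_exp_bracket[OF PM PSub H tr ex' ex comp x[unfolded fx] z])
    also have "?B (h, \<eta>) (0, \<xi>) q c = ?B (h, 0) (0, \<xi>) q c + ?B (0, \<eta>) (0, \<xi>) q c"
      by (rule splitL[OF hS \<eta>S pair0[OF \<xi>]])
    \<comment> \<open>The terms in \<xi> match without the equation, since those with
      \<open>?m h\<close> cancel. By antisymmetry the terms free of \<xi> add up to B (h \<oplus>
      \<eta>, f \<oplus> \<mu> df) - \<mu> d{h, f}, which vanishes by \<open>eq\<close>.\<close>
    also have "\<dots> = ?B (h, ?m h) (0, \<xi>) q c - ?B (f, ?m f) (0, \<eta> - ?m h) q c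
        + ?B (0, \<eta> - ?m h) (0, \<xi>) q c + (?B (h, ?m h) (f, ?m f) q c - ?m ?k q c)"
    proof -
      have a: "?B (h, ?m h) (0, \<xi>) q c = ?B (h, 0) (0, \<xi>) q c + ?B (0, ?m h) (0, \<xi>) q c"
        by (rule splitL[OF hS m[OF hS] pair0[OF \<xi>]])
      have b: "?B (f, ?m f) (0, \<eta> - ?m h) q c = ?B (f, 0) (0, \<eta>) q c - ?B (f, 0) (0, ?m h) q c
          + (?B (0, ?m f) (0, \<eta>) q c - ?B (0, ?m f) (0, ?m h) q c)"
        unfolding splitL[OF f m[OF f] pair0[OF \<zeta>S]] diffR[OF pair[OF f zero]] diffR[OF pair0[OF m[OF f]]] ..
      have d: "?B (h, ?m h) (f, ?m f) q c = ?B (h, 0) (f, 0) q c + ?B (h, 0) (0, ?m f) q c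
          + (?B (0, ?m h) (f, 0) q c + ?B (0, ?m h) (0, ?m f) q c)"
        unfolding splitL[OF hS m[OF hS] pair[OF f m[OF f]]] splitR[OF f m[OF f] pair[OF hS zero]]
          splitR[OF f m[OF f] pair0[OF m[OF hS]]] ..
      show ?thesis
        using eq a b d diffL[OF pair0[OF \<xi>]] anti[OF pair0[OF m[OF hS]] pair[OF f zero]]
          anti[OF pair0[OF m[OF hS]] pair0[OF m[OF f]]] anti[OF pair0[OF m[OF f]] pair0[OF \<eta>S]]
        by linarith
    qed
    finally show "first_variation M S e (hamiltonian_vf M P H) z (aff_fun x) =
        aff_fun (aff_bracket M P S PS ?L (h, \<eta> - ?m h) x) z"
      by (simp add: zq fx aff_fun_def aff_bracket_def opL'(1)[OF _ f _ z] opL'(2)[OF _ _ \<xi> z] hS f \<xi> \<zeta>S cb[OF _ _ z])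
  qed
qed

end
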